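(* Let $C_1\in(0,1]$, $C_2\in[1,\infty)$, and suppose the design matrix $\mathbf X\in\mathbb R^{n\times p}$ satisfies $C_1\le \lambda_{\min}(\mathbf X^\top\mathbf X)/\sigma^2\le\lambda_{\max}(\mathbf X^\top\mathbf X)/\sigma^2\le C_2$, with $C_1,C_2$ free of $n,p$. Let $\mathcal P$ be a closed subset of the set of all probability measures supported on $[-1,1]$, and let $\mu^*\in\mathcal P$ be the true prior. (a) There exists a universal constant $\kappa$ such that $$\sup_{\mathbf v\in\mathbb R^p}\sup_{\mu\in\mathcal P}\Big|\log Z_p(\mathbf v,\mu)-\sup_{\boldsymbol\gamma\in\mathbb R^p}M_p(\boldsymbol\gamma,\mathbf v,\mu)\Big|\le\kappa\,p^{2/3}\,\mathrm{Tr}(A^2)^{1/3}.$$ (b) For $\boldsymbol\gamma,\mathbf v\in\mathbb R^p$ and $\mu\in\mathcal P$ set $\widetilde M_p(\boldsymbol\gamma,\mathbf v,\mu):=M_p(\boldsymbol\gamma,\mathbf v,\mu)+\sum_{i=1}^pc_\mu(0,d_i)$. Let $\hat\mu_{\mathrm{MF}}\in\mathcal P$ be any sequence (in $p$) of $\varepsilon_p$-approximate maximizers of $\mu\mapsto\sup_{\boldsymbol\gamma\in\mathbb R^p}\widetilde M_p(\boldsymbol\gamma,\mathbf w,\mu)$, i.e. $$\sup_{\mu\in\mathcal P}\sup_{\boldsymbol\gamma\in\mathbb R^p}\widetilde M_p(\boldsymbol\gamma,\mathbf w,\mu)\le\sup_{\boldsymbol\gamma\in\mathbb R^p}\widetilde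 M_p(\boldsymbol\gamma,\mathbf w,\hat\mu_{\mathrm{MF}})+\varepsilon_p .$$ If $\varepsilon_p\le p^{5/6}$ almost surely, then there exist constants $c,C$ depending only on $C_1,C_2$ such that $$\mathbb P_{\mu^*}\Big(d_{\mathcal H}^2\big(\hat\mu_{\mathrm{MF}}\star N(0,C_1^{-1}),\mu^*\star N(0,C_1^{-1})\big)>c\Big(\frac1{p^{1/6}}+\frac{\mathrm{Tr}(A^2)^{1/3}}{p^{1/3}}\Big)\Big)\le C e^{-p^{2/3}/C}.$$
   Context: Model: $\mathbf y=\mathbf X\boldsymbol\beta+\boldsymbol\varepsilon\in\mathbb R^n$, with $\mathbf X\in\mathbb R^{n\times p}$ deterministic, $\boldsymbol\varepsilon\sim N_n(\mathbf 0,\sigma^2\mathbf I)$, $\sigma^2>0$ known, and, independently of $\boldsymbol\varepsilon$, $\beta_1,\dots,\beta_p\stackrel{iid}{\sim}\mu$. $\mathbb P_\mu$ denotes the joint law of $(\mathbf y,\boldsymbol\beta)$ when the prior is $\mu$. Here $n$ and $\mathbf X$ may depend on $p$. "Closed" refers to the topology of weak convergence. $d_{\mathcal H}$ is the Hellinger distance and $\star$ denotes convolution of measures. Notation: $A\in\mathbb R^{p\times p}$ is the off-diagonal part of $\sigma^{-2}\mathbf X^\top\mathbf X$ (its diagonal entries are $0$), $\mathbf w:=\sigma^{-2}\mathbf X^\top\mathbf y$, and $d_i:=\sigma^{-2}(\mathbf X^\top\mathbf X)_{ii}$ for $i=1,\dots,p$. For a probability measure $\mu$ on $\mathbb R$ and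 $(\gamma_1,\gamma_2)\in\mathbb R\times(0,\infty)$, $$c_\mu(\gamma_1,\gamma_2):=\log\int\exp\Big(\gamma_1\beta-\frac{\gamma_2}2\beta^2\Big)d\mu(\beta),\qquad \frac{d\mu_{\gamma_1,\gamma_2}}{d\mu}(\beta):=\exp\Big(\gamma_1\beta-\frac{\gamma_2}{2}\beta^2-c_\mu(\gamma_1,\gamma_2)\Big).$$ Let $\dot c_\mu(\gamma_1,\gamma_2)=\partial c_\mu(\gamma_1,\gamma_2)/\partial\gamma_1$, the mean of $\mu_{\gamma_1,\gamma_2}$. For $\mathbf v\in\mathbb R^p$, $$Z_p(\mathbf v,\mu):=\int_{\mathbb R^p}\exp\Big(-\frac12\boldsymbol\beta^\top A\boldsymbol\beta+\mathbf v^\top\boldsymbol\beta\Big)\prod_{i=1}^pd\mu_{0,d_i}(\beta_i).$$ For $\boldsymbol\gamma\in\mathbb R^p$ let $\mathbf u^{(\mu)}(\boldsymbol\gamma)\in\mathbb R^p$ have coordinates $u_i^{(\mu)}(\gamma_i):=\dot c_\mu(\gamma_i,d_i)$, and $$M_p(\boldsymbol\gamma,\mathbf v,\mu):=-\frac12\mathbf u^{(\mu)}(\boldsymbol\gamma)^\top A\,\mathbf u^{(\mu)}(\boldsymbol\gamma)+\mathbf u^{(\mu)}(\boldsymbol\gamma)^\top\mathbf v-\sum_{i=1}^p\mathrm{D_{KL}}(\mu_{\gamma_i,d_i}\|\mu_{0,d_i}),$$ where $\mathrm{D_{KL}}(P\|Q)$ is the Kullback–Leibler divergence; equivalently the last sum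 equals $\mathbf u^{(\mu)}(\boldsymbol\gamma)^\top\boldsymbol\gamma-\sum_ic_\mu(\gamma_i,d_i)+\sum_ic_\mu(0,d_i)$. *)

theory Defs
  imports "HOL-Probability.Probability" "Jordan_Normal_Form.Spectral_Radius"
begin

(* From here on the infix dot denotes the scalar product of Jordan_Normal_Form vectors. *)
no_notation inner (infix \<open>\<bullet>\<close> 70)

text \<open>Vectors and matrices have sizes that are natural numbers, so that constants can be
  quantified outside \<open>n\<close> and \<open>p\<close>. Random vectors live on product spaces indexed by
  \<open>{..<n}\<close> or \<open>{..<p}\<close>, and \<open>vec p \<beta>\<close> turns such a point into a vector.\<close>

definition lambda_min :: "real mat \<Rightarrow> real" where
  "lambda_min B = Min (spectrum B)"

definition lambda_max :: "real mat \<Rightarrow> real" where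
  "lambda_max B = Max (spectrum B)"

definition mat_trace :: "real mat \<Rightarrow> real" where
  "mat_trace B = (\<Sum>i<dim_row B. B $$ (i, i))"


subsection \<open>Priors, exponential tilting\<close>

text \<open>The coarsest topology on Borel probability measures on the line for which
  \<open>\<mu> \<mapsto> \<integral> f d\<mu>\<close> is continuous for every bounded continuous \<open>f\<close>.\<close>

definition weak_topology :: "real measure topology" where
  "weak_topology = topology_generated_by
     {{\<mu>. real_distribution \<mu> \<and> (\<integral>x. f x \<partial>\<mu>) \<in> U} | (f :: real \<Rightarrow> real) (U :: real set).
        continuous_on UNIV f \<and> bounded (range f) \<and> open U}"

definition unit_priors :: "real measure set" where
  "unit_priors = {\<mu>. real_distribution \<mu> \<and> measure \<mu> {-1..1} = 1}"

definition cumulant :: "real measure \<Rightarrow> real \<Rightarrow> real \<Rightarrow> real" where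
  "cumulant \<mu> \<gamma>\<^sub>1 \<gamma>\<^sub>2 = ln (\<integral>\<beta>. exp (\<gamma>\<^sub>1 * \<beta> - \<gamma>\<^sub>2 / 2 * \<beta>\<^sup>2) \<partial>\<mu>)"

definition tilted :: "real measure \<Rightarrow> real \<Rightarrow> real \<Rightarrow> real measure" where
  "tilted \<mu> \<gamma>\<^sub>1 \<gamma>\<^sub>2 =
     density \<mu> (\<lambda>\<beta>. ennreal (exp (\<gamma>\<^sub>1 * \<beta> - \<gamma>\<^sub>2 / 2 * \<beta>\<^sup>2 - cumulant \<mu> \<gamma>\<^sub>1 \<gamma>\<^sub>2)))"

definition cumulant_deriv :: "real measure \<Rightarrow> real \<Rightarrow> real \<Rightarrow> real" where
  "cumulant_deriv \<mu> \<gamma>\<^sub>1 \<gamma>\<^sub>2 = deriv (\<lambda>g. cumulant \<mu> g \<gamma>\<^sub>2) \<gamma>\<^sub>1"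


subsection \<open>The regression model\<close>

definition scaled_gram :: "real \<Rightarrow> real mat \<Rightarrow> real mat" where
  "scaled_gram \<sigma> X = (1 / \<sigma>\<^sup>2) \<cdot>\<^sub>m (X\<^sup>T * X)"

definition coupling :: "real \<Rightarrow> real mat \<Rightarrow> real mat" where
  "coupling \<sigma> X = mat (dim_col X) (dim_col X)
     (\<lambda>(i, j). if i = j then 0 else scaled_gram \<sigma> X $$ (i, j))"

definition diag_coeff :: "real \<Rightarrow> real mat \<Rightarrow> nat \<Rightarrow> real" where
  "diag_coeff \<sigma> X i = scaled_gram \<sigma> X $$ (i, i)"

definition suff_stat :: "real \<Rightarrow> real mat \<Rightarrow> real vec \<Rightarrow> real vec" where
  "suff_stat \<sigma> X y = (1 / \<sigma>\<^sup>2) \<cdot>\<^sub>v (X\<^sup>T *\<^sub>v y)"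

text \<open>The law of \<open>(y, \<beta>)\<close> where \<open>y = X \<beta> + \<epsilon>\<close>, with \<open>\<epsilon>\<close> and \<open>\<beta>\<close> independent.
  The second argument of \<open>normal_density\<close> is the standard deviation.\<close>

definition joint_law :: "real \<Rightarrow> real mat \<Rightarrow> real measure \<Rightarrow> ((nat \<Rightarrow> real) \<times> (nat \<Rightarrow> real)) measure" where
  "joint_law \<sigma> X \<mu> =
     distr
       (PiM {..<dim_row X} (\<lambda>_. density lborel (normal_density 0 \<sigma>)) \<Otimes>\<^sub>M PiM {..<dim_col X} (\<lambda>_. \<mu>))
       (PiM {..<dim_row X} (\<lambda>_. borel) \<Otimes>\<^sub>M PiM {..<dim_col X} (\<lambda>_. borel))
       (\<lambda>(\<epsilon>, \<beta>). (\<lambda>k\<in>{..<dim_row X}. (X *\<^sub>v vec (dim_col X) \<beta>) $ k + \<epsilon> k, \<beta>))"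


subsection \<open>Partition function and mean-field functionals\<close>

definition partition_fun :: "real \<Rightarrow> real mat \<Rightarrow> real vec \<Rightarrow> real measure \<Rightarrow> real" where
  "partition_fun \<sigma> X v \<mu> =
     (\<integral>\<beta>. exp (- (1/2) * (vec (dim_col X) \<beta> \<bullet> (coupling \<sigma> X *\<^sub>v vec (dim_col X) \<beta>))
                 + v \<bullet> vec (dim_col X) \<beta>)
        \<partial>PiM {..<dim_col X} (\<lambda>i. tilted \<mu> 0 (diag_coeff \<sigma> X i)))"

definition mf_mean :: "real \<Rightarrow> real mat \<Rightarrow> real measure \<Rightarrow> real vec \<Rightarrow> real vec" where
  "mf_mean \<sigma> X \<mu> \<gamma> = vec (dim_col X) (\<lambda>i. cumulant_deriv \<mu> (\<gamma> $ i) (diag_coeff \<sigma> X i))"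

text \<open>The library's \<open>KL_divergence b Q P\<close> is the divergence of \<open>P\<close> from \<open>Q\<close>,
  that is \<open>D(P || Q)\<close>, in base \<open>b\<close>.\<close>

definition mf_objective :: "real \<Rightarrow> real mat \<Rightarrow> real vec \<Rightarrow> real vec \<Rightarrow> real measure \<Rightarrow> real" where
  "mf_objective \<sigma> X \<gamma> v \<mu> =
     - (1/2) * (mf_mean \<sigma> X \<mu> \<gamma> \<bullet> (coupling \<sigma> X *\<^sub>v mf_mean \<sigma> X \<mu> \<gamma>))
     + mf_mean \<sigma> X \<mu> \<gamma> \<bullet> v
     - (\<Sum>i<dim_col X. KL_divergence (exp 1) (tilted \<mu> 0 (diag_coeff \<sigma> X i))
                                             (tilted \<mu> (\<gamma> $ i) (diag_coeff \<sigma> X i)))"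

definition mf_objective_shifted :: "real \<Rightarrow> real mat \<Rightarrow> real vec \<Rightarrow> real vec \<Rightarrow> real measure \<Rightarrow> real" where
  "mf_objective_shifted \<sigma> X \<gamma> v \<mu> =
     mf_objective \<sigma> X \<gamma> v \<mu> + (\<Sum>i<dim_col X. cumulant \<mu> 0 (diag_coeff \<sigma> X i))"


subsection \<open>Hellinger distance\<close>

text \<open>\<open>M\<close> is any sigma-finite measure that dominates \<open>P\<close> and \<open>Q\<close>; the value does not depend
  on its choice.\<close>

definition hellinger_dist :: "'a measure \<Rightarrow> 'a measure \<Rightarrow> 'a measure \<Rightarrow> real" where
  "hellinger_dist M P Q =
     sqrt (1/2 * (\<integral>x. (sqrt (enn2real (RN_deriv M P x)) - sqrt (enn2real (RN_deriv M Q x)))\<^sup>2 \<partial>M))"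

end

theory Submission
  imports Defs
begin

text \<open>
  (a) The lower bound on \<open>log Z\<close> is Jensen's inequality for the tilted product measure. For the upper bound, a Gibbs
  measure whose coordinates have small covariances is nearly a product measure with respect to the quadratic energy, so
  \<open>log Z\<close> is bounded by the mean-field value at its mean vector, plus half the Frobenius norm of \<open>A\<close> times that of
  the covariance matrix. Observing a noisy sign of a single coordinate splits a Gibbs measure in two; this costs entropy
  at most \<open>log 2\<close> and lowers the total variance, which is at most \<open>p\<close>, as long as the covariances are large.
  Balancing the two costs gives \<open>(p |A|)\<^sup>2\<^sup>/\<^sup>3\<close>.

  (b) By (a) the mean-field estimator nearly maximizes the marginal likelihood, which is a function of the Gaussian
  vector \<open>w\<close> with covariance \<open>G \<ge> C1 I\<close>. Splitting off an isotropic part of \<open>w\<close> shows that the Hellinger affinity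
  of two marginal likelihoods is at most the \<open>p\<close>-th power of the affinity of the two convolved priors. A union bound over
  a net of discrete priors, whose logarithmic size is a power of \<open>p\<close> smaller than \<open>p\<^sup>5\<^sup>/\<^sup>6\<close>, gives the rate.
\<close>

section \<open>Quadratic forms and density of a finite product measure\<close>

text \<open>The splitting in (a) never follows a sequence of conditionings. A noisy sign shown with
  probabilities (1 + X/2)/2 and (1 - X/2)/2 keeps every weight positive and bounded, so log-mass
  minus a multiple of the total variance has a finite supremum over all weights below the Gibbs
  weight. A gain of ln 2 at every weight with large covariances is incompatible with a positive
  supremum. Positivity of the weights also makes their coordinate means attainable by exponential
  tilts.

  In (b) the obstacle is that the likelihood involves a p-fold product of the prior: absolute
  closeness of cell masses is lost in the product, while a relative error 1/N per coordinate costs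
  only exp(p/N). The net therefore dominates priors from above, in one direction only; this suffices
  because the likelihood of a near maximizer has to be passed on to a net point, never back. Net
  points need not lie in P, since they enter only through their likelihood and their affinity with
  the true prior. With N of order p^(1/6) the loss p/N is p^(5/6), the order of the allowed
  optimization error, and the crude net entropy N^3 is only p^(1/2).\<close>

definition bilin :: "'i set \<Rightarrow> ('i \<Rightarrow> 'i \<Rightarrow> real) \<Rightarrow> ('i \<Rightarrow> real) \<Rightarrow> ('i \<Rightarrow> real) \<Rightarrow> real" where
  "bilin I Q x y = (\<Sum>i\<in>I. \<Sum>j\<in>I. Q i j * x i * y j)"

lemma bilin_commute:
  assumes "\<And>i j. i \<in> I \<Longrightarrow> j \<in> I \<Longrightarrow> Q i j = Q j i"
  shows "bilin I Q x y = bilin I Q y x"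
  unfolding bilin_def by (subst sum.swap) (auto intro!: sum.cong simp: assms mult_ac)

lemma bilin_add_left: "bilin I Q (\<lambda>i. x i + x' i) y = bilin I Q x y + bilin I Q x' y"
  by (simp add: bilin_def algebra_simps sum.distrib)

lemma bilin_add_right: "bilin I Q y (\<lambda>i. x i + x' i) = bilin I Q y x + bilin I Q y x'"
  by (simp add: bilin_def algebra_simps sum.distrib)

lemma bilin_scale_left: "bilin I Q (\<lambda>i. t * x i) y = t * bilin I Q x y"
  by (simp add: bilin_def sum_distrib_left mult_ac)

lemma bilin_scale_right: "bilin I Q y (\<lambda>i. t * x i) = t * bilin I Q y x"
  by (simp add: bilin_def sum_distrib_left mult_ac)

lemma bilin_shift:
  assumes "finite I"
  shows "bilin I (\<lambda>i j. Q i j - (if i = j then c else 0)) x x = bilin I Q x x - c * (\<Sum>i\<in>I. (x i)\<^sup>2)"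
proof -
  have "(\<Sum>j\<in>I. (Q i j - (if i = j then c else 0)) * x i * x j) = (\<Sum>j\<in>I. Q i j * x i * x j) - c * (x i)\<^sup>2"
    if "i \<in> I" for i
  proof -
    have "(\<Sum>j\<in>I. (if i = j then c else 0) * x i * x j) = (\<Sum>j\<in>I. if i = j then c * x i * x j else 0)"
      by (intro sum.cong) auto
    also have "\<dots> = c * (x i)\<^sup>2" using that assms by (simp add: power2_eq_square)
    finally show ?thesis by (simp add: left_diff_distrib sum_subtractf)
  qed
  then show ?thesis unfolding bilin_def by (simp add: sum_subtractf sum_distrib_left)
qed

text \<open>A nonzero linear term dominates near t = 0. The point t = -b/k with k = |a| + 1 works
  for every sign of a and gives a value of at most -b^2/k.\<close>

lemma nonneg_quadratic_no_linear_term: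
  fixes a b :: real
  assumes "\<And>t. 0 \<le> 2 * t * b + t\<^sup>2 * a"
  shows "b = 0"
proof -
  define k where "k = \<bar>a\<bar> + 1"
  have k: "0 < k" "a \<le> k" by (auto simp: k_def)
  have "0 \<le> 2 * (- b / k) * b + (- b / k)\<^sup>2 * a" by (rule assms)
  also have "\<dots> \<le> 2 * (- b / k) * b + (- b / k)\<^sup>2 * k"
    using k by (intro add_left_mono mult_left_mono) auto
  also have "\<dots> = - (b\<^sup>2 / k)" using k by (simp add: field_simps power2_eq_square)
  finally have "b\<^sup>2 \<le> 0" using k by (simp add: divide_le_0_iff)
  then show ?thesis by simp
qed

text \<open>x minimizes the form, so the first variation in every direction y vanishes.
  Equivalently, a null vector of a positive semidefinite form lies in the kernel of its
  matrix.\<close>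

lemma bilin_psd_null:
  assumes sym: "\<And>i j. i \<in> I \<Longrightarrow> j \<in> I \<Longrightarrow> Q i j = Q j i"
    and psd: "\<And>x. 0 \<le> bilin I Q x x" and x: "bilin I Q x x = 0"
  shows "bilin I Q y x = 0"
proof (rule nonneg_quadratic_no_linear_term)
  fix t
  have "bilin I Q (\<lambda>i. x i + t * y i) (\<lambda>i. x i + t * y i) = 2 * t * bilin I Q y x + t\<^sup>2 * bilin I Q y y"
    using bilin_commute[of I Q x y] sym x
    by (simp add: bilin_add_left bilin_add_right bilin_scale_left bilin_scale_right power2_eq_square)
  with psd show "0 \<le> 2 * t * bilin I Q y x + t\<^sup>2 * bilin I Q y y" by metis
qed

lemma bilin_unit_left:
  assumes "finite I" "a \<in> I"
  shows "bilin I Q (\<lambda>i. if i = a then 1 else 0) x = (\<Sum>j\<in>I. Q a j * x j)"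
proof -
  have "bilin I Q (\<lambda>i. if i = a then 1 else 0) x = (\<Sum>i\<in>I. if i = a then \<Sum>j\<in>I. Q i j * x j else 0)"
    unfolding bilin_def by (intro sum.cong) auto
  then show ?thesis using assms by simp
qed

text \<open>The form is nonnegative at s x + y and at s x - y; the two signs produce the absolute
  value.\<close>

lemma bilin_AM_GM:
  assumes psd: "\<And>x. 0 \<le> bilin I Q x x" and sym: "\<And>i j. i \<in> I \<Longrightarrow> j \<in> I \<Longrightarrow> Q i j = Q j i" and s: "0 < s"
  shows "2 * \<bar>bilin I Q x y\<bar> \<le> s * bilin I Q x x + bilin I Q y y / s"
proof -
  have "0 \<le> bilin I Q (\<lambda>i. s * x i + e * y i) (\<lambda>i. s * x i + e * y i)" for e by (rule psd)
  then have "0 \<le> s\<^sup>2 * bilin I Q x x + 2 * e * s * bilin I Q x y + e\<^sup>2 * bilin I Q y y" for e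
    using bilin_commute[of I Q x y] sym
    by (simp add: bilin_add_left bilin_add_right bilin_scale_left bilin_scale_right power2_eq_square algebra_simps)
  from this[of 1] this[of "-1"] have "2 * s * \<bar>bilin I Q x y\<bar> \<le> s\<^sup>2 * bilin I Q x x + bilin I Q y y" using s by (simp add: abs_if)
  then show ?thesis using s by (simp add: field_simps power2_eq_square)
qed

text \<open>The Rayleigh minimizer x on the unit sphere makes Q - l I positive semidefinite with
  null vector x, so \<open>bilin_psd_null\<close> tested against unit vectors yields the eigenvector
  equation.\<close>

lemma symmetric_min_eigenvector:
  fixes Q :: "nat \<Rightarrow> nat \<Rightarrow> real"
  assumes p: "0 < p" and sym: "\<And>i j. i < p \<Longrightarrow> j < p \<Longrightarrow> Q i j = Q j i"
  obtains x l where "\<exists>i<p. x i \<noteq> 0" "\<And>i. i < p \<Longrightarrow> (\<Sum>j<p. Q i j * x j) = l * x i"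
    "\<And>y. l * (\<Sum>i<p. (y i)\<^sup>2) \<le> bilin {..<p} Q y y"
proof -
  \<comment> \<open>The unit sphere of dimension p inside the functions on all naturals: coordinates
    from p on are frozen at 0, so the surrounding box is compact in the product topology.\<close>
  define K where "K = (PiE UNIV (\<lambda>i. if i < p then {-1..1::real} else {0})) \<inter> {x. (\<Sum>i<p. (x i)\<^sup>2) = 1}"
  have c1: "compact (PiE UNIV (\<lambda>i::nat. if i < p then {-1..1::real} else {0}))"
  proof -
    have "compactin (product_topology (\<lambda>_. euclidean) UNIV) (PiE UNIV (\<lambda>i::nat. if i < p then {-1..1::real} else {0}))"
      by (subst compactin_PiE) (auto simp: compactin_euclidean_iff)
    then show ?thesis by (simp add: euclidean_product_topology compactin_euclidean_iff)
  qed
  have "closed {x :: nat \<Rightarrow> real. (\<Sum>i<p. (x i)\<^sup>2) = 1}"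
    by (intro closed_Collect_eq continuous_on_sum continuous_on_power continuous_on_const continuous_on_product_coordinates)
  with c1 have K: "compact K" unfolding K_def by (rule compact_Int_closed)
  have "(\<lambda>i. if i = 0 then 1 else 0) \<in> K"
    using p by (auto simp: K_def if_distrib[of "\<lambda>x. x\<^sup>2"] cong: if_cong)
  then have "K \<noteq> {}" by auto
  moreover have "continuous_on K (\<lambda>x. bilin {..<p} Q x x)"
    unfolding bilin_def
    by (intro continuous_on_sum continuous_on_mult continuous_on_const continuous_on_subset[OF continuous_on_product_coordinates] subset_UNIV)
  ultimately obtain x where x: "x \<in> K" and min: "\<And>y. y \<in> K \<Longrightarrow> bilin {..<p} Q x x \<le> bilin {..<p} Q y y"
    using continuous_attains_inf[OF K] by blast
  define l where "l = bilin {..<p} Q x x"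
  have x1: "(\<Sum>i<p. (x i)\<^sup>2) = 1" using x by (simp add: K_def)
  have ray: "l * (\<Sum>i<p. (y i)\<^sup>2) \<le> bilin {..<p} Q y y" for y
  proof (cases "(\<Sum>i<p. (y i)\<^sup>2) = 0")
    case True
    then have "\<forall>i<p. y i = 0" by (simp add: sum_nonneg_eq_0_iff)
    then show ?thesis using True by (simp add: bilin_def)
  next
    case False
    define n where "n = sqrt (\<Sum>i<p. (y i)\<^sup>2)"
    have n: "0 < n" "n\<^sup>2 = (\<Sum>i<p. (y i)\<^sup>2)" using False sum_nonneg[of "{..<p}" "\<lambda>i. (y i)\<^sup>2"] by (auto simp: n_def less_le)
    define z where "z i = (if i < p then y i / n else 0)" for i
    have z1: "(\<Sum>i<p. (z i)\<^sup>2) = 1" using n False by (simp add: z_def power_divide flip: sum_divide_distrib)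
    have z2: "-1 \<le> z i \<and> z i \<le> 1" if "i < p" for i
    proof -
      have "(z i)\<^sup>2 \<le> (\<Sum>i<p. (z i)\<^sup>2)" using that by (intro member_le_sum) auto
      then have "\<bar>z i\<bar> \<le> 1" using z1 by (simp add: abs_square_le_1)
      then show ?thesis by linarith
    qed
    have "z i \<in> (if i < p then {-1..1} else {0})" for i
      using z2[of i] by (simp add: z_def)
    then have "z \<in> K" using z1 by (simp add: K_def PiE_iff)
    from min[OF this] have "l \<le> bilin {..<p} Q z z" by (simp add: l_def)
    also have "\<dots> = bilin {..<p} Q (\<lambda>i. inverse n * y i) (\<lambda>i. inverse n * y i)"
      unfolding bilin_def by (intro sum.cong) (auto simp: z_def field_simps)
    also have "\<dots> = bilin {..<p} Q y y / n\<^sup>2" by (simp only: bilin_scale_left bilin_scale_right) (simp add: field_simps power2_eq_square)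
    finally have "l * n\<^sup>2 \<le> bilin {..<p} Q y y" using n(1) by (simp add: pos_le_divide_eq)
    then show ?thesis using n(2) by simp
  qed
  define Q' where "Q' i j = Q i j - (if i = j then l else 0)" for i j
  have Q': "bilin {..<p} Q' y y = bilin {..<p} Q y y - l * (\<Sum>i<p. (y i)\<^sup>2)" for y
    unfolding Q'_def by (rule bilin_shift) simp
  have ev: "(\<Sum>j<p. Q i j * x j) = l * x i" if "i < p" for i
  proof -
    have "bilin {..<p} Q' (\<lambda>k. if k = i then 1 else 0) x = 0"
    proof (rule bilin_psd_null)
      show "Q' i j = Q' j i" if "i \<in> {..<p}" "j \<in> {..<p}" for i j using that sym[of i j] by (simp add: Q'_def)
      show "0 \<le> bilin {..<p} Q' y y" for y using ray[of y] by (simp add: Q')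
      show "bilin {..<p} Q' x x = 0" using x1 by (simp only: Q') (simp add: l_def)
    qed
    then have "(\<Sum>j<p. Q' i j * x j) = 0" using that by (simp add: bilin_unit_left)
    moreover have "(\<Sum>j<p. Q' i j * x j) = (\<Sum>j<p. Q i j * x j - (if i = j then l * x j else 0))"
      unfolding Q'_def by (intro sum.cong) (auto simp: algebra_simps)
    ultimately show ?thesis using that by (simp add: sum_subtractf)
  qed
  have "\<exists>i<p. x i \<noteq> 0" using x1 by (rule contrapos_pp) simp
  from that[OF this ev ray] show ?thesis by blast
qed

text \<open>Cholesky factorization by induction on the index set: remove the rank-one part
  \<open>t i * t j\<close> belonging to the new index and factor the Schur complement
  \<open>R'\<close> on the remaining ones.\<close>

lemma psd_factorization:
  assumes "finite I" "\<And>i j. i \<in> I \<Longrightarrow> j \<in> I \<Longrightarrow> R i j = R j i" "\<And>x. 0 \<le> bilin I R x x"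
  shows "\<exists>s. \<forall>i\<in>I. \<forall>j\<in>I. R i j = (\<Sum>k\<in>I. s k i * s k j)"
  using assms
proof (induction arbitrary: R rule: finite_induct)
  case (insert a I)
  note sym = insert.prems(1) and psd = insert.prems(2)
  have fin: "finite (insert a I)" using insert by simp
  have Raa: "0 \<le> R a a"
    using psd[of "\<lambda>i. if i = a then 1 else 0"] fin by (simp add: bilin_unit_left if_distrib cong: if_cong)
  have null: "R a j = 0" if "R a a = 0" "j \<in> I" for j
  proof -
    have "bilin (insert a I) R (\<lambda>i. if i = j then 1 else 0) (\<lambda>i. if i = a then 1 else 0) = 0"
      by (rule bilin_psd_null[OF sym psd]) (use fin that in \<open>simp_all add: bilin_unit_left if_distrib cong: if_cong\<close>)
    then show ?thesis using fin that sym[of a j] by (simp add: bilin_unit_left if_distrib cong: if_cong)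
  qed
  \<comment> \<open>For a zero pivot the row of \<open>a\<close> vanishes by \<open>null\<close>,
    and division by 0 yields 0, so \<open>t\<close> is zero as it should be.\<close>
  define t where "t j = R a j / sqrt (R a a)" for j
  define R' where "R' i j = R i j - t i * t j" for i j
  have ta: "t a * t j = R a j" if "j \<in> insert a I" for j
    using Raa null[of j] that by (auto simp: t_def field_simps real_div_sqrt)
  have psd': "0 \<le> bilin I R' x x" for x
  proof -
    define b where "b = (\<Sum>j\<in>I. t j * x j)"
    \<comment> \<open>The entry at \<open>a\<close> minimizes the form over that coordinate; the
      form at \<open>y\<close> is then the Schur complement form at \<open>x\<close>.\<close>
    define y where "y = (\<lambda>i. if i = a then - b / sqrt (R a a) else x i)"
    have a: "a \<notin> I" by fact
    have I: "(\<Sum>i\<in>I. f i (y i)) = (\<Sum>i\<in>I. f i (x i))" for f :: "_ \<Rightarrow> _ \<Rightarrow> real"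
      using a by (intro sum.cong) (auto simp: y_def)
    have Rb: "(\<Sum>j\<in>I. R a j * x j) = sqrt (R a a) * b"
      unfolding b_def sum_distrib_left
      using Raa null by (intro sum.cong) (auto simp: t_def)
    have "bilin (insert a I) R y y = R a a * y a * y a + 2 * y a * (\<Sum>j\<in>I. R a j * y j) + bilin I R y y"
    proof -
      have "(\<Sum>i\<in>I. R i a * y i * y a) = (\<Sum>j\<in>I. R a j * y a * y j)"
        using sym by (intro sum.cong) auto
      then show ?thesis
        using insert(1) a by (simp add: bilin_def sum.distrib) (simp add: mult_ac sum_distrib_left)
    qed
    also have "(\<Sum>j\<in>I. R a j * y j) = sqrt (R a a) * b" using I[of "\<lambda>j z. R a j * z"] Rb by simp
    also have "bilin I R y y = bilin I R x x" unfolding bilin_def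
      using a by (intro sum.cong) (auto simp: y_def)
    also have "R a a * y a * y a + 2 * y a * (sqrt (R a a) * b) = - b\<^sup>2"
    proof (cases "R a a = 0")
      case True then show ?thesis using null by (simp add: b_def t_def)
    next
      case False
      then show ?thesis using Raa by (simp add: y_def field_simps power2_eq_square)
    qed
    finally have "- b\<^sup>2 + bilin I R x x \<ge> 0" using psd[of y] by simp
    moreover have "bilin I R' x x = bilin I R x x - b\<^sup>2"
      unfolding R'_def bilin_def b_def power2_eq_square sum_product
      by (simp add: algebra_simps sum_subtractf)
    ultimately show ?thesis by simp
  qed
  obtain s where s: "\<forall>i\<in>I. \<forall>j\<in>I. R' i j = (\<Sum>k\<in>I. s k i * s k j)"
  proof -
    have "R' i j = R' j i" if "i \<in> I" "j \<in> I" for i j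
      using sym[of i j] that by (simp add: R'_def mult.commute)
    from insert.IH[OF this psd'] show ?thesis using that by blast
  qed
  \<comment> \<open>\<open>t\<close> is the new factor vector; the old ones are extended by 0 at
    \<open>a\<close>.\<close>
  define s' where "s' k j = (if k = a then t j else if j = a then 0 else s k j)" for k j
  have "R i j = (\<Sum>k\<in>insert a I. s' k i * s' k j)" if "i \<in> insert a I" "j \<in> insert a I" for i j
  proof -
    have *: "(\<Sum>k\<in>I. s' k i * s' k j) = (if i = a \<or> j = a then 0 else R' i j)"
    proof (cases "i = a \<or> j = a")
      case True
      then show ?thesis using insert(2) by (auto simp: s'_def intro!: sum.neutral)
    next
      case False
      then have "R' i j = (\<Sum>k\<in>I. s k i * s k j)" using s that by auto
      also have "\<dots> = (\<Sum>k\<in>I. s' k i * s' k j)" using insert(2) False by (intro sum.cong) (auto simp: s'_def)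
      finally show ?thesis using False by simp
    qed
    have "(\<Sum>k\<in>insert a I. s' k i * s' k j) = t i * t j + (if i = a \<or> j = a then 0 else R' i j)"
      using insert(1,2) by (simp add: * ) (simp add: s'_def)
    also have "\<dots> = R i j" using ta[of i] ta[of j] that sym[of i j] by (auto simp: R'_def mult_ac)
    finally show ?thesis ..
  qed
  then show ?case by blast
qed simp

text \<open>Agreement on boxes suffices, and there the integral of the product density factors.
  Serves both the tilting of product priors and the translation of Gaussian noise.\<close>

lemma PiM_density:
  fixes M :: "'i \<Rightarrow> 'a measure" and h :: "'i \<Rightarrow> 'a \<Rightarrow> ennreal"
  assumes I: "finite I" and M: "\<And>i. sigma_finite_measure (M i)" and h: "\<And>i. h i \<in> borel_measurable (M i)"
    and D: "\<And>i. sigma_finite_measure (density (M i) (h i))"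
  shows "PiM I (\<lambda>i. density (M i) (h i)) = density (PiM I M) (\<lambda>x. \<Prod>i\<in>I. h i (x i))"
proof -
  interpret M: product_sigma_finite M by (simp add: product_sigma_finite_def M)
  interpret D: product_sigma_finite "\<lambda>i. density (M i) (h i)" by (simp add: product_sigma_finite_def D)
  note h[measurable]
  show ?thesis
  proof (rule D.PiM_eqI[symmetric])
    show "finite I" by fact
    show "sets (density (PiM I M) (\<lambda>x. \<Prod>i\<in>I. h i (x i))) = sets (PiM I (\<lambda>i. density (M i) (h i)))"
      by (simp cong: sets_PiM_cong)
    fix A assume "\<And>i. i \<in> I \<Longrightarrow> A i \<in> sets (density (M i) (h i))"
    then have A: "\<And>i. i \<in> I \<Longrightarrow> A i \<in> sets (M i)" by simp
    have PA: "Pi\<^sub>E I A \<in> sets (PiM I M)" using A I by simp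
    have "emeasure (density (PiM I M) (\<lambda>x. \<Prod>i\<in>I. h i (x i))) (Pi\<^sub>E I A)
        = (\<integral>\<^sup>+x. (\<Prod>i\<in>I. h i (x i)) * indicator (Pi\<^sub>E I A) x \<partial>PiM I M)"
      using PA by (subst emeasure_density) auto
    also have "\<dots> = (\<integral>\<^sup>+x. (\<Prod>i\<in>I. h i (x i) * indicator (A i) (x i)) \<partial>PiM I M)"
    proof (intro nn_integral_cong)
      fix x assume "x \<in> space (PiM I M)"
      then have ext: "x \<in> extensional I" by (simp add: space_PiM PiE_def)
      have "(\<Prod>i\<in>I. indicator (A i) (x i) :: ennreal) = indicator (Pi\<^sub>E I A) x"
      proof (cases "x \<in> Pi\<^sub>E I A")
        case False
        then obtain i where "i \<in> I" "x i \<notin> A i" using ext by (auto simp: PiE_iff)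
        then have "(\<Prod>i\<in>I. indicator (A i) (x i) :: ennreal) = 0" using I by (intro prod_zero bexI[of _ i]) auto
        then show ?thesis using False by simp
      next
        case True
        then show ?thesis by (auto simp: PiE_iff intro!: prod.neutral)
      qed
      then show "(\<Prod>i\<in>I. h i (x i)) * indicator (Pi\<^sub>E I A) x = (\<Prod>i\<in>I. h i (x i) * indicator (A i) (x i))"
        by (simp add: prod.distrib)
    qed
    also have "\<dots> = (\<Prod>i\<in>I. \<integral>\<^sup>+x. h i x * indicator (A i) x \<partial>M i)"
      using A by (intro M.product_nn_integral_prod I) auto
    also have "\<dots> = (\<Prod>i\<in>I. emeasure (density (M i) (h i)) (A i))"
      using A by (intro prod.cong) (auto simp: emeasure_density)
    finally show "emeasure (density (PiM I M) (\<lambda>x. \<Prod>i\<in>I. h i (x i))) (Pi\<^sub>E I A) =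
        (\<Prod>i\<in>I. emeasure (density (M i) (h i)) (A i))" .
  qed
qed

section \<open>Uniqueness of characteristic functions on finite products\<close>

text \<open>Levy's uniqueness theorem compares probability laws, while \<open>q\<close> is a signed
  weight. The law of \<open>Y\<close> under the density (2 + q)/c and its unweighted law are both
  determined by the hypotheses; the weighted integral is c times the first minus twice the
  second.\<close>

lemma (in prob_space) weighted_char_unique:
  fixes q :: "'a \<Rightarrow> real" and q' :: "'b \<Rightarrow> real"
  assumes M': "prob_space M'"
    and Y[measurable]: "Y \<in> borel_measurable M" "Y' \<in> borel_measurable M'"
    and q[measurable]: "q \<in> borel_measurable M" "q' \<in> borel_measurable M'"
    and q1: "\<And>x. \<bar>q x\<bar> \<le> 1" "\<And>x. \<bar>q' x\<bar> \<le> 1"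
    and ch: "\<And>s. (CLINT x|M. iexp (s * Y x)) = (CLINT x|M'. iexp (s * Y' x))"
    and chq: "\<And>s. (CLINT x|M. q x *\<^sub>R iexp (s * Y x)) = (CLINT x|M'. q' x *\<^sub>R iexp (s * Y' x))"
    and B[measurable]: "B \<in> sets borel"
  shows "(\<integral>x. q x * indicator B (Y x) \<partial>M) = (\<integral>x. q' x * indicator B (Y' x) \<partial>M')"
proof -
  define c where "c = 2 + (\<integral>x. q x \<partial>M)"
  \<comment> \<open>Frequency 0 in \<open>chq\<close> equates the two totals, so one normalizer
    serves both spaces.\<close>
  have c': "c = 2 + (\<integral>x. q' x \<partial>M')"
    using chq[of 0] by (simp add: c_def scaleR_conv_of_real del: of_real_eq_iff) (metis Re_complex_of_real)
  interpret M': prob_space M' by fact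
  have iq: "integrable M q" "integrable M' q'"
    using q1 by (auto intro!: integrable_const_bound[of _ 1] M'.integrable_const_bound[of _ 1])
  have "-1 \<le> (\<integral>x. q x \<partial>M)"
    using q1 iq by (intro order_trans[OF _ integral_mono[of M "\<lambda>_. -1" q]]) (auto simp: prob_space abs_le_iff intro: minus_le_iff[THEN iffD1])
  then have c: "0 < c" by (simp add: c_def)
  have *: "real_distribution (distr (density N (\<lambda>x. ennreal ((2 + r x) / c))) borel Z)
       \<and> (\<forall>s. char (distr (density N (\<lambda>x. ennreal ((2 + r x) / c))) borel Z) s
             = (2 * (CLINT x|N. iexp (s * Z x)) + (CLINT x|N. r x *\<^sub>R iexp (s * Z x))) / c)
       \<and> measure (distr (density N (\<lambda>x. ennreal ((2 + r x) / c))) borel Z) B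
             = (2 * (\<integral>x. indicator B (Z x) \<partial>N) + (\<integral>x. r x * indicator B (Z x) \<partial>N)) / c"
    if N: "prob_space N" and [measurable]: "Z \<in> borel_measurable N" "r \<in> borel_measurable N"
      and r1: "\<And>x. \<bar>r x\<bar> \<le> 1" and cr: "c = 2 + (\<integral>x. r x \<partial>N)" for N :: "'c measure" and r :: "'c \<Rightarrow> real" and Z
  proof -
    interpret N: prob_space N by fact
    have ir: "integrable N r" using r1 by (auto intro!: N.integrable_const_bound[of _ 1])
    have r0: "0 \<le> (2 + r x) / c" for x using r1[of x] c by (auto simp: abs_le_iff)
    let ?D = "density N (\<lambda>x. ennreal ((2 + r x) / c))"
    have "emeasure ?D (space ?D) = (\<integral>\<^sup>+x. ennreal ((2 + r x) / c) \<partial>N)"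
      by (subst emeasure_density) (auto intro!: nn_integral_cong)
    also have "\<dots> = ennreal (\<integral>x. (2 + r x) / c \<partial>N)"
      using r0 ir by (intro nn_integral_eq_integral) auto
    also have "(\<integral>x. (2 + r x) / c \<partial>N) = 1" using ir c by (simp add: N.prob_space cr)
    finally interpret D: prob_space ?D by (intro prob_spaceI) simp
    have rd: "real_distribution (distr ?D borel Z)" by (intro D.real_distribution_distr) simp
    have i1: "integrable N (\<lambda>x. iexp (s * Z x))" for s by (intro N.integrable_const_bound[of _ 1]) auto
    have i2: "integrable N (\<lambda>x. r x *\<^sub>R iexp (s * Z x))" for s
      using r1 by (intro N.integrable_const_bound[of _ 1]) auto
    have "char (distr ?D borel Z) s = (CLINT x|N. ((2 + r x) / c) *\<^sub>R iexp (s * Z x))" for s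
      unfolding char_def using r0 by (subst integral_distr) (auto simp: integral_density)
    also have "\<dots>s = (CLINT x|N. (2 * iexp (s * Z x) + r x *\<^sub>R iexp (s * Z x)) / c)" for s
      by (intro Bochner_Integration.integral_cong) (auto simp: scaleR_conv_of_real field_simps)
    also have "\<dots>s = (2 * (CLINT x|N. iexp (s * Z x)) + (CLINT x|N. r x *\<^sub>R iexp (s * Z x))) / c" for s
      using i1[of s] i2[of s] by simp
    finally have ch: "char (distr ?D borel Z) s = (2 * (CLINT x|N. iexp (s * Z x)) + (CLINT x|N. r x *\<^sub>R iexp (s * Z x))) / c" for s .
    have i3: "integrable N (\<lambda>x. indicator B (Z x) :: real)" "integrable N (\<lambda>x. r x * indicator B (Z x))"
      using r1 by (auto intro!: N.integrable_const_bound[of _ 1] simp: indicator_def)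
    have "measure (distr ?D borel Z) B = (\<integral>x. indicator B x \<partial>distr ?D borel Z)"
      by (subst Bochner_Integration.integral_indicator) simp_all
    also have "\<dots> = (\<integral>x. ((2 + r x) / c) * indicator B (Z x) \<partial>N)"
      using r0 by (subst integral_distr) (auto simp: integral_density)
    also have "\<dots> = (\<integral>x. (2 * indicator B (Z x) + r x * indicator B (Z x)) / c \<partial>N)"
      by (intro Bochner_Integration.integral_cong) (auto simp: field_simps)
    also have "\<dots> = (2 * (\<integral>x. indicator B (Z x) \<partial>N) + (\<integral>x. r x * indicator B (Z x) \<partial>N)) / c"
      using i3 by simp
    finally show ?thesis using rd ch by blast
  qed
  note a = *[OF prob_space_axioms Y(1) q(1) q1(1) c_def] and b = *[OF M' Y(2) q(2) q1(2) c']
  have "distr (density M (\<lambda>x. ennreal ((2 + q x) / c))) borel Y = distr (density M' (\<lambda>x. ennreal ((2 + q' x) / c))) borel Y'"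
    using a b ch chq by (intro Levy_uniqueness) auto
  then have "(2 * (\<integral>x. indicator B (Y x) \<partial>M) + (\<integral>x. q x * indicator B (Y x) \<partial>M)) =
        (2 * (\<integral>x. indicator B (Y' x) \<partial>M') + (\<integral>x. q' x * indicator B (Y' x) \<partial>M'))"
    using a b c by simp
  moreover have "distr M borel Y = distr M' borel Y'"
    using ch by (intro Levy_uniqueness) (auto simp: char_def integral_distr)
  then have "(\<integral>x. indicator B x \<partial>distr M borel Y) = (\<integral>x. indicator B x \<partial>distr M' borel Y' :: real)" by simp
  then have "(\<integral>x. indicator B (Y x) \<partial>M) = (\<integral>x. indicator B (Y' x) \<partial>M' :: real)"
    by (simp add: integral_distr del: Bochner_Integration.integral_indicator)
  ultimately show ?thesis by linarith
qed

lemma iexp_cos_sin: "iexp x = complex_of_real (cos x) + \<i> * complex_of_real (sin x)"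
  by (simp add: cis_conv_exp[symmetric] complex_eq_iff)

lemma iexp_add_diff:
  "iexp (a + 1 * b) = iexp a * (complex_of_real (cos b) + \<i> * complex_of_real (sin b))"
  "iexp (a + (-1) * b) = iexp a * (complex_of_real (cos b) - \<i> * complex_of_real (sin b))"
  by (simp_all only: iexp_cos_sin)
    (simp_all add: complex_eq_iff cos_add sin_add cos_diff sin_diff)

text \<open>The coordinates are treated one at a time: the law of the next coordinate is compared under the positive
  weights \<open>2 + h cos \<theta>\<close> and \<open>2 + h sin \<theta>\<close>, where \<open>h\<close> is the indicator of a box in the coordinates already treated
  and \<open>\<theta>\<close> is linear in the remaining ones. The constant 2 keeps the total mass positive when \<open>h\<close> is null.\<close>

theorem PiM_char_unique:
  fixes Q :: "(nat \<Rightarrow> real) measure"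
  assumes "prob_space Q" "prob_space Q'"
    and sets: "sets Q = sets (PiM {..<p} (\<lambda>_. borel))" "sets Q' = sets (PiM {..<p} (\<lambda>_. borel))"
    and ch: "\<And>t. (CLINT x|Q. iexp (\<Sum>i<p. t i * x i)) = (CLINT x|Q'. iexp (\<Sum>i<p. t i * x i))"
  shows "Q = Q'"
proof -
  interpret Q: prob_space Q by fact
  interpret Q': prob_space Q' by fact
  note sets[measurable_cong]
  \<comment> \<open>A mixed transform: boxes in the first k coordinates, frequencies in the others.
    At k = 0 it is the hypothesis, at k = p it is equality on all boxes.\<close>
  have step: "\<forall>B t. (\<forall>i<k. B i \<in> sets borel) \<longrightarrow>
     (CLINT x|Q. (\<Prod>i<k. indicator (B i) (x i)) *\<^sub>R iexp (\<Sum>i\<in>{k..<p}. t i * x i))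
     = (CLINT x|Q'. (\<Prod>i<k. indicator (B i) (x i)) *\<^sub>R iexp (\<Sum>i\<in>{k..<p}. t i * x i))"
    if "k \<le> p" for k
    using that
  proof (induction k)
    case 0
    then show ?case using ch by (simp add: lessThan_atLeast0)
  next
    case (Suc k)
    then have k: "k < p" and IH: "\<And>B t. (\<And>i. i < k \<Longrightarrow> B i \<in> sets borel) \<Longrightarrow>
       (CLINT x|Q. (\<Prod>i<k. indicator (B i) (x i)) *\<^sub>R iexp (\<Sum>i\<in>{k..<p}. t i * x i))
       = (CLINT x|Q'. (\<Prod>i<k. indicator (B i) (x i)) *\<^sub>R iexp (\<Sum>i\<in>{k..<p}. t i * x i))" by auto
    show ?case
    proof (intro allI impI)
      fix B :: "nat \<Rightarrow> real set" and t assume B: "\<forall>i<Suc k. B i \<in> sets borel"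
      define h where "h x = (\<Prod>i<k. indicator (B i) (x i) :: real)" for x :: "nat \<Rightarrow> real"
      define \<theta> where "\<theta> x = (\<Sum>i\<in>{Suc k..<p}. t i * x i)" for x :: "nat \<Rightarrow> real"
      have [measurable]: "B k \<in> sets borel" using B by simp
      have mh[measurable]: "h \<in> borel_measurable (PiM {..<p} (\<lambda>_. borel))"
        unfolding h_def
      proof (intro borel_measurable_prod)
        fix i assume "i \<in> {..<k}"
        then have [measurable]: "B i \<in> sets borel" "i \<in> {..<p}" using B k by auto
        show "(\<lambda>x. indicator (B i) (x i) :: real) \<in> borel_measurable (PiM {..<p} (\<lambda>_. borel))" by measurable
      qed
      have m\<theta>[measurable]: "\<theta> \<in> borel_measurable (PiM {..<p} (\<lambda>_. borel))"
        unfolding \<theta>_def by measurable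
      have mk[measurable]: "(\<lambda>x. x k) \<in> borel_measurable (PiM {..<p} (\<lambda>_. borel))"
        by (rule measurable_component_singleton) (use k in simp)
      have h1: "\<bar>h x\<bar> \<le> 1" and h0: "0 \<le> h x" for x unfolding h_def
        by (auto simp: abs_prod intro!: prod_le_1 prod_nonneg)
      have hc: "\<bar>h x * cos a\<bar> \<le> 1" "\<bar>h x * sin a\<bar> \<le> 1" for x a
        using h1[of x] by (auto simp: abs_mult intro!: mult_le_one)
      have exp1: "(CLINT x|Q. h x *\<^sub>R iexp (s * x k + e * \<theta> x)) = (CLINT x|Q'. h x *\<^sub>R iexp (s * x k + e * \<theta> x))" for s e
      proof -
        have "(\<Sum>i\<in>{k..<p}. (if i = k then s else e * t i) * x i) = s * x k + e * \<theta> x" for x :: "nat \<Rightarrow> real"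
          using k by (simp add: sum.atLeast_Suc_lessThan \<theta>_def sum_distrib_left mult.assoc)
        then show ?thesis using IH[of B "\<lambda>i. if i = k then s else e * t i"] B unfolding h_def[symmetric] by simp
      qed
      have ch1: "(CLINT x|Q. iexp (s * x k)) = (CLINT x|Q'. iexp (s * x k))" for s
      proof -
        have "(\<Sum>i<p. (if i = k then s else 0) * x i) = (\<Sum>i<p. if i = k then s * x i else 0)" for x :: "nat \<Rightarrow> real"
          by (intro sum.cong) auto
        then have "(\<Sum>i<p. (if i = k then s else 0) * x i) = s * x k" for x :: "nat \<Rightarrow> real"
          using k by simp
        then show ?thesis using ch[of "\<lambda>i. if i = k then s else 0"] by simp
      qed
      have int: "integrable Q (\<lambda>x. h x *\<^sub>R iexp (s * x k + e * \<theta> x))" "integrable Q' (\<lambda>x. h x *\<^sub>R iexp (s * x k + e * \<theta> x))" for s e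
        using h1 by (auto intro!: Q.integrable_const_bound[of _ 1] Q'.integrable_const_bound[of _ 1])
      \<comment> \<open>Multiplying by the cosine or sine of the remaining phase only mixes the
        frequency signs e = 1 and e = -1, both covered by \<open>exp1\<close>.\<close>
      have cosid: "(h x * cos (\<theta> x)) *\<^sub>R iexp (s * x k) = (h x *\<^sub>R iexp (s * x k + 1 * \<theta> x) + h x *\<^sub>R iexp (s * x k + (-1) * \<theta> x)) / 2"
        and sinid: "(h x * sin (\<theta> x)) *\<^sub>R iexp (s * x k) = (h x *\<^sub>R iexp (s * x k + 1 * \<theta> x) - h x *\<^sub>R iexp (s * x k + (-1) * \<theta> x)) / (2 * \<i>)"
        for x s
        unfolding iexp_add_diff by (simp_all add: scaleR_conv_of_real field_simps)
      have cosw: "(\<integral>x. (h x * cos (\<theta> x)) * indicator (B k) (x k) \<partial>Q) = (\<integral>x. (h x * cos (\<theta> x)) * indicator (B k) (x k) \<partial>Q')"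
      proof (rule Q.weighted_char_unique[where Y = "\<lambda>x. x k" and Y' = "\<lambda>x. x k" and B = "B k"
            and q = "\<lambda>x. h x * cos (\<theta> x)" and q' = "\<lambda>x. h x * cos (\<theta> x)"])
        show "(CLINT x|Q. (h x * cos (\<theta> x)) *\<^sub>R iexp (s * x k)) = (CLINT x|Q'. (h x * cos (\<theta> x)) *\<^sub>R iexp (s * x k))" for s
          unfolding cosid using int[of s 1] int[of s "-1"] exp1[of s 1] exp1[of s "-1"] by (simp del: of_real_add of_real_mult mult_minus1)
        show "(\<lambda>x. x k) \<in> borel_measurable Q" "(\<lambda>x. x k) \<in> borel_measurable Q'"
          "(\<lambda>x. h x * cos (\<theta> x)) \<in> borel_measurable Q" "(\<lambda>x. h x * cos (\<theta> x)) \<in> borel_measurable Q'" by measurable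
        show "\<bar>h x * cos (\<theta> x)\<bar> \<le> 1" "\<bar>h x * cos (\<theta> x)\<bar> \<le> 1" for x by (rule hc)+
      qed (fact ch1 Q'.prob_space_axioms \<open>B k \<in> sets borel\<close>)+
      have sinw: "(\<integral>x. (h x * sin (\<theta> x)) * indicator (B k) (x k) \<partial>Q) = (\<integral>x. (h x * sin (\<theta> x)) * indicator (B k) (x k) \<partial>Q')"
      proof (rule Q.weighted_char_unique[where Y = "\<lambda>x. x k" and Y' = "\<lambda>x. x k" and B = "B k"
            and q = "\<lambda>x. h x * sin (\<theta> x)" and q' = "\<lambda>x. h x * sin (\<theta> x)"])
        show "(CLINT x|Q. (h x * sin (\<theta> x)) *\<^sub>R iexp (s * x k)) = (CLINT x|Q'. (h x * sin (\<theta> x)) *\<^sub>R iexp (s * x k))" for s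
          unfolding sinid using int[of s 1] int[of s "-1"] exp1[of s 1] exp1[of s "-1"] by (simp del: of_real_add of_real_mult mult_minus1)
        show "(\<lambda>x. x k) \<in> borel_measurable Q" "(\<lambda>x. x k) \<in> borel_measurable Q'"
          "(\<lambda>x. h x * sin (\<theta> x)) \<in> borel_measurable Q" "(\<lambda>x. h x * sin (\<theta> x)) \<in> borel_measurable Q'" by measurable
        show "\<bar>h x * sin (\<theta> x)\<bar> \<le> 1" "\<bar>h x * sin (\<theta> x)\<bar> \<le> 1" for x by (rule hc)+
      qed (fact ch1 Q'.prob_space_axioms \<open>B k \<in> sets borel\<close>)+
      have split: "(\<Prod>i<Suc k. indicator (B i) (x i)) *\<^sub>R iexp (\<Sum>i\<in>{Suc k..<p}. t i * x i)
          = complex_of_real ((h x * cos (\<theta> x)) * indicator (B k) (x k)) + \<i> * complex_of_real ((h x * sin (\<theta> x)) * indicator (B k) (x k))" for x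
        unfolding \<theta>_def[symmetric] iexp_cos_sin by (simp add: h_def scaleR_conv_of_real algebra_simps)
      have b1: "\<bar>(h x * cos (\<theta> x)) * indicator (B k) (x k)\<bar> \<le> 1" "\<bar>(h x * sin (\<theta> x)) * indicator (B k) (x k)\<bar> \<le> 1" for x
        using hc[of x "\<theta> x"] by (auto simp: indicator_def)
      have mi[measurable]: "(\<lambda>x. indicator (B k) (x k) :: real) \<in> borel_measurable (PiM {..<p} (\<lambda>_. borel))"
        by measurable
      have "integrable Q (\<lambda>x. (h x * cos (\<theta> x)) * indicator (B k) (x k))" "integrable Q (\<lambda>x. (h x * sin (\<theta> x)) * indicator (B k) (x k))"
        "integrable Q' (\<lambda>x. (h x * cos (\<theta> x)) * indicator (B k) (x k))" "integrable Q' (\<lambda>x. (h x * sin (\<theta> x)) * indicator (B k) (x k))"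
        by (rule Q.integrable_const_bound[of _ 1] Q'.integrable_const_bound[of _ 1],
            intro AE_I2, unfold real_norm_def, rule b1, measurable)+
      then show "(CLINT x|Q. (\<Prod>i<Suc k. indicator (B i) (x i)) *\<^sub>R iexp (\<Sum>i\<in>{Suc k..<p}. t i * x i)) =
          (CLINT x|Q'. (\<Prod>i<Suc k. indicator (B i) (x i)) *\<^sub>R iexp (\<Sum>i\<in>{Suc k..<p}. t i * x i))"
        unfolding split using cosw sinw by (simp del: of_real_mult)
    qed
  qed
  show ?thesis
  proof (rule measure_eqI_PiM_finite[OF _ sets])
    fix A :: "nat \<Rightarrow> real set" assume A: "\<And>i. i \<in> {..<p} \<Longrightarrow> A i \<in> sets borel"
    have ind: "(\<integral>x. (\<Prod>i<p. indicator (A i) (x i)) \<partial>R) = measure R (Pi\<^sub>E {..<p} A)"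
      if R: "sets R = sets (PiM {..<p} (\<lambda>_. borel))" for R :: "(nat \<Rightarrow> real) measure"
    proof -
      have sp: "space R = space (PiM {..<p} (\<lambda>_. borel))" using R by (rule sets_eq_imp_space_eq)
      have "(\<integral>x. (\<Prod>i<p. indicator (A i) (x i)) \<partial>R) = (\<integral>x. indicator (Pi\<^sub>E {..<p} A) x \<partial>R :: real)"
      proof (rule Bochner_Integration.integral_cong[OF refl])
        fix x assume "x \<in> space R"
        then have "x \<in> extensional {..<p}" by (simp add: sp space_PiM PiE_def)
        then show "(\<Prod>i<p. indicator (A i) (x i)) = (indicator (Pi\<^sub>E {..<p} A) x :: real)"
          by (auto simp: indicator_def PiE_iff Ball_def)
      qed
      also have "\<dots> = measure R (Pi\<^sub>E {..<p} A)"
        using sets.sets_into_space[of "Pi\<^sub>E {..<p} A" R] A R by (simp add: Int_absorb2)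
      finally show ?thesis .
    qed
    have "complex_of_real (\<integral>x. (\<Prod>i<p. indicator (A i) (x i)) \<partial>Q) = complex_of_real (\<integral>x. (\<Prod>i<p. indicator (A i) (x i)) \<partial>Q')"
      using step[of p] A by (simp add: scaleR_conv_of_real del: of_real_prod of_real_eq_iff)
    then show "emeasure Q (Pi\<^sub>E {..<p} A) = emeasure Q' (Pi\<^sub>E {..<p} A)"
      by (simp add: ind sets Q.emeasure_eq_measure Q'.emeasure_eq_measure)
  next
    show "range (\<lambda>_::nat. Pi\<^sub>E {..<p} (\<lambda>_. UNIV)) \<subseteq> prod_algebra {..<p} (\<lambda>_. borel :: real measure)"
      by (auto intro!: prod_algebraI_finite)
    show "(\<Union>i::nat. Pi\<^sub>E {..<p} (\<lambda>_. UNIV)) = space (PiM {..<p} (\<lambda>_. borel :: real measure))"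
      by (simp add: space_PiM)
  qed auto
qed

section \<open>Weights on bounded coordinates\<close>

text \<open>Law of total variance for branches of probability (1 + a)/2 and (1 - a)/2 with means m +
  (c/2)/(1 + a) and m - (c/2)/(1 - a): the average variance drops by the variance of the branch
  means, which is c^2 / (4 (1 - a^2)).\<close>

lemma split_variance_le:
  fixes m c q r a :: real
  assumes a: "\<bar>a\<bar> \<le> 1/2"
  shows "(1 + a) / 2 * ((q + r) / (1 + a) - (m + c / 2 / (1 + a))\<^sup>2)
       + (1 - a) / 2 * ((q - r) / (1 - a) - (m - c / 2 / (1 - a))\<^sup>2) \<le> q - m\<^sup>2 - c\<^sup>2 / 4"
proof -
  have p: "0 < 1 + a" "0 < 1 - a" using a by auto
  have gen: "u / 2 * ((q + e * r) / u - (m + e * c / 2 / u)\<^sup>2)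
      = (q + e * r) / 2 - u * m\<^sup>2 / 2 - e * m * c / 2 - e\<^sup>2 * c\<^sup>2 / 8 * (1 / u)"
    if "0 < u" for e u :: real using that by (simp add: field_simps power2_eq_square)
  have E1: "(1 + a) / 2 * ((q + r) / (1 + a) - (m + c / 2 / (1 + a))\<^sup>2)
      = (q + r) / 2 - (1 + a) * m\<^sup>2 / 2 - m * c / 2 - c\<^sup>2 / 8 * (1 / (1 + a))"
    using gen[of "1 + a" 1] p by simp
  have E2: "(1 - a) / 2 * ((q - r) / (1 - a) - (m - c / 2 / (1 - a))\<^sup>2)
      = (q - r) / 2 - (1 - a) * m\<^sup>2 / 2 + m * c / 2 - c\<^sup>2 / 8 * (1 / (1 - a))"
    using gen[of "1 - a" "-1"] p by simp
  have "1 / (1 + a) + 1 / (1 - a) = 2 / ((1 + a) * (1 - a))"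
    using p by (simp add: add_frac_eq)
  moreover have "(1 + a) * (1 - a) \<le> 1" by (simp add: algebra_simps)
  ultimately have "2 \<le> 1 / (1 + a) + 1 / (1 - a)"
    using p by (simp add: le_divide_eq)
  then have "c\<^sup>2 / 8 * 2 \<le> c\<^sup>2 / 8 * (1 / (1 + a) + 1 / (1 - a))" by (intro mult_left_mono) auto
  then have "c\<^sup>2 / 4 \<le> c\<^sup>2 / 8 * (1 / (1 + a)) + c\<^sup>2 / 8 * (1 / (1 - a))" by (simp only: distrib_left)
  moreover have "(1 + a) * m\<^sup>2 / 2 + (1 - a) * m\<^sup>2 / 2 = m\<^sup>2" by (simp add: field_simps)
  ultimately show ?thesis unfolding E1 E2 by (simp add: add_divide_distrib diff_divide_distrib)
qed

text \<open>The bound holds everywhere, not almost everywhere, so weighted moments exist without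
  null set arguments; laws on [-1, 1] meet this through \<open>clip\<close>.\<close>

locale bounded_coordinates = prob_space M for M :: "'a measure" +
  fixes p :: nat and X :: "nat \<Rightarrow> 'a \<Rightarrow> real"
  assumes X_measurable[measurable]: "\<And>i. X i \<in> borel_measurable M"
    and X_bound: "\<And>i x. \<bar>X i x\<bar> \<le> 1"
begin

text \<open>Densities stay unnormalized because the lost normalization \<open>mass\<close> is the
  quantity to be bounded. Positivity keeps the weighted law equivalent to the base law, and
  boundedness keeps all moments finite.\<close>

definition weight :: "('a \<Rightarrow> real) \<Rightarrow> bool" where
  "weight g \<longleftrightarrow> g \<in> borel_measurable M \<and> (\<forall>x. 0 < g x) \<and> (\<exists>B. \<forall>x. g x \<le> B)"

definition mass :: "('a \<Rightarrow> real) \<Rightarrow> real" where "mass g = (\<integral>x. g x \<partial>M)"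

definition wmean :: "('a \<Rightarrow> real) \<Rightarrow> ('a \<Rightarrow> real) \<Rightarrow> real" where
  "wmean g f = (\<integral>x. g x * f x \<partial>M) / mass g"

definition wcov :: "('a \<Rightarrow> real) \<Rightarrow> nat \<Rightarrow> nat \<Rightarrow> real" where
  "wcov g i j = wmean g (\<lambda>x. X i x * X j x) - wmean g (X i) * wmean g (X j)"

lemma weight_integrable:
  assumes "weight g" "f \<in> borel_measurable M" "\<And>x. \<bar>f x\<bar> \<le> C"
  shows "integrable M (\<lambda>x. g x * f x)"
proof -
  from assms(1) obtain B where B: "\<And>x. g x \<le> B" and g: "g \<in> borel_measurable M" "\<And>x. 0 < g x" by (auto simp: weight_def)
  have "\<bar>g x * f x\<bar> \<le> B * C" for x
    unfolding abs_mult using B[of x] g(2)[of x] assms(3)[of x] by (intro mult_mono) auto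
  then show ?thesis using g(1) assms(2) by (intro integrable_const_bound[of _ "B * C"]) auto
qed

lemma weight_integrable': "weight g \<Longrightarrow> integrable M g"
  using weight_integrable[of g "\<lambda>_. 1" 1] by simp

lemma mass_pos:
  assumes "weight g" shows "0 < mass g"
proof -
  have "0 \<le> mass g" using assms unfolding mass_def by (intro integral_nonneg_AE) (auto simp: weight_def less_imp_le)
  moreover have "mass g \<noteq> 0"
  proof
    assume "mass g = 0"
    then have "AE x in M. g x = 0"
      using assms weight_integrable'[OF assms] unfolding mass_def
      by (subst (asm) integral_nonneg_eq_0_iff_AE) (auto simp: weight_def less_imp_le)
    then have "AE x in M. False" by eventually_elim (use assms in \<open>auto simp: weight_def order_less_le\<close>)
    then show False by (simp add: AE_False)
  qed
  ultimately show ?thesis by simp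
qed

lemma wmean_add:
  assumes "weight g" "f \<in> borel_measurable M" "\<And>x. \<bar>f x\<bar> \<le> C" "h \<in> borel_measurable M" "\<And>x. \<bar>h x\<bar> \<le> D"
  shows "wmean g (\<lambda>x. f x + h x) = wmean g f + wmean g h"
  using weight_integrable[OF assms(1-3)] weight_integrable[OF assms(1,4,5)]
  by (simp add: wmean_def distrib_left add_divide_distrib)

lemma wmean_cmult: "wmean g (\<lambda>x. c * f x) = c * wmean g f"
  by (simp add: wmean_def mult.left_commute)

lemma wmean_const: "weight g \<Longrightarrow> wmean g (\<lambda>x. c) = c"
  using mass_pos[of g] by (simp add: wmean_def mass_def)

lemma wmean_sum:
  assumes "weight g" "\<And>i. i \<in> I \<Longrightarrow> f i \<in> borel_measurable M" "\<And>i x. i \<in> I \<Longrightarrow> \<bar>f i x\<bar> \<le> C i"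
  shows "wmean g (\<lambda>x. \<Sum>i\<in>I. f i x) = (\<Sum>i\<in>I. wmean g (f i))"
proof -
  have "integrable M (\<lambda>x. g x * f i x)" if "i \<in> I" for i
    using weight_integrable[OF assms(1), of "f i" "C i"] assms(2,3) that by auto
  then show ?thesis by (simp add: wmean_def sum_distrib_left sum_divide_distrib)
qed

lemma wmean_mono:
  assumes "weight g" "f \<in> borel_measurable M" "\<And>x. \<bar>f x\<bar> \<le> C" "h \<in> borel_measurable M" "\<And>x. \<bar>h x\<bar> \<le> D" "\<And>x. f x \<le> h x"
  shows "wmean g f \<le> wmean g h"
  unfolding wmean_def using weight_integrable[OF assms(1-3)] weight_integrable[OF assms(1,4,5)] mass_pos[OF assms(1)] assms(1,6)
  by (intro divide_right_mono integral_mono mult_left_mono) (auto simp: weight_def less_imp_le)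

text \<open>Jensen's inequality from the tangent line of exp at m, using only linearity and
  monotonicity of \<open>wmean\<close>.\<close>

lemma wmean_exp_ge:
  assumes g: "weight g" and f[measurable]: "f \<in> borel_measurable M" and C: "\<And>x. \<bar>f x\<bar> \<le> C"
  shows "exp (wmean g f) \<le> wmean g (\<lambda>x. exp (f x))"
proof -
  define m where "m = wmean g f"
  have "exp m = wmean g (\<lambda>x. exp m * (1 - m) + exp m * f x)"
    using wmean_add[OF g, of "\<lambda>_. exp m * (1 - m)" "\<bar>exp m * (1 - m)\<bar>" "\<lambda>x. exp m * f x" "exp m * C"] C
    by (simp add: wmean_const[OF g] wmean_cmult m_def[symmetric] abs_mult algebra_simps)
  also have "\<dots> \<le> wmean g (\<lambda>x. exp (f x))"
  proof (rule wmean_mono[OF g, where C = "\<bar>exp m * (1 - m)\<bar> + exp m * C" and D = "exp C"])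
    show "\<bar>exp m * (1 - m) + exp m * f x\<bar> \<le> \<bar>exp m * (1 - m)\<bar> + exp m * C" for x
      using C[of x] by (intro order_trans[OF abs_triangle_ineq] add_left_mono) (simp add: abs_mult)
    show "\<bar>exp (f x)\<bar> \<le> exp C" for x using C[of x] by simp
    have "1 + (f x - m) \<le> exp (f x - m)" for x by (rule exp_ge_add_one_self)
    then have "exp m * (1 + (f x - m)) \<le> exp m * exp (f x - m)" for x by (intro mult_left_mono) auto
    then show "exp m * (1 - m) + exp m * f x \<le> exp (f x)" for x
      by (simp add: exp_add[symmetric] algebra_simps)
  qed measurable
  finally show ?thesis by (simp add: m_def)
qed

lemma X_mult_bound: "\<bar>X i x * X j x\<bar> \<le> 1"
  unfolding abs_mult using X_bound[of i x] X_bound[of j x] by (intro mult_le_one) auto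

lemma X_square_le_1: "X i x * X i x \<le> 1"
  using X_mult_bound[of i x i] by simp

lemma wmean_X_bound: assumes "weight g" shows "\<bar>wmean g (X i)\<bar> \<le> 1"
proof -
  have "- 1 \<le> X i x \<and> X i x \<le> 1" for x using X_bound[of i x] by linarith
  then have "wmean g (\<lambda>_. -1) \<le> wmean g (X i)" "wmean g (X i) \<le> wmean g (\<lambda>_. 1)"
    using X_bound by (auto intro!: wmean_mono[OF assms, where C = 1 and D = 1])
  then show ?thesis by (simp add: wmean_const[OF assms])
qed

lemma wcov_diag_nonneg: assumes "weight g" shows "0 \<le> wcov g i i"
proof -
  define m where "m = wmean g (X i)"
  have "0 \<le> (\<integral>x. g x * (X i x - m)\<^sup>2 \<partial>M) / mass g"
    using mass_pos[OF assms] assms by (intro divide_nonneg_pos integral_nonneg_AE) (auto simp: weight_def less_imp_le)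
  also have "\<dots> = wmean g (\<lambda>x. (X i x - m)\<^sup>2)" by (simp add: wmean_def)
  also have "(\<lambda>x. (X i x - m)\<^sup>2) = (\<lambda>x. (X i x * X i x + (- 2 * m) * X i x) + m\<^sup>2)"
    by (auto simp: power2_eq_square algebra_simps)
  also have "wmean g \<dots> = wmean g (\<lambda>x. X i x * X i x) + (- 2 * m) * m + m\<^sup>2"
  proof -
    have b: "\<bar>(- 2 * m) * X i x\<bar> \<le> 2 * \<bar>m\<bar>" for x
      using X_bound[of i x] by (simp add: abs_mult mult_left_le)
    have b': "\<bar>X i x * X i x + (- 2 * m) * X i x\<bar> \<le> 1 + 2 * \<bar>m\<bar>" for x
      using b[of x] X_mult_bound[of i x i] by linarith
    have "wmean g (\<lambda>x. (X i x * X i x + (- 2 * m) * X i x) + m\<^sup>2)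
       = wmean g (\<lambda>x. X i x * X i x + (- 2 * m) * X i x) + m\<^sup>2"
      using b' by (subst wmean_add[OF assms, where C = "1 + 2 * \<bar>m\<bar>" and D = "m\<^sup>2"]) (auto simp: wmean_const[OF assms])
    also have "wmean g (\<lambda>x. X i x * X i x + (- 2 * m) * X i x) = wmean g (\<lambda>x. X i x * X i x) + wmean g (\<lambda>x. (- 2 * m) * X i x)"
      using b X_square_le_1 by (subst wmean_add[OF assms, where C = 1 and D = "2 * \<bar>m\<bar>"]) auto
    finally show ?thesis by (simp only: wmean_cmult m_def)
  qed
  finally show ?thesis by (simp add: wcov_def m_def[symmetric] power2_eq_square)
qed

lemma wcov_diag_le_1: assumes "weight g" shows "wcov g i i \<le> 1"
proof -
  have "wmean g (\<lambda>x. X i x * X i x) \<le> wmean g (\<lambda>_. 1)"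
    using X_square_le_1 by (intro wmean_mono[OF assms, where C = 1 and D = 1]) auto
  then have "wmean g (\<lambda>x. X i x * X i x) \<le> 1" by (simp add: wmean_const[OF assms])
  moreover have "0 \<le> wmean g (X i) * wmean g (X i)" by (rule zero_le_square)
  ultimately show ?thesis unfolding wcov_def by linarith
qed

text \<open>Joint weight of the point and a noisy sign e of \<open>X j\<close> that is shown with
  conditional probability (1 + e X/2)/2. The two signs add up to \<open>g\<close>; halving X keeps
  both probabilities in [1/4, 3/4], so the pieces are again positive weights.\<close>

definition pin :: "('a \<Rightarrow> real) \<Rightarrow> nat \<Rightarrow> real \<Rightarrow> 'a \<Rightarrow> real" where
  "pin g j e x = g x * (1 + e * X j x / 2) / 2"

lemma pin_factor:
  assumes "\<bar>e\<bar> = 1" shows "1/4 \<le> (1 + e * X j x / 2) / 2" "(1 + e * X j x / 2) / 2 \<le> 3/4"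
proof -
  have "\<bar>e * X j x\<bar> \<le> 1" using X_bound[of j x] assms by (simp add: abs_mult)
  then show "1/4 \<le> (1 + e * X j x / 2) / 2" "(1 + e * X j x / 2) / 2 \<le> 3/4" by auto
qed

lemma pin_le: assumes "\<bar>e\<bar> = 1" "0 \<le> g x" shows "pin g j e x \<le> g x"
proof -
  have "g x * ((1 + e * X j x / 2) / 2) \<le> g x * 1"
    using pin_factor[OF assms(1), of j x] assms(2) by (intro mult_left_mono) auto
  then show ?thesis by (simp add: pin_def)
qed

lemma weight_pin: assumes g: "weight g" and e: "\<bar>e\<bar> = 1" shows "weight (pin g j e)"
proof -
  have [measurable]: "g \<in> borel_measurable M" using g by (simp add: weight_def)
  have "0 < g x * ((1 + e * X j x / 2) / 2)" for x
    using pin_factor[OF e, of j x] g by (intro mult_pos_pos) (auto simp: weight_def)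
  moreover have "pin g j e x \<le> g x" for x using pin_le[OF e, of g x j] g by (simp add: weight_def less_imp_le)
  moreover have "pin g j e \<in> borel_measurable M" unfolding pin_def[abs_def] by measurable
  moreover obtain B where "\<And>x. g x \<le> B" using g by (auto simp: weight_def)
  ultimately show ?thesis unfolding weight_def
    by (intro conjI exI[of _ B] allI order_trans[of "pin g j e _" "g _" B]) (simp_all add: pin_def)
qed

lemma mass_pin: assumes g: "weight g"
  shows "mass (pin g j e) = mass g * (1 + e * wmean g (X j) / 2) / 2"
proof -
  have "mass (pin g j e) = (\<integral>x. g x / 2 + e / 4 * (g x * X j x) \<partial>M)"
    unfolding mass_def pin_def by (intro Bochner_Integration.integral_cong) (auto simp: field_simps)
  also have "\<dots> = mass g / 2 + e / 4 * (mass g * wmean g (X j))"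
  proof -
    have "integrable M (\<lambda>x. g x * X j x)" using weight_integrable[OF g, of "X j" 1] X_bound by simp
    then have "(\<integral>x. g x / 2 + e / 4 * (g x * X j x) \<partial>M) = (\<integral>x. g x \<partial>M) / 2 + e / 4 * (\<integral>x. g x * X j x \<partial>M)"
      using weight_integrable'[OF g] by simp
    then show ?thesis using mass_pos[OF g] by (simp add: wmean_def) (simp add: mass_def)
  qed
  finally show ?thesis by (simp add: field_simps)
qed

lemma wmean_pin:
  assumes g: "weight g" and f[measurable]: "f \<in> borel_measurable M" and C: "\<And>x. \<bar>f x\<bar> \<le> C" and e: "\<bar>e\<bar> = 1"
  shows "wmean (pin g j e) f = (wmean g f + e / 2 * wmean g (\<lambda>x. f x * X j x)) / (1 + e * wmean g (X j) / 2)"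
proof -
  have fX: "\<bar>f x * X j x\<bar> \<le> C" for x
  proof -
    have "\<bar>f x\<bar> * \<bar>X j x\<bar> \<le> C * 1" using C[of x] X_bound[of j x] by (intro mult_mono) auto
    then show ?thesis by (simp add: abs_mult)
  qed
  have "(\<integral>x. pin g j e x * f x \<partial>M) = (\<integral>x. 1/2 * (g x * f x) + e / 4 * (g x * (f x * X j x)) \<partial>M)"
    unfolding pin_def by (intro Bochner_Integration.integral_cong) (auto simp: field_simps)
  also have "\<dots> = 1/2 * (\<integral>x. g x * f x \<partial>M) + e / 4 * (\<integral>x. g x * (f x * X j x) \<partial>M)"
    using weight_integrable[OF g f C] weight_integrable[OF g _ fX] by simp
  also have "\<dots> = mass g / 2 * (wmean g f + e / 2 * wmean g (\<lambda>x. f x * X j x))"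
    using mass_pos[OF g] by (simp add: wmean_def field_simps)
  finally have "wmean (pin g j e) f = (mass g / 2 * (wmean g f + e / 2 * wmean g (\<lambda>x. f x * X j x))) / (mass g / 2 * (1 + e * wmean g (X j) / 2))"
    by (simp add: wmean_def[of "pin g j e"] mass_pin[OF g])
  then show ?thesis using mass_pos[OF g] by simp
qed

text \<open>By Bayes' rule the sign e moves the mean of \<open>X i\<close> by e c/2 divided by 1 + e
  a, where c is the covariance with \<open>X j\<close>. This is the situation of
  \<open>split_variance_le\<close>.\<close>

lemma wcov_pin_drop:
  fixes i j :: nat
  assumes g: "weight g"
  defines "a \<equiv> wmean g (X j) / 2"
  shows "(1 + a) / 2 * wcov (pin g j 1) i i + (1 - a) / 2 * wcov (pin g j (-1)) i i \<le> wcov g i i - (wcov g i j)\<^sup>2 / 4"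
proof -
  have a: "\<bar>a\<bar> \<le> 1/2" using wmean_X_bound[OF g, of j] by (simp add: a_def)
  define m where "m = wmean g (X i)"
  define c where "c = wcov g i j"
  define q where "q = wmean g (\<lambda>x. X i x * X i x)"
  define r where "r = wmean g (\<lambda>x. (X i x * X i x) * X j x) / 2"
  have m: "wmean (pin g j e) (X i) = m + e * c / 2 / (1 + e * a)" if "\<bar>e\<bar> = 1" for e
  proof -
    have "\<bar>e * a\<bar> \<le> 1/2" using a that by (simp add: abs_mult)
    then have "0 < 1 + e * a" by linarith
    moreover have "wmean g (\<lambda>x. X i x * X j x) = c + m * (2 * a)" by (simp add: c_def wcov_def m_def a_def)
    ultimately show ?thesis
      using wmean_pin[OF g, of "X i" 1 e j] X_bound that
      by (simp add: m_def[symmetric] a_def[symmetric] field_simps) (simp add: a_def field_simps)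
  qed
  have q: "wmean (pin g j e) (\<lambda>x. X i x * X i x) = (q + e * r) / (1 + e * a)" if "\<bar>e\<bar> = 1" for e
    using wmean_pin[OF g, of "\<lambda>x. X i x * X i x" 1 e j] X_square_le_1 that by (simp add: q_def r_def a_def)
  have "wcov (pin g j e) i i = (q + e * r) / (1 + e * a) - (m + e * c / 2 / (1 + e * a))\<^sup>2" if "\<bar>e\<bar> = 1" for e
    unfolding wcov_def m[OF that] q[OF that] by (simp add: power2_eq_square)
  from this[of 1] this[of "-1"] split_variance_le[OF a, of q r m c]
  show ?thesis by (simp add: c_def[symmetric] wcov_def[of g i i] q_def[symmetric] m_def[symmetric] power2_eq_square)
qed

text \<open>Observing a noisy sign of one coordinate costs entropy at most \<open>ln 2\<close> and, for a well chosen
  coordinate, lowers the total variance by a quarter of the mean squared covariance. The supremum of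
  log-mass minus a multiple of the total variance over all weights obtained in this way is therefore
  attained where all covariances are small.\<close>

theorem log_mass_le:
  assumes g0: "weight g0" and s: "0 < s" and F: "0 \<le> F"
    and low_cov: "\<And>g. weight g \<Longrightarrow> (\<And>x. g x \<le> g0 x) \<Longrightarrow>
      ln (mass g) \<le> B + F * sqrt (\<Sum>i<p. \<Sum>j<p. (wcov g i j)\<^sup>2)"
  shows "ln (mass g0) \<le> B + F * sqrt s + 8 * ln 2 * (real p)\<^sup>2 / s"
proof -
  define V where "V g = (\<Sum>i<p. wcov g i i)" for g
  \<comment> \<open>A variance drop of s/(4p) is worth exactly 2 ln 2 in L V: one ln 2 pays for the
    entropy of the sign, the other is the gain.\<close>
  define L where "L = 8 * ln 2 * real p / s"
  define \<Phi> where "\<Phi> g = ln (mass g) - (B + F * sqrt s) - L * V g" for g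
  define W where "W = {g. weight g \<and> (\<forall>x. g x \<le> g0 x)}"
  have L: "0 \<le> L" using s by (simp add: L_def)
  have V: "0 \<le> V g" "V g \<le> p" if "weight g" for g
  proof -
    show "0 \<le> V g" unfolding V_def using that by (intro sum_nonneg wcov_diag_nonneg)
    have "V g \<le> (\<Sum>i<p. 1)" unfolding V_def using that by (intro sum_mono wcov_diag_le_1)
    then show "V g \<le> p" by simp
  qed
  have g0W: "g0 \<in> W" using g0 by (simp add: W_def)
  have bdd: "bdd_above (\<Phi> ` W)"
  proof (rule bdd_aboveI2)
    fix g assume "g \<in> W"
    then have g: "weight g" "\<And>x. g x \<le> g0 x" by (auto simp: W_def)
    have "mass g \<le> mass g0" unfolding mass_def using g g0 by (intro integral_mono weight_integrable') auto
    then have "ln (mass g) \<le> ln (mass g0)" using mass_pos[OF g(1)] by simp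
    moreover have "0 \<le> L * V g" using L V[OF g(1)] by simp
    ultimately show "\<Phi> g \<le> ln (mass g0) - (B + F * sqrt s)" by (simp add: \<Phi>_def)
  qed
  define D where "D = (SUP g\<in>W. \<Phi> g)"
  have upper: "\<Phi> g \<le> D" if "g \<in> W" for g unfolding D_def using bdd that by (rule cSUP_upper2) simp
  \<comment> \<open>A weight either has small covariances, so that \<Phi> is at most 0, or splits
    into two pieces of \<open>W\<close> with a gain of ln 2. Taking the supremum gives D \<le> max 0
    (D - ln 2), hence D \<le> 0.\<close>
  have "\<Phi> g \<le> max 0 (D - ln 2)" if gW: "g \<in> W" for g
  proof (cases "(\<Sum>i<p. \<Sum>j<p. (wcov g i j)\<^sup>2) \<le> s")
    case True
    have g: "weight g" "\<And>x. g x \<le> g0 x" using gW by (auto simp: W_def)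
    have "F * sqrt (\<Sum>i<p. \<Sum>j<p. (wcov g i j)\<^sup>2) \<le> F * sqrt s" using True F by (intro mult_left_mono) auto
    with low_cov[OF g] have "ln (mass g) \<le> B + F * sqrt s" by linarith
    moreover have "0 \<le> L * V g" using L V[OF g(1)] by simp
    ultimately show ?thesis by (simp add: \<Phi>_def)
  next
    case False
    have g: "weight g" "\<And>x. g x \<le> g0 x" using gW by (auto simp: W_def)
    have p: "0 < p" using False s by (cases p) auto
    have "\<exists>j<p. s / p < (\<Sum>i<p. (wcov g i j)\<^sup>2)"
    proof (rule ccontr)
      assume "\<not> ?thesis"
      then have "(\<Sum>j<p. \<Sum>i<p. (wcov g i j)\<^sup>2) \<le> (\<Sum>j<p. s / p)" by (intro sum_mono) auto
      then have "(\<Sum>j<p. \<Sum>i<p. (wcov g i j)\<^sup>2) \<le> s" using p by simp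
      with False show False by (subst (asm) sum.swap) simp
    qed
    then obtain j where j: "j < p" "s / p < (\<Sum>i<p. (wcov g i j)\<^sup>2)" by blast
    define a where "a = wmean g (X j) / 2"
    have a: "\<bar>a\<bar> \<le> 1/2" using wmean_X_bound[OF g(1), of j] by (simp add: a_def)
    define P where "P e = (1 + e * a) / 2" for e :: real
    have P: "0 < P 1" "0 < P (-1)" "P 1 + P (-1) = 1" using a by (auto simp: P_def field_simps)
    have pW: "pin g j e \<in> W" if "\<bar>e\<bar> = 1" for e
      using weight_pin[OF g(1) that, of j] pin_le[OF that, of g _ j] g by (auto simp: W_def weight_def less_imp_le intro: order_trans)
    have mp: "ln (mass (pin g j e)) = ln (mass g) + ln (P e)" if "\<bar>e\<bar> = 1" "0 < P e" for e
    proof -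
      have "mass (pin g j e) = mass g * P e" using mass_pin[OF g(1), of j e] by (simp add: P_def a_def)
      then show ?thesis using that mass_pos[OF g(1)] by (simp add: ln_mult)
    qed
    \<comment> \<open>The entropy bound, linearized: over the two signs the left-hand sides P(e) -
      1/2 add up to 0.\<close>
    have ent: "P e - 1/2 \<le> P e * (ln 2 + ln (P e))" if "0 < P e" for e
    proof -
      have "ln (1 / (2 * P e)) \<le> 1 / (2 * P e) - 1" using that by (intro ln_le_minus_one) auto
      then have "1 - 1 / (2 * P e) \<le> ln 2 + ln (P e)" using that by (simp add: ln_div ln_mult)
      then have "P e * (1 - 1 / (2 * P e)) \<le> P e * (ln 2 + ln (P e))" using that by (intro mult_left_mono) auto
      then show ?thesis using that by (simp add: algebra_simps)
    qed
    have mass_le: "ln (mass g) \<le> P 1 * ln (mass (pin g j 1)) + P (-1) * ln (mass (pin g j (-1))) + ln 2"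
    proof -
      have d: "P 1 * z + P (-1) * z = z" for z using P(3) by (simp flip: distrib_right)
      have "P 1 * ln (mass (pin g j 1)) + P (-1) * ln (mass (pin g j (-1))) + ln 2
          = P 1 * (ln (mass g) + ln (P 1)) + P (-1) * (ln (mass g) + ln (P (-1))) + ln 2"
        using mp P by simp
      also have "\<dots> = ln (mass g) + (P 1 * (ln 2 + ln (P 1)) + P (-1) * (ln 2 + ln (P (-1))))"
        unfolding distrib_left using d[of "ln (mass g)"] d[of "ln 2"] by linarith
      finally show ?thesis using ent[of 1] ent[of "-1"] P by linarith
    qed
    have "P 1 * V (pin g j 1) + P (-1) * V (pin g j (-1))
        = (\<Sum>i<p. (1 + a) / 2 * wcov (pin g j 1) i i + (1 - a) / 2 * wcov (pin g j (-1)) i i)"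
      by (simp add: V_def P_def sum.distrib sum_distrib_left)
    also have "\<dots> \<le> (\<Sum>i<p. wcov g i i - (wcov g i j)\<^sup>2 / 4)"
      unfolding a_def by (intro sum_mono wcov_pin_drop[OF g(1)])
    also have "\<dots> = V g - (\<Sum>i<p. (wcov g i j)\<^sup>2) / 4" by (simp add: V_def sum_subtractf sum_divide_distrib)
    also have "\<dots> \<le> V g - s / p / 4" using j by simp
    finally have "L * (P 1 * V (pin g j 1) + P (-1) * V (pin g j (-1))) \<le> L * (V g - s / p / 4)"
      using L by (rule mult_left_mono)
    also have "\<dots> = L * V g - 2 * ln 2" using s p by (simp add: L_def field_simps)
    finally have "\<Phi> g \<le> P 1 * \<Phi> (pin g j 1) + P (-1) * \<Phi> (pin g j (-1)) - ln 2"
    proof -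
      assume *: "L * (P 1 * V (pin g j 1) + P (-1) * V (pin g j (-1))) \<le> L * V g - 2 * ln 2"
      have "P 1 * \<Phi> (pin g j 1) + P (-1) * \<Phi> (pin g j (-1))
         = P 1 * ln (mass (pin g j 1)) + P (-1) * ln (mass (pin g j (-1))) - (P 1 + P (-1)) * (B + F * sqrt s)
           - L * (P 1 * V (pin g j 1) + P (-1) * V (pin g j (-1)))"
        by (simp add: \<Phi>_def algebra_simps)
      then show ?thesis using * mass_le P(3) by (simp add: \<Phi>_def)
    qed
    also have "P 1 * \<Phi> (pin g j 1) + P (-1) * \<Phi> (pin g j (-1)) \<le> P 1 * D + P (-1) * D"
      using P pW upper by (intro add_mono mult_left_mono) auto
    also have "P 1 * D + P (-1) * D = D" using P(3) by (simp flip: distrib_right)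
    finally show ?thesis by simp
  qed
  then have "D \<le> max 0 (D - ln 2)" unfolding D_def using g0W by (intro cSUP_least) auto
  moreover have "0 < ln (2::real)" by simp
  ultimately have "D \<le> 0" by linarith
  then have "\<Phi> g0 \<le> 0" using upper[OF g0W] by simp
  then have "ln (mass g0) \<le> B + F * sqrt s + L * V g0" by (simp add: \<Phi>_def)
  also have "L * V g0 \<le> L * p" using L V[OF g0] by (intro mult_left_mono) auto
  also have "L * p = 8 * ln 2 * (real p)\<^sup>2 / s" by (simp add: L_def power2_eq_square)
  finally show ?thesis by simp
qed

end

section \<open>Exponential tilts of laws on [-1, 1]\<close>

definition lmgf :: "real measure \<Rightarrow> real \<Rightarrow> real" where
  "lmgf P t = ln (\<integral>x. exp (t * x) \<partial>P)"

definition tilted_mean :: "real measure \<Rightarrow> real \<Rightarrow> real" where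
  "tilted_mean P t = (\<integral>x. x * exp (t * x) \<partial>P) / (\<integral>x. exp (t * x) \<partial>P)"

text \<open>The quadratic remainder needed to differentiate under the integral. For u = -x negative
  it follows from (1 + x)(1 - x + x^2) = 1 + x^3 \<ge> 1.\<close>

lemma exp_minus_affine_le:
  fixes u :: real
  assumes "\<bar>u\<bar> \<le> 1"
  shows "\<bar>exp u - 1 - u\<bar> \<le> u\<^sup>2"
proof -
  have "exp u \<le> 1 + u + u\<^sup>2"
  proof (cases "0 \<le> u")
    case True then show ?thesis using assms by (intro exp_bound) auto
  next
    case False
    define x where "x = - u"
    have x: "0 \<le> x" using False by (simp add: x_def)
    have "1 \<le> (1 + x) * (1 - x + x\<^sup>2)"
    proof -
      have "(1 + x) * (1 - x + x\<^sup>2) = 1 + x * x\<^sup>2" by (simp add: algebra_simps power2_eq_square)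
      then show ?thesis using x by simp
    qed
    also have "\<dots> \<le> exp x * (1 - x + x\<^sup>2)"
    proof (rule mult_right_mono)
      have "0 \<le> (x - 1/2)\<^sup>2" by simp
      then show "0 \<le> 1 - x + x\<^sup>2" by (simp add: power2_eq_square algebra_simps)
    qed (rule exp_ge_add_one_self)
    finally have "exp (- x) * 1 \<le> exp (- x) * (exp x * (1 - x + x\<^sup>2))" by (intro mult_left_mono) auto
    also have "\<dots> = 1 - x + x\<^sup>2" by (simp add: mult.assoc[symmetric] exp_minus)
    finally show ?thesis by (simp add: x_def)
  qed
  moreover have "1 + u \<le> exp u" by (rule exp_ge_add_one_self)
  moreover have "0 \<le> u\<^sup>2" by simp
  ultimately show ?thesis by linarith
qed

lemma abs_exp_le: "\<bar>x\<bar> \<le> 1 \<Longrightarrow> \<bar>exp (t * (x - m))\<bar> \<le> exp (\<bar>t\<bar> * (1 + \<bar>m\<bar>))" for x t m :: real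
proof -
  assume "\<bar>x\<bar> \<le> 1"
  then have "\<bar>t\<bar> * \<bar>x - m\<bar> \<le> \<bar>t\<bar> * (1 + \<bar>m\<bar>)" by (intro mult_left_mono) auto
  moreover have "t * (x - m) \<le> \<bar>t\<bar> * \<bar>x - m\<bar>" by (metis abs_ge_self abs_mult)
  ultimately show ?thesis by simp
qed

locale unit_distribution = prob_space P for P :: "real measure" +
  assumes sets_P[measurable_cong, simp]: "sets P = sets borel"
    and AE_abs_le_1: "AE x in P. \<bar>x\<bar> \<le> 1"
begin

lemma integrable_bounded:
  fixes f :: "real \<Rightarrow> real"
  assumes "f \<in> borel_measurable borel" "\<And>x. \<bar>x\<bar> \<le> 1 \<Longrightarrow> \<bar>f x\<bar> \<le> C"
  shows "integrable P f"
proof (rule integrable_const_bound[of _ C])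
  show "AE x in P. norm (f x) \<le> C" using AE_abs_le_1 by eventually_elim (use assms(2) in simp)
qed (use assms(1) in simp)

lemma integrable_exp: "integrable P (\<lambda>x. exp (t * (x - m)))"
  by (rule integrable_bounded[OF _ abs_exp_le]) auto

lemma integrable_mult_exp: "integrable P (\<lambda>x. (x - m) * exp (t * (x - m)))"
proof (rule integrable_bounded)
  fix x :: real assume x: "\<bar>x\<bar> \<le> 1"
  then have "\<bar>x - m\<bar> * \<bar>exp (t * (x - m))\<bar> \<le> (1 + \<bar>m\<bar>) * exp (\<bar>t\<bar> * (1 + \<bar>m\<bar>))"
    using abs_exp_le[OF x, of t m] by (intro mult_mono) auto
  then show "\<bar>(x - m) * exp (t * (x - m))\<bar> \<le> (1 + \<bar>m\<bar>) * exp (\<bar>t\<bar> * (1 + \<bar>m\<bar>))" by (simp add: abs_mult)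
qed auto

lemma mgf_pos: "0 < (\<integral>x. exp (t * (x - m)) \<partial>P)"
proof -
  have "(\<integral>x. exp (t * (x - m)) \<partial>P) \<noteq> 0"
  proof
    assume "(\<integral>x. exp (t * (x - m)) \<partial>P) = 0"
    then have "AE x in P. exp (t * (x - m)) = 0"
      using integrable_exp by (subst (asm) integral_nonneg_eq_0_iff_AE) auto
    then show False by (simp add: AE_False)
  qed
  moreover have "0 \<le> (\<integral>x. exp (t * (x - m)) \<partial>P)" by simp
  ultimately show ?thesis by linarith
qed

text \<open>Differentiation under the integral: K bounds |x - m|, so for |h| < 1/K the exponential
  remainder bound holds pointwise and the difference quotient is off by O(|h|). The centre m = 0
  serves the cumulant, a general m the search for a tilt with mean m.\<close>

lemma mgf_has_derivative:
  "((\<lambda>t. \<integral>x. exp (t * (x - m)) \<partial>P) has_real_derivative (\<integral>x. (x - m) * exp (t * (x - m)) \<partial>P)) (at t)"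
proof -
  define F where "F t = (\<integral>x. exp (t * (x - m)) \<partial>P)" for t
  define F' where "F' = (\<integral>x. (x - m) * exp (t * (x - m)) \<partial>P)"
  define K where "K = 1 + \<bar>m\<bar>"
  have K: "0 < K" by (simp add: K_def add_pos_nonneg)
  have xK: "\<bar>x - m\<bar> \<le> K" if "\<bar>x\<bar> \<le> 1" for x using that by (auto simp: K_def)
  have est: "\<bar>(F (t + h) - F t) / h - F'\<bar> \<le> \<bar>h\<bar> * (K\<^sup>2 * F t)" if h: "h \<noteq> 0" "\<bar>h\<bar> < 1 / K" for h
  proof -
    have eq: "F (t + h) - F t - h * F' = (\<integral>x. exp ((t + h) * (x - m)) - exp (t * (x - m)) - h * ((x - m) * exp (t * (x - m))) \<partial>P)"
      unfolding F_def F'_def using integrable_exp integrable_mult_exp by simp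
    have "\<bar>F (t + h) - F t - h * F'\<bar> \<le> (\<integral>x. (h\<^sup>2 * K\<^sup>2) * exp (t * (x - m)) \<partial>P)"
      unfolding eq
    proof (rule integral_abs_bound[THEN order_trans], rule integral_mono_AE)
      show "AE x in P. \<bar>exp ((t + h) * (x - m)) - exp (t * (x - m)) - h * ((x - m) * exp (t * (x - m)))\<bar>
          \<le> (h\<^sup>2 * K\<^sup>2) * exp (t * (x - m))"
        using AE_abs_le_1
      proof eventually_elim
        case (elim x)
        define u where "u = h * (x - m)"
        have "\<bar>h\<bar> * \<bar>x - m\<bar> \<le> \<bar>h\<bar> * K" using xK[OF elim] by (intro mult_left_mono) auto
        also have "\<dots> \<le> 1 / K * K" using h K by (intro mult_right_mono) auto
        finally have u1: "\<bar>u\<bar> \<le> 1" using K by (simp add: u_def abs_mult)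
        have "(x - m)\<^sup>2 \<le> K\<^sup>2" using xK[OF elim] K by (simp add: abs_le_square_iff[symmetric])
        then have u2: "u\<^sup>2 \<le> h\<^sup>2 * K\<^sup>2" unfolding u_def power_mult_distrib by (intro mult_left_mono) auto
        have "exp ((t + h) * (x - m)) = exp (t * (x - m)) * exp u"
          by (simp add: u_def exp_add[symmetric] algebra_simps)
        then have e: "exp ((t + h) * (x - m)) - exp (t * (x - m)) - h * ((x - m) * exp (t * (x - m)))
           = exp (t * (x - m)) * (exp u - 1 - u)"
          by (simp add: u_def algebra_simps)
        have "\<bar>exp (t * (x - m)) * (exp u - 1 - u)\<bar> \<le> exp (t * (x - m)) * (h\<^sup>2 * K\<^sup>2)"
          using exp_minus_affine_le[OF u1] u2 by (auto simp: abs_mult intro: mult_left_mono)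
        then show ?case unfolding e by (simp add: mult.commute)
      qed
    qed (intro integrable_abs Bochner_Integration.integrable_diff integrable_mult_right integrable_exp integrable_mult_exp)+
    also have "\<dots> = h\<^sup>2 * K\<^sup>2 * F t" by (simp add: F_def)
    finally have "\<bar>F (t + h) - F t - h * F'\<bar> / \<bar>h\<bar> \<le> h\<^sup>2 * K\<^sup>2 * F t / \<bar>h\<bar>" by (rule divide_right_mono) simp
    also have "h\<^sup>2 * K\<^sup>2 * F t / \<bar>h\<bar> = \<bar>h\<bar> * (K\<^sup>2 * F t)"
      using h(1) by (simp add: power2_eq_square field_simps)
    also have "\<bar>F (t + h) - F t - h * F'\<bar> / \<bar>h\<bar> = \<bar>(F (t + h) - F t) / h - F'\<bar>"
      using h(1) by (simp add: abs_divide[symmetric] diff_divide_distrib)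
    finally show ?thesis .
  qed
  have "(\<lambda>h. (F (t + h) - F t) / h) \<midarrow>0\<rightarrow> F'"
  proof (rule LIM_zero_cancel, rule Lim_null_comparison)
    show "\<forall>\<^sub>F h in at 0. norm ((F (t + h) - F t) / h - F') \<le> \<bar>h\<bar> * (K\<^sup>2 * F t)"
      unfolding eventually_at using K est by (intro exI[of _ "1 / K"]) (auto simp: dist_norm)
    show "((\<lambda>h. \<bar>h\<bar> * (K\<^sup>2 * F t)) \<longlongrightarrow> 0) (at 0)" by (auto intro!: tendsto_eq_intros)
  qed
  then show ?thesis by (simp add: DERIV_def F_def F'_def)
qed

lemma lmgf_has_derivative: "(lmgf P has_real_derivative tilted_mean P t) (at t)"
proof -
  have "((\<lambda>t. ln (\<integral>x. exp (t * (x - 0)) \<partial>P)) has_real_derivative tilted_mean P t) (at t)"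
    using mgf_pos[of t 0] mgf_has_derivative[of 0 t]
    by (auto intro!: derivative_eq_intros simp: tilted_mean_def)
  then show ?thesis by (simp add: lmgf_def[abs_def])
qed

text \<open>If s (x - m) is at least 1/(n + 1) on a set of mass e > 0, then R = (n + 1)/e gives at
  least e exp(1/e) \<ge> e + 1.\<close>

lemma mgf_unbounded:
  assumes "\<not> (AE x in P. s * (x - m) \<le> 0)"
  shows "\<exists>R>0. 1 < (\<integral>x. exp (s * R * (x - m)) \<partial>P)"
proof -
  define E where "E n = {x. 1 / real (Suc n) \<le> s * (x - m)}" for n
  have Em[measurable]: "E n \<in> sets borel" for n unfolding E_def by measurable
  have "\<exists>n. 0 < measure P (E n)"
  proof (rule ccontr)
    assume "\<not> ?thesis"
    then have "emeasure P (E n) = 0" for n by (simp add: emeasure_eq_measure not_less measure_le_0_iff)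
    then have "AE x in P. x \<notin> E n" for n by (intro AE_not_in) (auto simp: null_sets_def)
    then have "AE x in P. \<forall>n. x \<notin> E n" by (simp add: AE_all_countable)
    then have "AE x in P. s * (x - m) \<le> 0"
    proof eventually_elim
      case (elim x)
      show ?case
      proof (rule ccontr)
        assume "\<not> s * (x - m) \<le> 0"
        then obtain n where "1 / real (Suc n) < s * (x - m)" using nat_approx_posE by (metis not_le)
        then have "x \<in> E n" by (simp add: E_def)
        then show False using elim by blast
      qed
    qed
    with assms show False by simp
  qed
  then obtain n where n: "0 < measure P (E n)" by blast
  define e where "e = measure P (E n)"
  define R where "R = real (Suc n) / e"
  have R: "0 < R" using n by (simp add: R_def e_def)
  have "1 < e * exp (R / real (Suc n))"
  proof -
    have "1 + 1 / e \<le> exp (1 / e)" by (rule exp_ge_add_one_self)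
    then have "e * (1 + 1 / e) \<le> e * exp (1 / e)" using n by (intro mult_left_mono) (auto simp: e_def)
    moreover have "e * (1 + 1 / e) = e + 1" using n by (simp add: e_def field_simps)
    moreover have "R / real (Suc n) = 1 / e" by (simp add: R_def)
    moreover have "0 < e" using n by (simp add: e_def)
    ultimately show ?thesis by simp
  qed
  also have "e * exp (R / real (Suc n)) = (\<integral>x. indicator (E n) x * exp (R / real (Suc n)) \<partial>P)"
    by (simp add: e_def)
  also have "\<dots> \<le> (\<integral>x. exp (s * R * (x - m)) \<partial>P)"
  proof (rule integral_mono)
    show "integrable P (\<lambda>x. indicator (E n) x * exp (R / real (Suc n)))" by (simp add: emeasure_eq_measure)
    show "integrable P (\<lambda>x. exp (s * R * (x - m)))" by (rule integrable_exp)
    show "indicator (E n) x * exp (R / real (Suc n)) \<le> exp (s * R * (x - m))" for x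
    proof (cases "x \<in> E n")
      case True
      then have "R * (1 / real (Suc n)) \<le> R * (s * (x - m))" using R by (intro mult_left_mono) (auto simp: E_def)
      then show ?thesis using True by (simp add: mult_ac)
    qed simp
  qed
  finally show ?thesis using R by blast
qed

text \<open>The hypothesis holds for the mean \<open>m\<close> of any law equivalent to \<open>P\<close>. If \<open>P\<close> is not a point mass,
  the convex function \<open>t \<mapsto> \<integral> exp (t (x - m)) dP\<close> then grows at both ends, and \<open>t\<close> is its minimizer.\<close>

lemma exists_tilted_mean:
  assumes "(AE x in P. x \<le> m) \<or> (AE x in P. m \<le> x) \<Longrightarrow> AE x in P. x = m"
  shows "\<exists>t. tilted_mean P t = m"
proof (cases "AE x in P. x = m")
  case True
  then have "(\<integral>x. x \<partial>P) = (\<integral>x. m \<partial>P)" by (intro integral_cong_AE) auto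
  then show ?thesis by (intro exI[of _ 0]) (simp add: tilted_mean_def prob_space)
next
  case False
  then have ns: "\<not> (AE x in P. 1 * (x - m) \<le> 0)" "\<not> (AE x in P. -1 * (x - m) \<le> 0)" using assms by auto
  define f where "f t = (\<integral>x. exp (t * (x - m)) \<partial>P)" for t
  have D: "(f has_real_derivative (\<integral>x. (x - m) * exp (t * (x - m)) \<partial>P)) (at t)" for t
    using mgf_has_derivative[of m t] by (simp add: f_def[abs_def])
  obtain R where R: "0 < R" "1 < f R" using mgf_unbounded[OF ns(1)] by (auto simp: f_def)
  obtain R' where R': "0 < R'" "1 < f (-R')" using mgf_unbounded[OF ns(2)] by (auto simp: f_def)
  have f0: "f 0 = 1" by (simp add: f_def prob_space)
  have "continuous_on {-R'..R} f"
    using D by (intro continuous_at_imp_continuous_on ballI DERIV_isCont)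
  then obtain t where t: "t \<in> {-R'..R}" "\<And>y. y \<in> {-R'..R} \<Longrightarrow> f t \<le> f y"
    using continuous_attains_inf[of "{-R'..R}" f] R R' by auto
  \<comment> \<open>The value 1 at 0 lies below both end values, so the minimizer is interior and
    the derivative vanishes there.\<close>
  have "f t \<le> 1" using t(2)[of 0] R R' f0 by simp
  then have t': "-R' < t" "t < R" using t(1) R R' by (auto simp: less_le)
  have "(\<integral>x. (x - m) * exp (t * (x - m)) \<partial>P) = 0"
  proof (rule DERIV_local_min[OF D])
    show "0 < min (t + R') (R - t)" using t' by simp
    show "\<forall>y. \<bar>t - y\<bar> < min (t + R') (R - t) \<longrightarrow> f t \<le> f y"
      by (intro allI impI t(2)) (auto simp: abs_less_iff)
  qed
  also have "(\<integral>x. (x - m) * exp (t * (x - m)) \<partial>P) = (\<integral>x. exp (- t * m) * (x * exp (t * x)) - exp (- t * m) * m * exp (t * x) \<partial>P)"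
    by (intro Bochner_Integration.integral_cong) (auto simp: algebra_simps exp_diff exp_minus field_simps)
  also have "\<dots> = exp (- t * m) * (\<integral>x. x * exp (t * x) \<partial>P) - exp (- t * m) * m * (\<integral>x. exp (t * x) \<partial>P)"
    using integrable_exp[of t 0] integrable_mult_exp[of 0 t]
    by (subst Bochner_Integration.integral_diff) simp_all
  finally have "exp (- t * m) * ((\<integral>x. x * exp (t * x) \<partial>P) - m * (\<integral>x. exp (t * x) \<partial>P)) = 0"
    by (simp add: algebra_simps)
  then have "(\<integral>x. x * exp (t * x) \<partial>P) = m * (\<integral>x. exp (t * x) \<partial>P)" by simp
  then have "tilted_mean P t = m" using mgf_pos[of t 0] by (simp add: tilted_mean_def)
  then show ?thesis by blast
qed

end

section \<open>Mean-field approximation for product laws\<close>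

definition clip :: "real \<Rightarrow> real" where "clip x = max (-1) (min 1 x)"

lemma borel_measurable_clip[measurable]: "clip \<in> borel_measurable borel"
  unfolding clip_def[abs_def] by measurable

lemma abs_clip_le: "\<bar>clip x\<bar> \<le> 1" by (auto simp: clip_def)

lemma clip_eq: "\<bar>x\<bar> \<le> 1 \<Longrightarrow> clip x = x" by (auto simp: clip_def)

definition quad_energy :: "nat \<Rightarrow> (nat \<Rightarrow> nat \<Rightarrow> real) \<Rightarrow> (nat \<Rightarrow> real) \<Rightarrow> (nat \<Rightarrow> real) \<Rightarrow> real" where
  "quad_energy p A v x = (\<Sum>i<p. v i * x i) - bilin {..<p} A x x / 2"

text \<open>The subtracted sum is the relative entropy of the tilted product law with respect to the
  product of the \<open>P i\<close>.\<close>

definition mf_value :: "nat \<Rightarrow> (nat \<Rightarrow> nat \<Rightarrow> real) \<Rightarrow> (nat \<Rightarrow> real) \<Rightarrow> (nat \<Rightarrow> real measure) \<Rightarrow> (nat \<Rightarrow> real) \<Rightarrow> real" where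
  "mf_value p A v P \<gamma> = quad_energy p A v (\<lambda>i. tilted_mean (P i) (\<gamma> i))
     - (\<Sum>i<p. \<gamma> i * tilted_mean (P i) (\<gamma> i) - lmgf (P i) (\<gamma> i))"

lemma (in unit_distribution) AE_clip: "AE x in P. clip x = x"
  using AE_abs_le_1 by eventually_elim (rule clip_eq)

lemma (in unit_distribution) integral_clip:
  fixes f :: "real \<Rightarrow> real"
  assumes [measurable]: "f \<in> borel_measurable borel"
  shows "(\<integral>x. f (clip x) \<partial>P) = (\<integral>x. f x \<partial>P)"
proof (rule integral_cong_AE)
  show "AE x in P. f (clip x) = f x" using AE_clip by eventually_elim simp
qed measurable

locale product_unit_distributions =
  fixes p :: nat and P :: "nat \<Rightarrow> real measure" and A :: "nat \<Rightarrow> nat \<Rightarrow> real" and v :: "nat \<Rightarrow> real"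
  assumes unit: "\<And>i. unit_distribution (P i)"
    and A_diag: "\<And>i. A i i = 0"
begin

definition X :: "nat \<Rightarrow> (nat \<Rightarrow> real) \<Rightarrow> real" where "X i x = (if i < p then clip (x i) else 0)"

lemma sets_P[measurable_cong, simp]: "sets (P i) = sets borel"
  using unit by (rule unit_distribution.sets_P)

lemma prob_P: "prob_space (P i)" using unit by (simp add: unit_distribution_def)

lemma component_measurable: "i < p \<Longrightarrow> (\<lambda>x. x i) \<in> borel_measurable (PiM {..<p} P)"
  using measurable_component_singleton[of i "{..<p}" P] by (simp cong: measurable_cong_sets)

sublocale prod: product_prob_space P "{..<p}"
  by (simp add: product_prob_space_def product_prob_space_axioms_def product_sigma_finite_def prob_P prob_space_imp_sigma_finite)

sublocale bounded_coordinates "PiM {..<p} P" p X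
proof
  fix i
  show "X i \<in> borel_measurable (PiM {..<p} P)"
  proof (cases "i < p")
    case True
    note component_measurable[OF True, measurable]
    show ?thesis using True by (simp add: X_def[abs_def])
  qed (simp add: X_def[abs_def])
qed (simp add: abs_clip_le X_def)

definition H :: "(nat \<Rightarrow> real) \<Rightarrow> real" where
  "H x = (\<Sum>i<p. v i * X i x) - (\<Sum>i<p. \<Sum>j<p. A i j * (X i x * X j x)) / 2"

definition H_bd :: real where "H_bd = (\<Sum>i<p. \<bar>v i\<bar>) + (\<Sum>i<p. \<Sum>j<p. \<bar>A i j\<bar>) / 2"

lemma H_measurable[measurable]: "H \<in> borel_measurable (PiM {..<p} P)"
  unfolding H_def[abs_def] by measurable

lemma lin_bd: "\<bar>\<Sum>i<p. c i * X i x\<bar> \<le> (\<Sum>i<p. \<bar>c i\<bar>)" for c :: "nat \<Rightarrow> real"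
  by (intro sum_abs[THEN order_trans] sum_mono) (use X_bound in \<open>auto simp: abs_mult intro!: mult_left_le\<close>)

lemma quad_bd: "\<bar>\<Sum>i<p. \<Sum>j<p. A i j * (X i x * X j x)\<bar> \<le> (\<Sum>i<p. \<Sum>j<p. \<bar>A i j\<bar>)"
proof (intro sum_abs[THEN order_trans] sum_mono)
  fix i j
  have "\<bar>A i j\<bar> * \<bar>X i x * X j x\<bar> \<le> \<bar>A i j\<bar> * 1" using X_mult_bound by (rule mult_left_mono) simp
  then show "\<bar>A i j * (X i x * X j x)\<bar> \<le> \<bar>A i j\<bar>" unfolding abs_mult by simp
qed

lemma abs_H_le: "\<bar>H x\<bar> \<le> H_bd"
  unfolding H_def H_bd_def using lin_bd[of v x] quad_bd[of x] by linarith

text \<open>Log-density of the tilted product law; the \<open>lmgf\<close> terms normalize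
  it.\<close>

definition T :: "(nat \<Rightarrow> real) \<Rightarrow> (nat \<Rightarrow> real) \<Rightarrow> real" where
  "T \<gamma> x = (\<Sum>i<p. \<gamma> i * X i x) - (\<Sum>i<p. lmgf (P i) (\<gamma> i))"

lemma T_measurable[measurable]: "T \<gamma> \<in> borel_measurable (PiM {..<p} P)"
  unfolding T_def[abs_def] by measurable

lemma abs_T_le: "\<bar>T \<gamma> x\<bar> \<le> (\<Sum>i<p. \<bar>\<gamma> i\<bar>) + \<bar>\<Sum>i<p. lmgf (P i) (\<gamma> i)\<bar>"
  unfolding T_def using lin_bd[of \<gamma> x] by linarith

lemma weight_exp: assumes "f \<in> borel_measurable (PiM {..<p} P)" "\<And>x. \<bar>f x\<bar> \<le> C" shows "weight (\<lambda>x. exp (f x))"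
  unfolding weight_def using assms by (auto intro!: exI[of _ "exp C"] simp: abs_le_iff)

lemma wmean_lin:
  fixes c :: "nat \<Rightarrow> real"
  assumes "weight g" shows "wmean g (\<lambda>x. \<Sum>i<p. c i * X i x) = (\<Sum>i<p. c i * wmean g (X i))"
proof -
  have "wmean g (\<lambda>x. \<Sum>i<p. c i * X i x) = (\<Sum>i<p. wmean g (\<lambda>x. c i * X i x))"
  proof (rule wmean_sum[OF assms, where C = "\<lambda>i. \<bar>c i\<bar>"])
    show "\<bar>c i * X i x\<bar> \<le> \<bar>c i\<bar>" for i x using X_bound[of i x] by (simp add: abs_mult mult_left_le)
  qed measurable
  then show ?thesis by (simp add: wmean_cmult)
qed

lemma wmean_quad:
  assumes "weight g"
  shows "wmean g (\<lambda>x. \<Sum>i<p. \<Sum>j<p. A i j * (X i x * X j x)) = (\<Sum>i<p. \<Sum>j<p. A i j * wmean g (\<lambda>x. X i x * X j x))"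
proof -
  have b: "\<bar>A i j * (X i x * X j x)\<bar> \<le> \<bar>A i j\<bar>" for i j x
  proof -
    have "\<bar>A i j\<bar> * \<bar>X i x * X j x\<bar> \<le> \<bar>A i j\<bar> * 1" using X_mult_bound by (rule mult_left_mono) simp
    then show ?thesis unfolding abs_mult[of "A i j"] by simp
  qed
  have m: "(\<lambda>x. A i j * (X i x * X j x)) \<in> borel_measurable (PiM {..<p} P)" for i j by measurable
  have "wmean g (\<lambda>x. \<Sum>i<p. \<Sum>j<p. A i j * (X i x * X j x)) = (\<Sum>i<p. wmean g (\<lambda>x. \<Sum>j<p. A i j * (X i x * X j x)))"
    by (rule wmean_sum[OF assms, where C = "\<lambda>i. \<Sum>j<p. \<bar>A i j\<bar>"])
      (use m b in \<open>auto intro!: sum_abs[THEN order_trans] sum_mono\<close>)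
  also have "\<dots> = (\<Sum>i<p. \<Sum>j<p. wmean g (\<lambda>x. A i j * (X i x * X j x)))"
    by (intro sum.cong refl wmean_sum[OF assms m b])
  finally show ?thesis by (simp only: wmean_cmult)
qed

lemma wmean_diff:
  assumes "weight g" "f \<in> borel_measurable (PiM {..<p} P)" "\<And>x. \<bar>f x\<bar> \<le> C" "h \<in> borel_measurable (PiM {..<p} P)" "\<And>x. \<bar>h x\<bar> \<le> D"
  shows "wmean g (\<lambda>x. f x - h x) = wmean g f - wmean g h"
  using wmean_add[OF assms(1-3), of "\<lambda>x. (-1) * h x" D] assms(4,5) wmean_cmult[of g "-1" h] by simp

lemma wmean_H:
  assumes "weight g"
  shows "wmean g H = (\<Sum>i<p. v i * wmean g (X i)) - (\<Sum>i<p. \<Sum>j<p. A i j * wmean g (\<lambda>x. X i x * X j x)) / 2"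
proof -
  define q where "q x = (\<Sum>i<p. \<Sum>j<p. A i j * (X i x * X j x))" for x
  have q: "q \<in> borel_measurable (PiM {..<p} P)" unfolding q_def[abs_def] by measurable
  have q_bd: "\<bar>1/2 * q x\<bar> \<le> 1/2 * (\<Sum>i<p. \<Sum>j<p. \<bar>A i j\<bar>)" for x
    using quad_bd[of x] unfolding abs_mult q_def by simp
  have "wmean g (\<lambda>x. (\<Sum>i<p. v i * X i x) - 1/2 * q x) = wmean g (\<lambda>x. \<Sum>i<p. v i * X i x) - wmean g (\<lambda>x. 1/2 * q x)"
    by (rule wmean_diff[OF assms _ lin_bd _ q_bd]) (use q in measurable)
  moreover have "H = (\<lambda>x. (\<Sum>i<p. v i * X i x) - 1/2 * q x)"
    by (simp add: H_def[abs_def] q_def)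
  moreover have "wmean g q = (\<Sum>i<p. \<Sum>j<p. A i j * wmean g (\<lambda>x. X i x * X j x))"
    using wmean_quad[OF assms] by (simp add: q_def[abs_def])
  ultimately show ?thesis using wmean_lin[OF assms, of v] wmean_cmult[of g "1/2" q] by simp
qed

lemma wmean_T:
  assumes "weight g"
  shows "wmean g (T \<gamma>) = (\<Sum>i<p. \<gamma> i * wmean g (X i) - lmgf (P i) (\<gamma> i))"
proof -
  have "wmean g (T \<gamma>) = wmean g (\<lambda>x. \<Sum>i<p. \<gamma> i * X i x) - wmean g (\<lambda>x. \<Sum>i<p. lmgf (P i) (\<gamma> i))"
    unfolding T_def[abs_def] by (rule wmean_diff[OF assms _ lin_bd _ order_refl]) measurable
  then show ?thesis using wmean_lin[OF assms] by (simp add: wmean_const[OF assms] sum_subtractf)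
qed

lemma mf_value_eq:
  assumes "\<And>i. i < p \<Longrightarrow> u i = tilted_mean (P i) (\<gamma> i)"
  shows "mf_value p A v P \<gamma> = (\<Sum>i<p. v i * u i) - (\<Sum>i<p. \<Sum>j<p. A i j * (u i * u j)) / 2 - (\<Sum>i<p. \<gamma> i * u i - lmgf (P i) (\<gamma> i))"
  using assms by (simp add: mf_value_def quad_energy_def bilin_def mult.assoc cong: sum.cong_simp)

section \<open>Moments under the tilted product law\<close>

lemma tilt_integral:
  fixes f :: "nat \<Rightarrow> real \<Rightarrow> real"
  assumes f: "\<And>i. f i \<in> borel_measurable borel" "\<And>i x. \<bar>f i x\<bar> \<le> C"
  shows "(\<integral>x. exp (T \<gamma> x) * (\<Prod>i<p. f i (X i x)) \<partial>PiM {..<p} P)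
     = (\<Prod>i<p. (\<integral>x. exp (\<gamma> i * x) * f i x \<partial>P i) / (\<integral>x. exp (\<gamma> i * x) \<partial>P i))"
proof -
  have "(\<integral>x. exp (T \<gamma> x) * (\<Prod>i<p. f i (X i x)) \<partial>PiM {..<p} P)
     = (\<integral>x. (\<Prod>i<p. exp (\<gamma> i * clip (x i) - lmgf (P i) (\<gamma> i)) * f i (clip (x i))) \<partial>PiM {..<p} P)"
  proof (rule Bochner_Integration.integral_cong[OF refl])
    fix x :: "nat \<Rightarrow> real"
    have "exp (T \<gamma> x) = (\<Prod>i<p. exp (\<gamma> i * X i x - lmgf (P i) (\<gamma> i)))"
      by (simp add: T_def sum_subtractf[symmetric] exp_sum)
    then show "exp (T \<gamma> x) * (\<Prod>i<p. f i (X i x)) = (\<Prod>i<p. exp (\<gamma> i * clip (x i) - lmgf (P i) (\<gamma> i)) * f i (clip (x i)))"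
      by (simp add: prod.distrib X_def cong: prod.cong_simp)
  qed
  also have "\<dots> = (\<Prod>i<p. \<integral>x. exp (\<gamma> i * clip x - lmgf (P i) (\<gamma> i)) * f i (clip x) \<partial>P i)"
  proof (rule prod.product_integral_prod)
    fix i
    interpret Pi: unit_distribution "P i" by (rule unit)
    have [measurable]: "f i \<in> borel_measurable borel" by fact
    show "integrable (P i) (\<lambda>x. exp (\<gamma> i * clip x - lmgf (P i) (\<gamma> i)) * f i (clip x))"
    proof (rule Pi.integrable_bounded)
      fix x
      have "\<bar>\<gamma> i\<bar> * \<bar>clip x\<bar> \<le> \<bar>\<gamma> i\<bar> * 1" using abs_clip_le[of x] by (intro mult_left_mono) auto
      moreover have "\<gamma> i * clip x \<le> \<bar>\<gamma> i\<bar> * \<bar>clip x\<bar>" unfolding abs_mult[symmetric] by (rule abs_ge_self)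
      ultimately have "\<gamma> i * clip x \<le> \<bar>\<gamma> i\<bar> * 1" by linarith
      then have "exp (\<gamma> i * clip x - lmgf (P i) (\<gamma> i)) * \<bar>f i (clip x)\<bar> \<le> exp (\<bar>\<gamma> i\<bar> - lmgf (P i) (\<gamma> i)) * C"
        using f(2) by (intro mult_mono) auto
      then show "\<bar>exp (\<gamma> i * clip x - lmgf (P i) (\<gamma> i)) * f i (clip x)\<bar> \<le> exp (\<bar>\<gamma> i\<bar> - lmgf (P i) (\<gamma> i)) * C"
        by (simp add: abs_mult)
    qed measurable
  qed simp
  also have "\<dots> = (\<Prod>i<p. (\<integral>x. exp (\<gamma> i * x) * f i x \<partial>P i) / (\<integral>x. exp (\<gamma> i * x) \<partial>P i))"
  proof (rule prod.cong[OF refl])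
    fix i
    interpret Pi: unit_distribution "P i" by (rule unit)
    have [measurable]: "f i \<in> borel_measurable borel" by fact
    have "(\<integral>x. exp (\<gamma> i * clip x - lmgf (P i) (\<gamma> i)) * f i (clip x) \<partial>P i) = (\<integral>x. exp (\<gamma> i * x - lmgf (P i) (\<gamma> i)) * f i x \<partial>P i)"
      by (rule Pi.integral_clip[of "\<lambda>x. exp (\<gamma> i * x - lmgf (P i) (\<gamma> i)) * f i x"]) measurable
    also have "\<dots> = (\<integral>x. (exp (\<gamma> i * x) * f i x) / (\<integral>x. exp (\<gamma> i * x) \<partial>P i) \<partial>P i)"
      using Pi.mgf_pos[of "\<gamma> i" 0] by (intro Bochner_Integration.integral_cong) (auto simp: exp_diff lmgf_def)
    finally show "(\<integral>x. exp (\<gamma> i * clip x - lmgf (P i) (\<gamma> i)) * f i (clip x) \<partial>P i) = (\<integral>x. exp (\<gamma> i * x) * f i x \<partial>P i) / (\<integral>x. exp (\<gamma> i * x) \<partial>P i)"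
      by simp
  qed
  finally show ?thesis .
qed

lemma mass_tilt: "mass (\<lambda>x. exp (T \<gamma> x)) = 1"
proof -
  have "(\<integral>x. exp (\<gamma> i * x) \<partial>P i) \<noteq> 0" for i using unit_distribution.mgf_pos[OF unit, of i "\<gamma> i" 0] by simp
  then show ?thesis using tilt_integral[of "\<lambda>_ _. 1" 1 \<gamma>] by (simp add: mass_def)
qed

lemma tilt_moments:
  assumes "k < p"
  shows "wmean (\<lambda>x. exp (T \<gamma> x)) (X k) = tilted_mean (P k) (\<gamma> k)"
    and "l < p \<Longrightarrow> l \<noteq> k \<Longrightarrow> wmean (\<lambda>x. exp (T \<gamma> x)) (\<lambda>x. X k x * X l x) = tilted_mean (P k) (\<gamma> k) * tilted_mean (P l) (\<gamma> l)"
proof -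
  have nz: "(\<integral>x. exp (\<gamma> i * x) \<partial>P i) \<noteq> 0" for i using unit_distribution.mgf_pos[OF unit, of i "\<gamma> i" 0] by simp
  have mean: "(\<integral>x. exp (\<gamma> i * x) * clip x \<partial>P i) / (\<integral>x. exp (\<gamma> i * x) \<partial>P i) = tilted_mean (P i) (\<gamma> i)" for i
  proof -
    interpret Pi: unit_distribution "P i" by (rule unit)
    have "(\<integral>x. exp (\<gamma> i * x) * clip x \<partial>P i) = (\<integral>x. x * exp (\<gamma> i * x) \<partial>P i)"
    proof (rule integral_cong_AE)
      show "AE x in P i. exp (\<gamma> i * x) * clip x = x * exp (\<gamma> i * x)" using Pi.AE_clip by eventually_elim simp
    qed measurable
    then show ?thesis by (simp add: tilted_mean_def)
  qed
  have *: "wmean (\<lambda>x. exp (T \<gamma> x)) (\<lambda>x. \<Prod>i\<in>K. X i x) = (\<Prod>i\<in>K. tilted_mean (P i) (\<gamma> i))" if K: "K \<subseteq> {..<p}" for K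
  proof -
    define f where "f i x = (if i \<in> K then clip x else 1)" for i x
    have f: "f i \<in> borel_measurable borel" "\<bar>f i x\<bar> \<le> 1" for i x
      unfolding f_def using abs_clip_le by auto
    have cc: "clip (clip x) = clip x" for x using abs_clip_le by (rule clip_eq)
    have P: "(\<Prod>i<p. f i (X i x)) = (\<Prod>i\<in>K. X i x)" for x
    proof -
      have "(\<Prod>i\<in>K. X i x) = (\<Prod>i<p. if i \<in> K then X i x else 1)"
        using K by (simp add: prod.If_cases Int_absorb1)
      also have "\<dots> = (\<Prod>i<p. f i (X i x))" by (intro prod.cong) (auto simp: f_def X_def cc)
      finally show ?thesis ..
    qed
    have "(\<Prod>i<p. (\<integral>x. exp (\<gamma> i * x) * f i x \<partial>P i) / (\<integral>x. exp (\<gamma> i * x) \<partial>P i)) = (\<Prod>i<p. if i \<in> K then tilted_mean (P i) (\<gamma> i) else 1)"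
      using mean nz by (intro prod.cong) (auto simp: f_def)
    also have "\<dots> = (\<Prod>i\<in>K. tilted_mean (P i) (\<gamma> i))" using K by (simp add: prod.If_cases Int_absorb1)
    finally show ?thesis using tilt_integral[of f 1 \<gamma>] f by (simp add: P wmean_def mass_tilt)
  qed
  show "wmean (\<lambda>x. exp (T \<gamma> x)) (X k) = tilted_mean (P k) (\<gamma> k)" using *[of "{k}"] assms by simp
  show "wmean (\<lambda>x. exp (T \<gamma> x)) (\<lambda>x. X k x * X l x) = tilted_mean (P k) (\<gamma> k) * tilted_mean (P l) (\<gamma> l)" if "l < p" "l \<noteq> k"
    using *[of "{k, l}"] assms that by simp
qed

lemma mass_H: "mass (\<lambda>x. exp (H x)) = (\<integral>x. exp (quad_energy p A v x) \<partial>PiM {..<p} P)"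
  unfolding mass_def
proof (rule integral_cong_AE)
  have "AE x in PiM {..<p} P. \<forall>i\<in>{..<p}. clip (x i) = x i"
    using unit_distribution.AE_clip[OF unit] prob_P by (intro AE_finite_allI AE_PiM_component) auto
  then show "AE x in PiM {..<p} P. exp (H x) = exp (quad_energy p A v x)"
    by eventually_elim (simp add: H_def X_def quad_energy_def bilin_def mult.assoc cong: sum.cong_simp)
  note component_measurable[measurable]
  show "(\<lambda>x. exp (quad_energy p A v x)) \<in> borel_measurable (PiM {..<p} P)"
    unfolding quad_energy_def bilin_def by measurable
qed measurable

text \<open>Jensen's inequality in logarithmic form, used in both directions: with \<open>g\<close>
  a tilted product weight, f = H and h = T for the lower bound on log Z; with \<open>g\<close> below
  the Gibbs weight, f = T and h = H for the upper bound.\<close>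

lemma exp_diff_bound:
  assumes f: "f \<in> borel_measurable (PiM {..<p} P)" "\<And>x. \<bar>f x\<bar> \<le> C"
    and h: "h \<in> borel_measurable (PiM {..<p} P)" "\<And>x. \<bar>h x\<bar> \<le> D"
    and g: "weight g" and le: "wmean g (\<lambda>x. exp (f x - h x)) \<le> c"
  shows "wmean g f - wmean g h \<le> ln c" "0 < c"
proof -
  have "\<bar>f x - h x\<bar> \<le> C + D" for x using f(2)[of x] h(2)[of x] by linarith
  then have "exp (wmean g (\<lambda>x. f x - h x)) \<le> c"
    using wmean_exp_ge[OF g, of "\<lambda>x. f x - h x" "C + D"] f h le by simp
  then have "exp (wmean g f - wmean g h) \<le> c" using wmean_diff[OF g f h] by simp
  moreover have "0 < exp (wmean g f - wmean g h)" by simp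
  ultimately show "0 < c" by linarith
  then show "wmean g f - wmean g h \<le> ln c" using \<open>exp (wmean g f - wmean g h) \<le> c\<close> by (simp add: ln_ge_iff)
qed

text \<open>The zero diagonal of \<open>A\<close> makes the mean energy of a product law equal to
  the energy at its mean vector, so Jensen's inequality produces exactly
  \<open>mf_value\<close>.\<close>

theorem mf_value_le: "mf_value p A v P \<gamma> \<le> ln (\<integral>x. exp (quad_energy p A v x) \<partial>PiM {..<p} P)"
proof -
  have w: "weight (\<lambda>x. exp (T \<gamma> x))" by (rule weight_exp[OF T_measurable abs_T_le])
  have "wmean (\<lambda>x. exp (T \<gamma> x)) (\<lambda>x. exp (H x - T \<gamma> x)) = mass (\<lambda>x. exp (H x))"
    by (simp add: wmean_def mass_tilt exp_add[symmetric]) (simp add: mass_def)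
  then have "wmean (\<lambda>x. exp (T \<gamma> x)) H - wmean (\<lambda>x. exp (T \<gamma> x)) (T \<gamma>) \<le> ln (mass (\<lambda>x. exp (H x)))"
    by (intro exp_diff_bound[OF H_measurable abs_H_le T_measurable abs_T_le w]) simp
  moreover have "wmean (\<lambda>x. exp (T \<gamma> x)) H - wmean (\<lambda>x. exp (T \<gamma> x)) (T \<gamma>) = mf_value p A v P \<gamma>"
  proof -
    have "A i j * wmean (\<lambda>x. exp (T \<gamma> x)) (\<lambda>x. X i x * X j x) = A i j * (tilted_mean (P i) (\<gamma> i) * tilted_mean (P j) (\<gamma> j))"
      if "i < p" "j < p" for i j
      using tilt_moments(2)[of i j \<gamma>] that A_diag by (cases "i = j") auto
    then have "(\<Sum>i<p. \<Sum>j<p. A i j * wmean (\<lambda>x. exp (T \<gamma> x)) (\<lambda>x. X i x * X j x))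
        = (\<Sum>i<p. \<Sum>j<p. A i j * (tilted_mean (P i) (\<gamma> i) * tilted_mean (P j) (\<gamma> j)))"
      by (intro sum.cong refl) auto
    then show ?thesis
      unfolding wmean_H[OF w] wmean_T[OF w] mf_value_eq[OF refl]
      using tilt_moments(1)[of _ \<gamma>] by (simp cong: sum.cong_simp)
  qed
  ultimately show ?thesis by (simp add: mass_H)
qed

text \<open>If X i - m had a fixed sign almost everywhere, its zero integral against the strictly
  positive weight would force X i = m almost everywhere. This is the hypothesis of
  \<open>exists_tilted_mean\<close>.\<close>

lemma exists_matching_tilt:
  assumes g: "weight g" and i: "i < p"
  shows "\<exists>t. tilted_mean (P i) t = wmean g (X i)"
proof -
  interpret Pi: unit_distribution "P i" by (rule unit)
  define m where "m = wmean g (X i)"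
  have [measurable]: "g \<in> borel_measurable (PiM {..<p} P)" using g by (simp add: weight_def)
  have "wmean g (\<lambda>x. X i x - m) = 0"
    using wmean_diff[OF g X_measurable[of i] X_bound[of i], of "\<lambda>_. m" "\<bar>m\<bar>"] by (simp add: m_def wmean_const[OF g])
  then have zero: "(\<integral>x. g x * (X i x - m) \<partial>PiM {..<p} P) = 0" using mass_pos[OF g] by (simp add: wmean_def)
  have int: "integrable (PiM {..<p} P) (\<lambda>x. g x * (X i x - m))"
  proof (rule weight_integrable[OF g])
    show "\<bar>X i x - m\<bar> \<le> 1 + \<bar>m\<bar>" for x using X_bound[of i x] by linarith
  qed measurable
  have "AE x in P i. x = m" if s: "AE x in P i. 0 \<le> s * (x - m)" and s0: "s \<noteq> 0" for s :: real
  proof -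
    have "AE x in P i. 0 \<le> s * (clip x - m)" using s Pi.AE_clip by eventually_elim simp
    then have ae: "AE x in PiM {..<p} P. 0 \<le> s * (clip (x i) - m)"
      using i prob_P by (intro AE_PiM_component) auto
    have g0: "0 < g x" for x using g by (simp add: weight_def)
    have "AE x in PiM {..<p} P. 0 \<le> s * (g x * (X i x - m))"
      using ae
    proof eventually_elim
      case (elim x)
      have "0 \<le> g x * (s * (X i x - m))" using mult_nonneg_nonneg[OF less_imp_le[OF g0[of x]] elim] i by (simp add: X_def)
      then show ?case by (simp add: mult.left_commute)
    qed
    moreover have "(\<integral>x. s * (g x * (X i x - m)) \<partial>PiM {..<p} P) = 0" using zero by simp
    moreover have "integrable (PiM {..<p} P) (\<lambda>x. s * (g x * (X i x - m)))"
      by (rule integrable_mult_right[OF int])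
    ultimately have "AE x in PiM {..<p} P. s * (g x * (X i x - m)) = 0"
      using integral_nonneg_eq_0_iff_AE by blast
    then have "AE x in PiM {..<p} P. clip (x i) = m"
    proof eventually_elim
      case (elim x)
      then show ?case using g0[of x] s0 i by (simp add: X_def)
    qed
    then have "AE x in distr (PiM {..<p} P) (P i) (\<lambda>x. x i). clip x = m"
    proof (subst AE_distr_iff)
      show "(\<lambda>x. x i) \<in> measurable (PiM {..<p} P) (P i)" using i by (intro measurable_component_singleton) simp
      show "{x \<in> space (P i). clip x = m} \<in> sets (P i)" by measurable
    qed
    then have "AE x in P i. clip x = m"
      using distr_PiM_component[of "{..<p}" P i] prob_P i by (simp only: lessThan_iff)
    then show ?thesis using Pi.AE_clip by eventually_elim simp
  qed
  note ae = this
  show ?thesis unfolding m_def[symmetric]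
  proof (rule Pi.exists_tilted_mean)
    assume "(AE x in P i. x \<le> m) \<or> (AE x in P i. m \<le> x)"
    then show "AE x in P i. x = m"
    proof
      assume "AE x in P i. x \<le> m"
      then have "AE x in P i. 0 \<le> -1 * (x - m)" by eventually_elim simp
      then show ?thesis by (rule ae) simp
    next
      assume "AE x in P i. m \<le> x"
      then have "AE x in P i. 0 \<le> 1 * (x - m)" by eventually_elim simp
      then show ?thesis by (rule ae) simp
    qed
  qed
qed

theorem ln_partition_le:
  assumes B: "\<And>\<gamma>. mf_value p A v P \<gamma> \<le> B"
  defines "F \<equiv> sqrt (\<Sum>i<p. \<Sum>j<p. (A i j)\<^sup>2)"
  shows "ln (\<integral>x. exp (quad_energy p A v x) \<partial>PiM {..<p} P) \<le> B + 7 * (real p * F) powr (2/3)"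
proof -
  define g0 where "g0 x = exp (H x)" for x
  have g0: "weight g0" unfolding g0_def by (rule weight_exp[OF H_measurable abs_H_le])
  have F: "0 \<le> F" unfolding F_def by (intro real_sqrt_ge_zero sum_nonneg) auto
  have low: "ln (mass g) \<le> B + F / 2 * sqrt (\<Sum>i<p. \<Sum>j<p. (wcov g i j)\<^sup>2)"
    if g: "weight g" and le: "\<And>x. g x \<le> g0 x" for g
  proof -
    have "\<exists>\<gamma>. \<forall>i<p. tilted_mean (P i) (\<gamma> i) = wmean g (X i)"
      using exists_matching_tilt[OF g] by metis
    then obtain \<gamma> where \<gamma>: "\<And>i. i < p \<Longrightarrow> tilted_mean (P i) (\<gamma> i) = wmean g (X i)" by blast
    have wT: "weight (\<lambda>x. exp (T \<gamma> x))" by (rule weight_exp[OF T_measurable abs_T_le])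
    have [measurable]: "g \<in> borel_measurable (PiM {..<p} P)" using g by (simp add: weight_def)
    have bd: "\<bar>T \<gamma> x - H x\<bar> \<le> (\<Sum>i<p. \<bar>\<gamma> i\<bar>) + \<bar>\<Sum>i<p. lmgf (P i) (\<gamma> i)\<bar> + H_bd" for x
      using abs_T_le[of \<gamma> x] abs_H_le[of x] by linarith
    \<comment> \<open>Because g \<le> exp H, the integral is at most the total mass 1 of the tilted
      law. Jensen's inequality then bounds the log-mass of \<open>g\<close> by mean energy minus
      mean log-density of the tilt.\<close>
    have "(\<integral>x. g x * exp (T \<gamma> x - H x) \<partial>PiM {..<p} P) \<le> (\<integral>x. exp (T \<gamma> x) \<partial>PiM {..<p} P)"
    proof (rule integral_mono)
      show "integrable (PiM {..<p} P) (\<lambda>x. g x * exp (T \<gamma> x - H x))"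
        using bd by (intro weight_integrable[OF g, where C = "exp ((\<Sum>i<p. \<bar>\<gamma> i\<bar>) + \<bar>\<Sum>i<p. lmgf (P i) (\<gamma> i)\<bar> + H_bd)"]) (auto simp: abs_le_iff)
      show "integrable (PiM {..<p} P) (\<lambda>x. exp (T \<gamma> x))" using weight_integrable'[OF wT] .
      fix x
      have "g x * exp (T \<gamma> x - H x) \<le> exp (H x) * exp (T \<gamma> x - H x)"
        using le[of x] by (intro mult_right_mono) (auto simp: g0_def)
      then show "g x * exp (T \<gamma> x - H x) \<le> exp (T \<gamma> x)" by (simp add: exp_add[symmetric])
    qed
    then have "wmean g (\<lambda>x. exp (T \<gamma> x - H x)) \<le> 1 / mass g"
      using mass_tilt[of \<gamma>] mass_pos[OF g] by (simp add: wmean_def mass_def[of "\<lambda>x. exp (T \<gamma> x)"] divide_right_mono)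
    from exp_diff_bound(1)[OF T_measurable abs_T_le H_measurable abs_H_le g this]
    have "wmean g (T \<gamma>) - wmean g H \<le> - ln (mass g)" using mass_pos[OF g] by (simp add: ln_div)
    then have le1: "ln (mass g) \<le> wmean g H - wmean g (T \<gamma>)" by simp
    note mv = mf_value_eq[of "\<lambda>i. wmean g (X i)" \<gamma>, OF \<gamma>[symmetric], simplified]
    \<comment> \<open>The tilt has the same means as \<open>g\<close>, so only the covariances of
      \<open>g\<close> separate its mean energy from the energy at the mean vector.\<close>
    have "wmean g H - wmean g (T \<gamma>) = mf_value p A v P \<gamma> - (\<Sum>i<p. \<Sum>j<p. A i j * wcov g i j) / 2"
      unfolding wmean_H[OF g] wmean_T[OF g] mv wcov_def
      by (simp add: right_diff_distrib sum_subtractf diff_divide_distrib)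
    with le1 have le: "ln (mass g) \<le> mf_value p A v P \<gamma> - (\<Sum>i<p. \<Sum>j<p. A i j * wcov g i j) / 2" by simp
    define a where "a z = A (fst z) (snd z)" for z
    define c where "c z = wcov g (fst z) (snd z)" for z
    have "\<bar>\<Sum>z\<in>{..<p}\<times>{..<p}. a z * c z\<bar> \<le> (\<Sum>z\<in>{..<p}\<times>{..<p}. \<bar>a z * c z\<bar>)" by (rule sum_abs)
    also have "\<dots> \<le> L2_set a ({..<p}\<times>{..<p}) * L2_set c ({..<p}\<times>{..<p})"
      unfolding abs_mult by (rule L2_set_mult_ineq)
    finally have "\<bar>\<Sum>i<p. \<Sum>j<p. A i j * wcov g i j\<bar> \<le> F * sqrt (\<Sum>i<p. \<Sum>j<p. (wcov g i j)\<^sup>2)"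
      by (simp add: sum.cartesian_product L2_set_def F_def case_prod_unfold a_def c_def)
    with le B[of \<gamma>] show ?thesis by simp
  qed
  have mass: "ln (\<integral>x. exp (quad_energy p A v x) \<partial>PiM {..<p} P) = ln (mass g0)"
    by (simp add: mass_H[symmetric] g0_def[abs_def])
  show ?thesis
  \<comment> \<open>If p F = 0 there is nothing to balance, and the error term of \<open>g0\<close>
    itself is 0.\<close>
  proof (cases "real p * F = 0")
    case True
    then have "F / 2 * sqrt (\<Sum>i<p. \<Sum>j<p. (wcov g0 i j)\<^sup>2) = 0" by auto
    moreover have "0 \<le> 7 * (real p * F) powr (2/3)" by simp
    ultimately show ?thesis unfolding mass using low[OF g0 order_refl] by linarith
  next
    case False
    moreover have "0 \<le> real p * F" using F by simp
    ultimately have pF: "0 < real p * F" by linarith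
    \<comment> \<open>Balances the two costs: with s = p^2 t both become multiples of q = (p
      F)^(2/3), namely q/2 from the covariances and 8 ln 2 q \<le> 6.5 q from the splittings. Their
      sum is the constant 7.\<close>
    define t where "t = (real p * F) powr (- 2/3)"
    have t: "0 < t" unfolding t_def powr_gt_zero using pF by linarith
    have p: "0 < real p"
    proof (rule ccontr)
      assume "\<not> ?thesis"
      then have "real p = 0" by linarith
      then have "real p * F = 0" by (simp only: mult_zero_left)
      with pF show False by linarith
    qed
    define q where "q = (real p * F) powr (2/3)"
    have "ln (mass g0) \<le> B + F / 2 * sqrt ((real p)\<^sup>2 * t) + 8 * ln 2 * (real p)\<^sup>2 / ((real p)\<^sup>2 * t)"
    proof (rule log_mass_le[OF g0])
      show "0 < (real p)\<^sup>2 * t" using p t by (intro mult_pos_pos zero_less_power)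
      show "0 \<le> F / 2" using F by linarith
    qed (rule low)
    moreover have "F / 2 * sqrt ((real p)\<^sup>2 * t) = q / 2"
    proof -
      define z where "z = real p * F"
      have z: "0 < z" using pF by (simp only: z_def)
      have st: "sqrt t = z powr (-1/3)" unfolding t_def z_def[symmetric]
        using z by (simp add: powr_half_sqrt[symmetric] powr_powr)
      have "z * z powr (-1/3) = q"
        using z powr_add[of z 1 "-1/3"] by (simp add: q_def z_def[symmetric])
      moreover have "F / 2 * sqrt ((real p)\<^sup>2 * t) = z * sqrt t / 2" by (simp add: real_sqrt_mult z_def)
      ultimately show ?thesis using st by simp
    qed
    moreover have "8 * ln 2 * (real p)\<^sup>2 / ((real p)\<^sup>2 * t) = 8 * ln 2 * q"
    proof -
      have "1 / t = q" using powr_minus_divide[of "real p * F" "2/3"] by (simp add: t_def q_def)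
      moreover have "8 * ln 2 * (real p)\<^sup>2 / ((real p)\<^sup>2 * t) = 8 * ln 2 * (1 / t)" using p by simp
      ultimately show ?thesis by simp
    qed
    moreover have "8 * ln 2 * q \<le> 6.5 * q"
      using ln2_le_25_over_36 by (intro mult_right_mono) (simp_all add: q_def)
    ultimately show ?thesis unfolding mass q_def[symmetric] by simp
  qed
qed

end

section \<open>The mean-field objective of the regression model\<close>

lemma unit_distribution_prior:
  assumes "\<mu> \<in> unit_priors" shows "unit_distribution \<mu>"
proof -
  interpret real_distribution \<mu> using assms by (simp add: unit_priors_def)
  have "AE x in \<mu>. x \<in> {-1..1}" using assms by (intro AE_in_set_eq_1[THEN iffD2]) (auto simp: unit_priors_def)
  then have "AE x in \<mu>. \<bar>x\<bar> \<le> 1" by eventually_elim (auto simp: abs_le_iff)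
  then show ?thesis by (simp add: unit_distribution_def unit_distribution_axioms_def prob_space_axioms)
qed

section \<open>Quadratic-exponential tilts of a single prior\<close>

context unit_distribution
begin

lemma space_P[simp]: "space P = UNIV"
  using sets_eq_imp_space_eq[OF sets_P] by simp

lemma integrable_exp_quadratic: "integrable P (\<lambda>x. exp (t * x - d / 2 * x\<^sup>2))"
proof (rule integrable_bounded)
  fix x :: real assume x: "\<bar>x\<bar> \<le> 1"
  have "\<bar>t\<bar> * \<bar>x\<bar> \<le> \<bar>t\<bar> * 1" using x by (intro mult_left_mono) auto
  moreover have "t * x \<le> \<bar>t\<bar> * \<bar>x\<bar>" unfolding abs_mult[symmetric] by (rule abs_ge_self)
  moreover have "- (d / 2 * x\<^sup>2) \<le> \<bar>d / 2\<bar> * 1"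
  proof -
    have "x\<^sup>2 \<le> 1" using x by (simp add: abs_square_le_1)
    then have "\<bar>d / 2 * x\<^sup>2\<bar> \<le> \<bar>d / 2\<bar> * 1" unfolding abs_mult by (intro mult_left_mono) auto
    then show ?thesis by linarith
  qed
  ultimately show "\<bar>exp (t * x - d / 2 * x\<^sup>2)\<bar> \<le> exp (\<bar>t\<bar> + \<bar>d / 2\<bar>)" by simp
qed auto

lemma exp_cumulant: "exp (cumulant P t d) = (\<integral>x. exp (t * x - d / 2 * x\<^sup>2) \<partial>P)"
proof -
  have "(\<integral>x. exp (t * x - d / 2 * x\<^sup>2) \<partial>P) \<noteq> 0"
  proof
    assume "(\<integral>x. exp (t * x - d / 2 * x\<^sup>2) \<partial>P) = 0"
    then have "AE x in P. exp (t * x - d / 2 * x\<^sup>2) = 0"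
      using integrable_exp_quadratic by (subst (asm) integral_nonneg_eq_0_iff_AE) auto
    then show False by (simp add: AE_False)
  qed
  moreover have "0 \<le> (\<integral>x. exp (t * x - d / 2 * x\<^sup>2) \<partial>P)" by simp
  ultimately have "0 < (\<integral>x. exp (t * x - d / 2 * x\<^sup>2) \<partial>P)" by linarith
  then show ?thesis by (simp add: cumulant_def)
qed

lemma exp_minus_cumulant: "exp (a - b - cumulant P t d) = exp (a - b) / exp (cumulant P t d)"
  by (rule exp_diff)

lemma unit_distribution_tilted: "unit_distribution (tilted P t d)"
proof -
  have "emeasure (tilted P t d) (space (tilted P t d)) = (\<integral>\<^sup>+x. ennreal (exp (t * x - d / 2 * x\<^sup>2 - cumulant P t d)) \<partial>P)"
    unfolding tilted_def by (subst emeasure_density) (auto intro!: nn_integral_cong)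
  also have "\<dots> = ennreal (\<integral>x. exp (t * x - d / 2 * x\<^sup>2) / exp (cumulant P t d) \<partial>P)"
    unfolding exp_minus_cumulant using integrable_exp_quadratic[of t d]
    by (intro nn_integral_eq_integral integrable_divide) auto
  also have "\<dots> = 1" by (simp only: integral_divide_zero exp_cumulant[symmetric]) simp
  finally interpret T: prob_space "tilted P t d" by (rule prob_spaceI)
  show ?thesis
  proof
    show "sets (tilted P t d) = sets borel" by (simp add: tilted_def)
    show "AE x in tilted P t d. \<bar>x\<bar> \<le> 1"
      unfolding tilted_def using AE_abs_le_1 by (subst AE_density) auto
  qed
qed

lemma integral_tilted:
  fixes f :: "real \<Rightarrow> real"
  assumes [measurable]: "f \<in> borel_measurable borel"
  shows "(\<integral>x. f x \<partial>tilted P t d) = (\<integral>x. exp (t * x - d / 2 * x\<^sup>2 - cumulant P t d) * f x \<partial>P)"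
  unfolding tilted_def by (subst integral_density) auto

text \<open>Reduces the two-parameter family to exponential tilts of the single law
  \<open>tilted P 0 d\<close>, whose log moment generating function is a cumulant increment.\<close>

lemma lmgf_tilted: "lmgf (tilted P 0 d) t = cumulant P t d - cumulant P 0 d"
proof -
  have "(\<integral>x. exp (t * x) \<partial>tilted P 0 d) = (\<integral>x. exp (t * x - d / 2 * x\<^sup>2) / exp (cumulant P 0 d) \<partial>P)"
  proof (subst integral_tilted)
    have "exp (0 * x - d / 2 * x\<^sup>2 - cumulant P 0 d) * exp (t * x) = exp (t * x - d / 2 * x\<^sup>2) / exp (cumulant P 0 d)" for x
      by (simp only: exp_diff[symmetric] exp_add[symmetric]) (simp add: algebra_simps)
    then show "(\<integral>x. exp (0 * x - d / 2 * x\<^sup>2 - cumulant P 0 d) * exp (t * x) \<partial>P)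
        = (\<integral>x. exp (t * x - d / 2 * x\<^sup>2) / exp (cumulant P 0 d) \<partial>P)" by simp
  qed auto
  also have "\<dots> = exp (cumulant P t d - cumulant P 0 d)"
    by (simp only: integral_divide_zero exp_cumulant[of t, symmetric]) (rule exp_diff[symmetric])
  finally show ?thesis by (simp add: lmgf_def)
qed

lemma cumulant_deriv_eq: "cumulant_deriv P t d = tilted_mean (tilted P 0 d) t"
proof -
  interpret T: unit_distribution "tilted P 0 d" by (rule unit_distribution_tilted)
  have "((\<lambda>t. lmgf (tilted P 0 d) t + cumulant P 0 d) has_real_derivative tilted_mean (tilted P 0 d) t) (at t)"
    using T.lmgf_has_derivative[of t] by (auto intro!: derivative_eq_intros)
  then have "((\<lambda>t. cumulant P t d) has_real_derivative tilted_mean (tilted P 0 d) t) (at t)"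
    by (simp add: lmgf_tilted)
  then show ?thesis by (simp add: cumulant_deriv_def DERIV_imp_deriv)
qed

text \<open>The log-density of the tilt is affine in x, so the divergence is its mean under the
  tilt.\<close>

lemma KL_tilt:
  "KL_divergence (exp 1) P (density P (\<lambda>x. ennreal (exp (t * x - lmgf P t)))) = t * tilted_mean P t - lmgf P t"
proof -
  have e: "exp (lmgf P t) = (\<integral>x. exp (t * x) \<partial>P)" using mgf_pos[of t 0] by (simp add: lmgf_def)
  have i: "integrable P (\<lambda>x. exp (t * x))" "integrable P (\<lambda>x. x * exp (t * x))"
    using integrable_exp[of t 0] integrable_mult_exp[of 0 t] by simp_all
  have "KL_divergence (exp 1) P (density P (\<lambda>x. ennreal (exp (t * x - lmgf P t)))) = (\<integral>x. exp (t * x - lmgf P t) * log (exp 1) (exp (t * x - lmgf P t)) \<partial>P)"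
    by (rule KL_density) auto
  also have "\<dots> = (\<integral>x. t / exp (lmgf P t) * (x * exp (t * x)) - lmgf P t / exp (lmgf P t) * exp (t * x) \<partial>P)"
  proof (intro Bochner_Integration.integral_cong refl)
    fix x
    have ln: "log (exp 1) (exp y) = y" for y by (simp add: log_def)
    show "exp (t * x - lmgf P t) * log (exp 1) (exp (t * x - lmgf P t))
        = t / exp (lmgf P t) * (x * exp (t * x)) - lmgf P t / exp (lmgf P t) * exp (t * x)"
      unfolding ln by (simp add: exp_diff field_simps)
  qed
  also have "\<dots> = t / exp (lmgf P t) * (\<integral>x. x * exp (t * x) \<partial>P) - lmgf P t / exp (lmgf P t) * (\<integral>x. exp (t * x) \<partial>P)"
    using i by simp
  also have "\<dots> = t * tilted_mean P t - lmgf P t"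
    using mgf_pos[of t 0] by (simp add: e tilted_mean_def)
  finally show ?thesis .
qed

lemma tilted_tilted: "tilted P t d = density (tilted P 0 d) (\<lambda>x. ennreal (exp (t * x - lmgf (tilted P 0 d) t)))"
proof -
  have "density (tilted P 0 d) (\<lambda>x. ennreal (exp (t * x - lmgf (tilted P 0 d) t)))
     = density P (\<lambda>x. ennreal (exp (0 * x - d / 2 * x\<^sup>2 - cumulant P 0 d)) * ennreal (exp (t * x - lmgf (tilted P 0 d) t)))"
    unfolding tilted_def by (rule density_density_eq) auto
  also have "\<dots> = tilted P t d"
    unfolding tilted_def[of P t] lmgf_tilted
    by (simp add: ennreal_mult[symmetric] exp_add[symmetric] algebra_simps)
  finally show ?thesis ..
qed

lemma KL_tilted:
  "KL_divergence (exp 1) (tilted P 0 d) (tilted P t d) = t * tilted_mean (tilted P 0 d) t - lmgf (tilted P 0 d) t"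
  using unit_distribution.KL_tilt[OF unit_distribution_tilted, of 0 d t] by (simp add: tilted_tilted[of t d])

end

section \<open>From matrices to coefficient sums\<close>

definition gram_coeff :: "real \<Rightarrow> real mat \<Rightarrow> nat \<Rightarrow> nat \<Rightarrow> real" where
  "gram_coeff \<sigma> X i j = scaled_gram \<sigma> X $$ (i, j)"

definition offdiag_coeff :: "real \<Rightarrow> real mat \<Rightarrow> nat \<Rightarrow> nat \<Rightarrow> real" where
  "offdiag_coeff \<sigma> X i j = (if i = j then 0 else gram_coeff \<sigma> X i j)"

lemma gram_coeff_eq:
  assumes "X \<in> carrier_mat n p" "i < p" "j < p"
  shows "gram_coeff \<sigma> X i j = (\<Sum>k<n. X $$ (k, i) * X $$ (k, j)) / \<sigma>\<^sup>2"
  using assms by (simp add: gram_coeff_def scaled_gram_def scalar_prod_def lessThan_atLeast0)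

lemma gram_coeff_sym:
  assumes "X \<in> carrier_mat n p" "i < p" "j < p"
  shows "gram_coeff \<sigma> X i j = gram_coeff \<sigma> X j i"
  using assms by (simp add: gram_coeff_eq mult.commute)

lemma coupling_bilin:
  assumes "X \<in> carrier_mat n p"
  shows "vec p f \<bullet> (coupling \<sigma> X *\<^sub>v vec p g) = bilin {..<p} (offdiag_coeff \<sigma> X) f g"
  using assms
  by (auto simp: scalar_prod_def bilin_def coupling_def offdiag_coeff_def gram_coeff_def sum_distrib_left lessThan_atLeast0
      intro!: sum.cong)

lemma vec_scalar_prod: "v \<in> carrier_vec p \<Longrightarrow> v \<bullet> vec p f = (\<Sum>i<p. v $ i * f i)"
  by (simp add: scalar_prod_def lessThan_atLeast0)

lemma vec_scalar_prod': "v \<in> carrier_vec p \<Longrightarrow> vec p f \<bullet> v = (\<Sum>i<p. v $ i * f i)" for f :: "nat \<Rightarrow> real"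
  by (auto simp: scalar_prod_def lessThan_atLeast0 mult.commute intro!: sum.cong)

text \<open>Symmetry of the Gram matrix turns the trace of the square into the squared Frobenius
  norm.\<close>

lemma trace_coupling:
  assumes X: "X \<in> carrier_mat n p"
  shows "mat_trace (coupling \<sigma> X * coupling \<sigma> X) = (\<Sum>i<p. \<Sum>j<p. (offdiag_coeff \<sigma> X i j)\<^sup>2)"
  unfolding mat_trace_def using X
  by (auto simp: coupling_def offdiag_coeff_def scalar_prod_def power2_eq_square gram_coeff_def[symmetric] lessThan_atLeast0
      gram_coeff_sym[OF X] intro!: sum.cong)

lemma product_unit_distributions_tilted:
  assumes "\<mu> \<in> unit_priors"
  shows "product_unit_distributions (\<lambda>i. tilted \<mu> 0 (diag_coeff \<sigma> X i)) (offdiag_coeff \<sigma> X)"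
  using unit_distribution.unit_distribution_tilted[OF unit_distribution_prior[OF assms]]
  by (simp add: product_unit_distributions_def offdiag_coeff_def)

lemma partition_fun_eq:
  assumes "X \<in> carrier_mat n p" "v \<in> carrier_vec p"
  shows "partition_fun \<sigma> X v \<mu> = (\<integral>\<beta>. exp (quad_energy p (offdiag_coeff \<sigma> X) (($) v) \<beta>) \<partial>PiM {..<p} (\<lambda>i. tilted \<mu> 0 (diag_coeff \<sigma> X i)))"
  using assms coupling_bilin[OF assms(1)] vec_scalar_prod[OF assms(2)]
  by (simp add: partition_fun_def quad_energy_def)

lemma mf_objective_eq:
  assumes "X \<in> carrier_mat n p" "v \<in> carrier_vec p" "\<mu> \<in> unit_priors"
  shows "mf_objective \<sigma> X \<gamma> v \<mu> = mf_value p (offdiag_coeff \<sigma> X) (($) v) (\<lambda>i. tilted \<mu> 0 (diag_coeff \<sigma> X i)) (($) \<gamma>)"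
proof -
  interpret unit_distribution \<mu> by (rule unit_distribution_prior[OF assms(3)])
  have p: "dim_col X = p" using assms(1) by simp
  show ?thesis
    unfolding mf_objective_def mf_mean_def p coupling_bilin[OF assms(1)] vec_scalar_prod'[OF assms(2)]
    by (simp add: cumulant_deriv_eq KL_tilted mf_value_def quad_energy_def)
qed

text \<open>The extended-real supremum is finite: log Z bounds it above and the value at \<gamma> =
  0 below. Keeping the two inequalities apart matters later, because the error sits on one side
  only.\<close>

lemma mf_approximation:
  assumes X: "X \<in> carrier_mat n p" and v: "v \<in> carrier_vec p" and \<mu>: "\<mu> \<in> unit_priors"
  obtains S where "(SUP \<gamma>\<in>carrier_vec p. ereal (mf_objective \<sigma> X \<gamma> v \<mu>)) = ereal S"
    and "S \<le> ln (partition_fun \<sigma> X v \<mu>)"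
    and "ln (partition_fun \<sigma> X v \<mu>) \<le> S + 7 * real p powr (2/3) * mat_trace (coupling \<sigma> X * coupling \<sigma> X) powr (1/3)"
proof -
  let ?P = "\<lambda>i. tilted \<mu> 0 (diag_coeff \<sigma> X i)"
  let ?M = "mf_value p (offdiag_coeff \<sigma> X) (($) v) ?P"
  interpret product_unit_distributions p ?P "offdiag_coeff \<sigma> X" "($) v"
    by (rule product_unit_distributions_tilted[OF \<mu>])
  note obj = mf_objective_eq[OF X v \<mu>, of \<sigma>] and Z = partition_fun_eq[OF X v, of \<sigma> \<mu>]
  define s where "s = (SUP \<gamma>\<in>carrier_vec p. ereal (mf_objective \<sigma> X \<gamma> v \<mu>))"
  have "s \<le> ereal (ln (partition_fun \<sigma> X v \<mu>))"
    unfolding s_def obj Z by (intro SUP_least) (simp add: mf_value_le)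
  moreover have "ereal (?M (($) (0\<^sub>v p))) \<le> s"
    unfolding s_def obj by (rule SUP_upper) simp
  ultimately obtain S where S: "s = ereal S" by (cases s) auto
  have le: "S \<le> ln (partition_fun \<sigma> X v \<mu>)" using \<open>s \<le> _\<close> S by simp
  have "?M \<gamma> \<le> S" for \<gamma>
  proof -
    have "ereal (mf_objective \<sigma> X (vec p \<gamma>) v \<mu>) \<le> s" unfolding s_def by (rule SUP_upper) simp
    moreover have "?M (($) (vec p \<gamma>)) = ?M \<gamma>"
      by (simp add: mf_value_def quad_energy_def bilin_def cong: sum.cong_simp)
    ultimately show ?thesis by (simp add: S obj)
  qed
  from ln_partition_le[OF this] have "ln (partition_fun \<sigma> X v \<mu>)
      \<le> S + 7 * (real p * sqrt (mat_trace (coupling \<sigma> X * coupling \<sigma> X))) powr (2/3)"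
    by (simp add: Z trace_coupling[OF X])
  also have "(real p * sqrt (mat_trace (coupling \<sigma> X * coupling \<sigma> X))) powr (2/3)
     = real p powr (2/3) * mat_trace (coupling \<sigma> X * coupling \<sigma> X) powr (1/3)"
  proof -
    have "0 \<le> mat_trace (coupling \<sigma> X * coupling \<sigma> X)" unfolding trace_coupling[OF X] by (intro sum_nonneg) auto
    then show ?thesis by (simp add: powr_mult powr_half_sqrt[symmetric] powr_powr)
  qed
  finally have "ln (partition_fun \<sigma> X v \<mu>) \<le> S + 7 * real p powr (2/3) * mat_trace (coupling \<sigma> X * coupling \<sigma> X) powr (1/3)"
    by (simp add: mult.assoc)
  from that[OF _ le this] S show thesis by (simp add: s_def)
qed

theorem mf_approximation_uniform:
  assumes X: "X \<in> carrier_mat n p" and P: "P \<subseteq> unit_priors"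
  shows "(SUP v\<in>carrier_vec p. SUP \<mu>\<in>P.
         \<bar>ereal (ln (partition_fun \<sigma> X v \<mu>)) - (SUP \<gamma>\<in>carrier_vec p. ereal (mf_objective \<sigma> X \<gamma> v \<mu>))\<bar>)
      \<le> ereal (7 * real p powr (2/3) * mat_trace (coupling \<sigma> X * coupling \<sigma> X) powr (1/3))"
proof (intro SUP_least)
  fix v :: "real vec" and \<mu> assume "v \<in> carrier_vec p" "\<mu> \<in> P"
  then obtain S where "(SUP \<gamma>\<in>carrier_vec p. ereal (mf_objective \<sigma> X \<gamma> v \<mu>)) = ereal S"
    and "S \<le> ln (partition_fun \<sigma> X v \<mu>)"
    and "ln (partition_fun \<sigma> X v \<mu>) \<le> S + 7 * real p powr (2/3) * mat_trace (coupling \<sigma> X * coupling \<sigma> X) powr (1/3)"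
    using mf_approximation[OF X] P by blast
  then show "\<bar>ereal (ln (partition_fun \<sigma> X v \<mu>)) - (SUP \<gamma>\<in>carrier_vec p. ereal (mf_objective \<sigma> X \<gamma> v \<mu>))\<bar>
      \<le> ereal (7 * real p powr (2/3) * mat_trace (coupling \<sigma> X * coupling \<sigma> X) powr (1/3))"
    by simp
qed

lemma closedin_unit_priors:
  assumes "closedin (subtopology weak_topology unit_priors) P" shows "P \<subseteq> unit_priors"
  using closedin_subset[OF assms] by simp

section \<open>Gaussian product measures\<close>

abbreviation gauss :: "real \<Rightarrow> real measure" where
  "gauss s \<equiv> density lborel (\<lambda>x. ennreal (normal_density 0 s x))"

lemma prob_space_gauss: "0 < s \<Longrightarrow> prob_space (gauss s)"
  by (rule prob_space_normal_density)

text \<open>Tilting a centred Gaussian is a translation: the one-dimensional Cameron-Martin formula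
  at the level of densities.\<close>

lemma normal_density_tilt:
  assumes "0 < s"
  shows "normal_density 0 s x * exp (a * x / s\<^sup>2 - a\<^sup>2 / (2 * s\<^sup>2)) = normal_density a s x"
proof -
  have "- x\<^sup>2 / (2 * s\<^sup>2) + (a * x / s\<^sup>2 - a\<^sup>2 / (2 * s\<^sup>2)) = - (x - a)\<^sup>2 / (2 * s\<^sup>2)"
    using assms by (simp add: field_simps power2_eq_square)
  then show ?thesis by (simp add: normal_density_def exp_add[symmetric])
qed

lemma gauss_tilt:
  assumes "0 < s"
  shows "density (gauss s) (\<lambda>x. ennreal (exp (a * x / s\<^sup>2 - a\<^sup>2 / (2 * s\<^sup>2)))) = density lborel (\<lambda>x. ennreal (normal_density a s x))"
  using normal_density_tilt[OF assms, of _ a] by (subst density_density_eq) (auto simp: ennreal_mult[symmetric])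

lemma distr_gauss_shift:
  assumes "0 < s"
  shows "distr (gauss s) borel (\<lambda>x. a + x) = density lborel (\<lambda>x. ennreal (normal_density a s x))"
proof (rule measure_eqI)
  fix A assume "A \<in> sets (distr (gauss s) borel (\<lambda>x. a + x))"
  then have [measurable]: "A \<in> sets borel" by simp
  have "emeasure (distr (gauss s) borel (\<lambda>x. a + x)) A = (\<integral>\<^sup>+y. indicator A y \<partial>distr (gauss s) borel (\<lambda>x. a + x))"
    by (rule nn_integral_indicator[symmetric]) simp
  also have "\<dots> = (\<integral>\<^sup>+x. ennreal (normal_density 0 s x) * indicator A (a + x) \<partial>lborel)"
  proof -
    have "(\<integral>\<^sup>+y. indicator A y \<partial>distr (gauss s) borel (\<lambda>x. a + x)) = (\<integral>\<^sup>+x. indicator A (a + x) \<partial>gauss s)"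
      by (rule nn_integral_distr) auto
    also have "\<dots> = (\<integral>\<^sup>+x. ennreal (normal_density 0 s x) * indicator A (a + x) \<partial>lborel)"
      by (rule nn_integral_density) auto
    finally show ?thesis .
  qed
  also have "\<dots> = (\<integral>\<^sup>+x. ennreal (normal_density a s (a + 1 * x)) * indicator A (a + 1 * x) \<partial>lborel)"
    by (simp add: normal_density_def)
  also have "\<dots> = (\<integral>\<^sup>+x. ennreal (normal_density a s x) * indicator A x \<partial>lborel)"
    using nn_integral_real_affine[of "\<lambda>x. ennreal (normal_density a s x) * indicator A x" 1 a] by simp
  also have "\<dots> = emeasure (density lborel (\<lambda>x. ennreal (normal_density a s x))) A"
    by (subst emeasure_density) auto
  finally show "emeasure (distr (gauss s) borel (\<lambda>x. a + x)) A = emeasure (density lborel (\<lambda>x. ennreal (normal_density a s x))) A" .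
qed simp

lemma nn_mgf_gauss:
  assumes "0 < s"
  shows "(\<integral>\<^sup>+x. ennreal (exp (c * x)) \<partial>gauss s) = ennreal (exp (s\<^sup>2 * c\<^sup>2 / 2))"
proof -
  define a where "a = s\<^sup>2 * c"
  have "exp (c * x) = exp (s\<^sup>2 * c\<^sup>2 / 2) * exp (a * x / s\<^sup>2 - a\<^sup>2 / (2 * s\<^sup>2))" for x
    using assms by (simp add: exp_add[symmetric] a_def power2_eq_square field_simps)
  then have "normal_density 0 s x * exp (c * x) = exp (s\<^sup>2 * c\<^sup>2 / 2) * normal_density a s x" for x
    using normal_density_tilt[OF assms, of x a] by (simp add: mult.left_commute)
  then have "(\<integral>\<^sup>+x. ennreal (exp (c * x)) \<partial>gauss s) = (\<integral>\<^sup>+x. ennreal (exp (s\<^sup>2 * c\<^sup>2 / 2)) * ennreal (normal_density a s x) \<partial>lborel)"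
    by (subst nn_integral_density) (auto simp: ennreal_mult[symmetric])
  also have "\<dots> = ennreal (exp (s\<^sup>2 * c\<^sup>2 / 2)) * (\<integral>\<^sup>+x. ennreal (normal_density a s x) \<partial>lborel)"
    by (rule nn_integral_cmult) simp
  also have "(\<integral>\<^sup>+x. ennreal (normal_density a s x) \<partial>lborel) = 1"
    using assms by (subst nn_integral_eq_integral) auto
  finally show ?thesis by simp
qed

lemma char_gauss:
  assumes s: "0 < s"
  shows "(CLINT x|gauss s. iexp (c * x)) = complex_of_real (exp (- (s\<^sup>2 * c\<^sup>2) / 2))"
proof -
  have "(CLINT x|gauss s. iexp (c * x)) = (CLINT x|lborel. normal_density 0 s x *\<^sub>R iexp (c * x))"
    by (subst integral_density) auto
  also have "\<dots> = \<bar>s\<bar> *\<^sub>R (CLINT x|lborel. normal_density 0 s (0 + s * x) *\<^sub>R iexp (c * (0 + s * x)))"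
    by (rule lborel_integral_real_affine) (use s in simp)
  also have "\<dots> = (CLINT x|lborel. s *\<^sub>R (normal_density 0 s (0 + s * x) *\<^sub>R iexp (c * (0 + s * x))))"
    unfolding abs_of_pos[OF s] by (rule integral_scaleR_right[symmetric])
  also have "\<dots> = (CLINT x|lborel. std_normal_density x *\<^sub>R iexp ((s * c) * x))"
  proof (intro Bochner_Integration.integral_cong refl)
    fix x
    have "s * normal_density 0 s (s * x) = std_normal_density x"
      using s by (simp add: normal_density_def real_sqrt_mult power_mult_distrib)
    moreover have "c * (s * x) = s * c * x" by simp
    ultimately show "s *\<^sub>R (normal_density 0 s (0 + s * x) *\<^sub>R iexp (c * (0 + s * x))) = std_normal_density x *\<^sub>R iexp (s * c * x)"
      by (simp add: ac_simps)
  qed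
  also have "\<dots> = char std_normal_distribution (s * c)"
    unfolding char_def by (subst integral_density) auto
  also have "\<dots> = complex_of_real (exp (- (s\<^sup>2 * c\<^sup>2) / 2))"
    by (simp add: char_std_normal_distribution power_mult_distrib)
  finally show ?thesis .
qed

text \<open>Coordinatewise images of product laws are product laws. Used to translate the noise and
  to round the coefficients.\<close>

lemma distr_PiM_components:
  assumes I: "finite I" and M: "\<And>i. prob_space (M i)" and N: "\<And>i. f i \<in> measurable (M i) (N i)"
  shows "distr (PiM I M) (PiM I N) (\<lambda>x. \<lambda>i\<in>I. f i (x i)) = PiM I (\<lambda>i. distr (M i) (N i) (f i))"
proof -
  have D: "prob_space (distr (M i) (N i) (f i))" for i using M N by (rule prob_space.prob_space_distr)
  interpret M: product_sigma_finite M by (simp add: product_sigma_finite_def M prob_space_imp_sigma_finite)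
  interpret D: product_sigma_finite "\<lambda>i. distr (M i) (N i) (f i)" by (simp add: product_sigma_finite_def D prob_space_imp_sigma_finite)
  have f: "(\<lambda>x. \<lambda>i\<in>I. f i (x i)) \<in> measurable (PiM I M) (PiM I N)"
  proof (rule measurable_restrict)
    fix i assume "i \<in> I"
    from measurable_compose[OF measurable_component_singleton[OF this, of M] N[of i]]
    show "(\<lambda>x. f i (x i)) \<in> measurable (PiM I M) (N i)" .
  qed
  show ?thesis
  proof (rule D.PiM_eqI[OF I])
    show "sets (distr (PiM I M) (PiM I N) (\<lambda>x. \<lambda>i\<in>I. f i (x i))) = sets (PiM I (\<lambda>i. distr (M i) (N i) (f i)))"
      by (simp cong: sets_PiM_cong)
    fix A assume "\<And>i. i \<in> I \<Longrightarrow> A i \<in> sets (distr (M i) (N i) (f i))"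
    then have A: "\<And>i. i \<in> I \<Longrightarrow> A i \<in> sets (N i)" by simp
    have "emeasure (distr (PiM I M) (PiM I N) (\<lambda>x. \<lambda>i\<in>I. f i (x i))) (Pi\<^sub>E I A)
        = emeasure (PiM I M) ((\<lambda>x. \<lambda>i\<in>I. f i (x i)) -` Pi\<^sub>E I A \<inter> space (PiM I M))"
      using A I by (intro emeasure_distr[OF f]) simp
    also have "(\<lambda>x. \<lambda>i\<in>I. f i (x i)) -` Pi\<^sub>E I A \<inter> space (PiM I M) = Pi\<^sub>E I (\<lambda>i. f i -` A i \<inter> space (M i))"
      by (auto simp: space_PiM PiE_iff)
    also have "emeasure (PiM I M) \<dots> = (\<Prod>i\<in>I. emeasure (M i) (f i -` A i \<inter> space (M i)))"
      using A N I by (intro M.emeasure_PiM) (auto intro: measurable_sets)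
    also have "\<dots> = (\<Prod>i\<in>I. emeasure (distr (M i) (N i) (f i)) (A i))"
      using A N by (intro prod.cong) (auto simp: emeasure_distr)
    finally show "emeasure (distr (PiM I M) (PiM I N) (\<lambda>x. \<lambda>i\<in>I. f i (x i))) (Pi\<^sub>E I A) = (\<Prod>i\<in>I. emeasure (distr (M i) (N i) (f i)) (A i))" .
  qed
qed

section \<open>Products of Gaussian laws\<close>

abbreviation gauss_prod :: "nat \<Rightarrow> real \<Rightarrow> (nat \<Rightarrow> real) measure" where
  "gauss_prod n s \<equiv> PiM {..<n} (\<lambda>_. gauss s)"

lemma sets_gauss_prod: "sets (gauss_prod n s) = sets (PiM {..<n} (\<lambda>_. borel))"
  by (intro sets_PiM_cong) auto

lemma prob_space_gauss_prod: "0 < s \<Longrightarrow> prob_space (gauss_prod n s)"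
  by (intro prob_space_PiM prob_space_gauss)

lemma ennreal_exp_sum: "finite I \<Longrightarrow> ennreal (exp (\<Sum>i\<in>I. f i)) = (\<Prod>i\<in>I. ennreal (exp (f i)))"
  by (simp add: exp_sum prod_ennreal)

text \<open>The Cameron-Martin formula in n dimensions: the translated law has the product of the
  one-dimensional tilts as its density.\<close>

lemma gauss_prod_shift:
  assumes s: "0 < s" and f[measurable]: "f \<in> borel_measurable (PiM {..<n} (\<lambda>_. borel))"
  shows "(\<integral>\<^sup>+e. f (\<lambda>k\<in>{..<n}. a k + e k) \<partial>gauss_prod n s)
       = (\<integral>\<^sup>+e. f e * ennreal (exp ((\<Sum>k<n. a k * e k) / s\<^sup>2 - (\<Sum>k<n. (a k)\<^sup>2) / (2 * s\<^sup>2))) \<partial>gauss_prod n s)"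
proof -
  let ?h = "\<lambda>k x. ennreal (exp (a k * x / s\<^sup>2 - (a k)\<^sup>2 / (2 * s\<^sup>2)))"
  note sets_gauss_prod[measurable_cong]
  have N: "prob_space (density lborel (\<lambda>x. ennreal (normal_density (a k) s x)))" for k
    using s by (rule prob_space_normal_density)
  have "distr (gauss_prod n s) (PiM {..<n} (\<lambda>_. borel)) (\<lambda>e. \<lambda>k\<in>{..<n}. a k + e k)
     = PiM {..<n} (\<lambda>k. distr (gauss s) borel (\<lambda>x. a k + x))"
    by (rule distr_PiM_components) (use s in \<open>auto intro: prob_space_gauss\<close>)
  also have "\<dots> = PiM {..<n} (\<lambda>k. density (gauss s) (?h k))"
    using s by (simp only: distr_gauss_shift gauss_tilt)
  also have "\<dots> = density (gauss_prod n s) (\<lambda>x. \<Prod>k<n. ?h k (x k))"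
    using s by (intro PiM_density) (auto simp: gauss_tilt intro!: prob_space_imp_sigma_finite prob_space_gauss N)
  finally have d: "distr (gauss_prod n s) (PiM {..<n} (\<lambda>_. borel)) (\<lambda>e. \<lambda>k\<in>{..<n}. a k + e k) = density (gauss_prod n s) (\<lambda>x. \<Prod>k<n. ?h k (x k))" .
  have m: "(\<lambda>e. \<lambda>k\<in>{..<n}. a k + e k) \<in> measurable (gauss_prod n s) (PiM {..<n} (\<lambda>_. borel))"
    by measurable
  have "(\<integral>\<^sup>+e. f (\<lambda>k\<in>{..<n}. a k + e k) \<partial>gauss_prod n s) = (\<integral>\<^sup>+e. f e \<partial>distr (gauss_prod n s) (PiM {..<n} (\<lambda>_. borel)) (\<lambda>e. \<lambda>k\<in>{..<n}. a k + e k))"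
    by (intro nn_integral_distr[symmetric] m) simp
  also have "\<dots> = (\<integral>\<^sup>+e. (\<Prod>k<n. ?h k (e k)) * f e \<partial>gauss_prod n s)"
    unfolding d by (rule nn_integral_density) measurable
  also have "\<dots> = (\<integral>\<^sup>+e. f e * ennreal (exp ((\<Sum>k<n. a k * e k) / s\<^sup>2 - (\<Sum>k<n. (a k)\<^sup>2) / (2 * s\<^sup>2))) \<partial>gauss_prod n s)"
    by (simp add: ennreal_exp_sum[symmetric] sum_subtractf sum_divide_distrib mult.commute)
  finally show ?thesis .
qed

lemma gauss_prod_char:
  assumes s: "0 < s"
  shows "(CLINT e|gauss_prod n s. iexp (\<Sum>k<n. c k * e k)) = complex_of_real (exp (- (s\<^sup>2 * (\<Sum>k<n. (c k)\<^sup>2)) / 2))"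
proof -
  interpret product_sigma_finite "\<lambda>_::nat. gauss s"
    using s by (simp add: product_sigma_finite_def prob_space_gauss prob_space_imp_sigma_finite)
  interpret G: prob_space "gauss s" using s by (rule prob_space_gauss)
  have "(CLINT e|gauss_prod n s. iexp (\<Sum>k<n. c k * e k)) = (CLINT e|gauss_prod n s. (\<Prod>k<n. iexp (c k * e k)))"
    by (simp add: exp_sum[symmetric] sum_distrib_left)
  also have "\<dots> = (\<Prod>k<n. CLINT x|gauss s. iexp (c k * x))"
    by (rule product_integral_prod) (auto intro!: G.integrable_const_bound[of _ 1])
  also have "\<dots> = (\<Prod>k<n. complex_of_real (exp (- (s\<^sup>2 * (c k)\<^sup>2) / 2)))"
    using s by (simp only: char_gauss)
  also have "\<dots> = complex_of_real (exp (\<Sum>k<n. - (s\<^sup>2 * (c k)\<^sup>2) / 2))"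
    by (simp only: exp_sum[OF finite_lessThan] of_real_prod)
  finally show ?thesis by (simp add: sum_negf sum_divide_distrib sum_distrib_left)
qed

lemma gauss_prod_nn_mgf:
  assumes s: "0 < s"
  shows "(\<integral>\<^sup>+e. ennreal (exp (\<Sum>k<n. c k * e k)) \<partial>gauss_prod n s) = ennreal (exp (s\<^sup>2 * (\<Sum>k<n. (c k)\<^sup>2) / 2))"
proof -
  interpret product_sigma_finite "\<lambda>_::nat. gauss s"
    using s by (simp add: product_sigma_finite_def prob_space_gauss prob_space_imp_sigma_finite)
  have "(\<integral>\<^sup>+e. ennreal (exp (\<Sum>k<n. c k * e k)) \<partial>gauss_prod n s) = (\<integral>\<^sup>+e. (\<Prod>k<n. ennreal (exp (c k * e k))) \<partial>gauss_prod n s)"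
    by (simp add: ennreal_exp_sum)
  also have "\<dots> = (\<Prod>k<n. \<integral>\<^sup>+x. ennreal (exp (c k * x)) \<partial>gauss s)"
    by (rule product_nn_integral_prod) auto
  also have "\<dots> = (\<Prod>k<n. ennreal (exp (s\<^sup>2 * (c k)\<^sup>2 / 2)))" using s by (simp only: nn_mgf_gauss)
  also have "\<dots> = ennreal (exp (\<Sum>k<n. s\<^sup>2 * (c k)\<^sup>2 / 2))" by (simp add: ennreal_exp_sum)
  finally show ?thesis by (simp add: sum_divide_distrib sum_distrib_left)
qed

lemma sum_linear_combination:
  "(\<Sum>i<p. t i * (\<Sum>k<n. b k i * e k)) = (\<Sum>k<n. (\<Sum>i<p. t i * b k i) * e k)" for t e :: "nat \<Rightarrow> real"
  by (simp add: sum_distrib_left sum_distrib_right mult.assoc) (rule sum.swap)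

lemma sum_square_linear_combination:
  "(\<Sum>k<n. (\<Sum>i<p. t i * b k i)\<^sup>2) = bilin {..<p} (\<lambda>i j. \<Sum>k<n. b k i * b k j) t t" for t :: "nat \<Rightarrow> real"
proof -
  have "(\<Sum>k<n. (\<Sum>i<p. t i * b k i)\<^sup>2) = (\<Sum>k<n. \<Sum>i<p. \<Sum>j<p. (b k i * b k j) * t i * t j)"
    by (simp add: power2_eq_square sum_product mult_ac)
  also have "\<dots> = (\<Sum>i<p. \<Sum>j<p. \<Sum>k<n. (b k i * b k j) * t i * t j)"
    by (subst sum.swap) (intro sum.cong refl sum.swap)
  finally show ?thesis by (simp add: bilin_def sum_distrib_right)
qed

text \<open>Both sides integrate \<open>f\<close> against centred Gaussian laws with the same
  covariance, hence with the same characteristic function. The vector x has variance 1/c and enters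
  as c x, which contributes c I; in this scaling it acts as an observation with noise variance
  1/c.\<close>

lemma gaussian_split:
  fixes a :: "nat \<Rightarrow> nat \<Rightarrow> real" and b :: "nat \<Rightarrow> nat \<Rightarrow> real"
  assumes s: "0 < s" and c: "0 < c"
    and gram: "\<And>t. s\<^sup>2 * bilin {..<p} (\<lambda>i j. \<Sum>k<n. a k i * a k j) t t
        = c * (\<Sum>i<p. (t i)\<^sup>2) + bilin {..<p} (\<lambda>i j. \<Sum>k<m. b k i * b k j) t t"
    and f[measurable]: "f \<in> borel_measurable (PiM {..<p} (\<lambda>_. borel))"
  shows "(\<integral>\<^sup>+e. f (\<lambda>i\<in>{..<p}. \<Sum>k<n. a k i * e k) \<partial>gauss_prod n s)
       = (\<integral>\<^sup>+x. \<integral>\<^sup>+z. f (\<lambda>i\<in>{..<p}. c * x i + (\<Sum>k<m. b k i * z k)) \<partial>gauss_prod m 1 \<partial>gauss_prod p (sqrt (1 / c)))"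
proof -
  note sets_gauss_prod[measurable_cong]
  let ?Q1 = "gauss_prod n s" and ?X = "gauss_prod p (sqrt (1 / c))" and ?Z = "gauss_prod m 1"
  interpret Q1: prob_space ?Q1 using s by (rule prob_space_gauss_prod)
  interpret X: prob_space ?X using c by (intro prob_space_gauss_prod) simp
  interpret Z: prob_space ?Z by (rule prob_space_gauss_prod) simp
  interpret XZ: pair_prob_space ?X ?Z ..
  define W1 where "W1 e = (\<lambda>i\<in>{..<p}. \<Sum>k<n. a k i * e k)" for e :: "nat \<Rightarrow> real"
  define W2 where "W2 y = (\<lambda>i\<in>{..<p}. c * fst y i + (\<Sum>k<m. b k i * snd y k))" for y :: "(nat \<Rightarrow> real) \<times> (nat \<Rightarrow> real)"
  have W1[measurable]: "W1 \<in> measurable ?Q1 (PiM {..<p} (\<lambda>_. borel))" unfolding W1_def[abs_def] by measurable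
  have W2[measurable]: "W2 \<in> measurable (?X \<Otimes>\<^sub>M ?Z) (PiM {..<p} (\<lambda>_. borel))" unfolding W2_def[abs_def] by measurable
  have "distr ?Q1 (PiM {..<p} (\<lambda>_. borel)) W1 = distr (?X \<Otimes>\<^sub>M ?Z) (PiM {..<p} (\<lambda>_. borel)) W2"
  proof (rule PiM_char_unique)
    show "prob_space (distr ?Q1 (PiM {..<p} (\<lambda>_. borel)) W1)" by (rule Q1.prob_space_distr[OF W1])
    show "prob_space (distr (?X \<Otimes>\<^sub>M ?Z) (PiM {..<p} (\<lambda>_. borel)) W2)" by (rule XZ.prob_space_distr[OF W2])
    fix t :: "nat \<Rightarrow> real"
    have it[measurable]: "(\<lambda>x. iexp (\<Sum>i<p. t i * x i)) \<in> borel_measurable (PiM {..<p} (\<lambda>_. borel))"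
      by measurable
    have "(CLINT x|distr ?Q1 (PiM {..<p} (\<lambda>_. borel)) W1. iexp (\<Sum>i<p. t i * x i)) = (CLINT e|?Q1. iexp (\<Sum>i<p. t i * W1 e i))"
      by (rule integral_distr[OF W1 it])
    also have "\<dots> = (CLINT e|?Q1. iexp (\<Sum>k<n. (\<Sum>i<p. t i * a k i) * e k))"
      by (simp add: W1_def sum_linear_combination)
    also have "\<dots> = complex_of_real (exp (- (s\<^sup>2 * (\<Sum>k<n. (\<Sum>i<p. t i * a k i)\<^sup>2)) / 2))"
      by (rule gauss_prod_char[OF s])
    finally have 1: "(CLINT x|distr ?Q1 (PiM {..<p} (\<lambda>_. borel)) W1. iexp (\<Sum>i<p. t i * x i))
      = complex_of_real (exp (- (s\<^sup>2 * (\<Sum>k<n. (\<Sum>i<p. t i * a k i)\<^sup>2)) / 2))" .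
    let ?A = "\<lambda>x. iexp (\<Sum>i<p. (c * t i) * x i)" and ?B = "\<lambda>z. iexp (\<Sum>k<m. (\<Sum>i<p. t i * b k i) * z k)"
    have split: "iexp (\<Sum>i<p. t i * W2 (x, z) i) = ?A x * ?B z" for x z
    proof -
      have "(\<Sum>i<p. t i * W2 (x, z) i) = (\<Sum>i<p. (c * t i) * x i) + (\<Sum>i<p. t i * (\<Sum>k<m. b k i * z k))"
        by (simp add: W2_def distrib_left sum.distrib mult_ac)
      then show ?thesis by (simp only: sum_linear_combination of_real_add distrib_left exp_add)
    qed
    have "(CLINT x|distr (?X \<Otimes>\<^sub>M ?Z) (PiM {..<p} (\<lambda>_. borel)) W2. iexp (\<Sum>i<p. t i * x i))
        = (CLINT y|?X \<Otimes>\<^sub>M ?Z. iexp (\<Sum>i<p. t i * W2 y i))"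
      by (rule integral_distr[OF W2 it])
    also have "\<dots> = (CLINT x|?X. CLINT z|?Z. iexp (\<Sum>i<p. t i * W2 (x, z) i))"
    proof (rule XZ.integral_fst'[symmetric])
      have "(\<lambda>y. iexp (\<Sum>i<p. t i * W2 y i)) \<in> borel_measurable (?X \<Otimes>\<^sub>M ?Z)"
        using measurable_compose[OF W2 it] .
      then show "integrable (?X \<Otimes>\<^sub>M ?Z) (\<lambda>y. iexp (\<Sum>i<p. t i * W2 y i))"
        by (intro XZ.integrable_const_bound[of _ 1]) auto
    qed
    also have "\<dots> = (CLINT x|?X. ?A x) * (CLINT z|?Z. ?B z)" unfolding split by simp
    also have "\<dots> = complex_of_real (exp (- ((sqrt (1 / c))\<^sup>2 * (\<Sum>i<p. (c * t i)\<^sup>2)) / 2)) *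
         complex_of_real (exp (- (1\<^sup>2 * (\<Sum>k<m. (\<Sum>i<p. t i * b k i)\<^sup>2)) / 2))"
      using c by (subst (1 2) gauss_prod_char) simp_all
    also have "\<dots> = complex_of_real (exp (- ((sqrt (1 / c))\<^sup>2 * (\<Sum>i<p. (c * t i)\<^sup>2)) / 2 + - (1\<^sup>2 * (\<Sum>k<m. (\<Sum>i<p. t i * b k i)\<^sup>2)) / 2))"
      by (simp only: exp_add of_real_mult)
    also have "- ((sqrt (1 / c))\<^sup>2 * (\<Sum>i<p. (c * t i)\<^sup>2)) / 2 + - (1\<^sup>2 * (\<Sum>k<m. (\<Sum>i<p. t i * b k i)\<^sup>2)) / 2
       = - (s\<^sup>2 * (\<Sum>k<n. (\<Sum>i<p. t i * a k i)\<^sup>2)) / 2"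
    proof -
      have "(sqrt (1 / c))\<^sup>2 * (\<Sum>i<p. (c * t i)\<^sup>2) = c * (\<Sum>i<p. (t i)\<^sup>2)"
      proof -
        have "(\<Sum>i<p. (c * t i)\<^sup>2) = c\<^sup>2 * (\<Sum>i<p. (t i)\<^sup>2)" by (simp add: power_mult_distrib sum_distrib_left)
        then show ?thesis using c by (simp add: power2_eq_square)
      qed
      then show ?thesis using gram[of t] by (simp add: sum_square_linear_combination)
    qed
    finally show "(CLINT x|distr ?Q1 (PiM {..<p} (\<lambda>_. borel)) W1. iexp (\<Sum>i<p. t i * x i)) =
        (CLINT x|distr (?X \<Otimes>\<^sub>M ?Z) (PiM {..<p} (\<lambda>_. borel)) W2. iexp (\<Sum>i<p. t i * x i))"
      using 1 by simp
  qed simp_all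
  then have "(\<integral>\<^sup>+w. f w \<partial>distr ?Q1 (PiM {..<p} (\<lambda>_. borel)) W1) = (\<integral>\<^sup>+w. f w \<partial>distr (?X \<Otimes>\<^sub>M ?Z) (PiM {..<p} (\<lambda>_. borel)) W2)" by simp
  then have "(\<integral>\<^sup>+e. f (W1 e) \<partial>?Q1) = (\<integral>\<^sup>+y. f (W2 y) \<partial>(?X \<Otimes>\<^sub>M ?Z))"
    by (simp add: nn_integral_distr)
  also have "\<dots> = (\<integral>\<^sup>+x. \<integral>\<^sup>+z. f (W2 (x, z)) \<partial>?Z \<partial>?X)"
    using measurable_compose[OF W2 f] by (rule Z.nn_integral_fst[symmetric])
  finally show ?thesis by (simp add: W1_def[abs_def] W2_def[abs_def])
qed

section \<open>Likelihood of the regression model\<close>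

text \<open>Lebesgue density of \<open>P\<close> convolved with a centred Gaussian of standard
  deviation \<open>s\<close>.\<close>

definition bayes_density :: "real \<Rightarrow> real measure \<Rightarrow> real \<Rightarrow> real" where
  "bayes_density s P z = (\<integral>b. normal_density b s z \<partial>P)"

definition affinity :: "real \<Rightarrow> real measure \<Rightarrow> real measure \<Rightarrow> real" where
  "affinity s P Q = (\<integral>z. sqrt (bayes_density s P z * bayes_density s Q z) \<partial>lborel)"

lemma normal_density_le: "normal_density b s z \<le> 1 / sqrt (2 * pi * s\<^sup>2)"
proof -
  have "exp (- (z - b)\<^sup>2 / (2 * s\<^sup>2)) \<le> 1" by simp
  then show ?thesis unfolding normal_density_def by (intro mult_left_le) auto
qed

lemma normal_density_measurable2[measurable]: "(\<lambda>x. normal_density (f x) s (g x)) \<in> borel_measurable M"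
  if "f \<in> borel_measurable M" "g \<in> borel_measurable M"
  unfolding normal_density_def using that by measurable

context unit_distribution
begin

lemma integrable_normal_density_param: "integrable P (\<lambda>b. normal_density b s z)"
  by (rule integrable_bounded[where C = "1 / sqrt (2 * pi * s\<^sup>2)"]) (use normal_density_le in auto)

lemma bayes_density_nonneg: "0 \<le> bayes_density s P z"
  unfolding bayes_density_def by (intro integral_nonneg_AE) auto

lemma bayes_density_measurable[measurable]: "bayes_density s P \<in> borel_measurable borel"
  unfolding bayes_density_def[abs_def] by measurable

lemma ennreal_bayes_density: "ennreal (bayes_density s P z) = (\<integral>\<^sup>+b. ennreal (normal_density b s z) \<partial>P)"
  unfolding bayes_density_def by (rule nn_integral_eq_integral[symmetric]) (auto simp: integrable_normal_density_param)

lemma nn_integral_bayes_density: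
  assumes s: "0 < s" shows "(\<integral>\<^sup>+z. ennreal (bayes_density s P z) \<partial>lborel) = 1"
proof -
  interpret pair_sigma_finite P lborel ..
  have "(\<integral>\<^sup>+z. ennreal (bayes_density s P z) \<partial>lborel) = (\<integral>\<^sup>+z. \<integral>\<^sup>+b. ennreal (normal_density b s z) \<partial>P \<partial>lborel)"
    by (simp add: ennreal_bayes_density)
  also have "\<dots> = (\<integral>\<^sup>+b. \<integral>\<^sup>+z. ennreal (normal_density b s z) \<partial>lborel \<partial>P)"
    by (rule Fubini') measurable
  also have "\<dots> = (\<integral>\<^sup>+b. 1 \<partial>P)" using s by (intro nn_integral_cong) (subst nn_integral_eq_integral, auto)
  finally show ?thesis by (simp add: emeasure_space_1[simplified])
qed

lemma integral_bayes_density: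
  assumes s: "0 < s"
  shows "integrable lborel (bayes_density s P)" "(\<integral>z. bayes_density s P z \<partial>lborel) = 1"
proof -
  show "integrable lborel (bayes_density s P)"
    by (rule integrableI_nonneg) (use nn_integral_bayes_density[OF s] bayes_density_nonneg in auto)
  show "(\<integral>z. bayes_density s P z \<partial>lborel) = 1"
    by (subst integral_eq_nn_integral) (use nn_integral_bayes_density[OF s] bayes_density_nonneg in auto)
qed

lemma bayes_density_lr:
  assumes c: "0 < c"
  shows "normal_density 0 (sqrt (1 / c)) z * (\<integral>b. exp (c * z * b - c * b\<^sup>2 / 2) \<partial>P) = bayes_density (sqrt (1 / c)) P z"
proof -
  have "normal_density 0 (sqrt (1 / c)) z * exp (c * z * b - c * b\<^sup>2 / 2) = normal_density b (sqrt (1 / c)) z" for b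
    using normal_density_tilt[of "sqrt (1 / c)" z b] c by (simp add: mult_ac)
  then show ?thesis unfolding bayes_density_def by (subst integral_mult_right_zero[symmetric]) simp
qed

end

lemma ennreal_le_if_square_le:
  fixes x :: ennreal
  assumes "x\<^sup>2 \<le> ennreal (r\<^sup>2)" "0 \<le> r" shows "x \<le> ennreal r"
proof (cases x)
  case (real a)
  then have "a\<^sup>2 \<le> r\<^sup>2" using assms by (simp add: ennreal_power)
  then show ?thesis using real assms(2) by (auto intro!: ennreal_leI power2_le_imp_le)
next
  case top
  then show ?thesis using assms(1) by (simp add: power2_eq_square ennreal_mult_top top_unique)
qed

definition gram_entry :: "nat \<Rightarrow> (nat \<Rightarrow> nat \<Rightarrow> real) \<Rightarrow> real \<Rightarrow> nat \<Rightarrow> nat \<Rightarrow> real" where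
  "gram_entry n x \<sigma> i j = (\<Sum>k<n. x k i * x k j) / \<sigma>\<^sup>2"

text \<open>The eigenvalue conditions appear as quadratic form bounds, the shape in which
  coefficient vectors are perturbed; \<open>rayleigh_bounds\<close> converts from spectra.\<close>

locale regression =
  fixes n p :: nat and x :: "nat \<Rightarrow> nat \<Rightarrow> real" and \<sigma> C1 C2 :: real
  assumes \<sigma>: "0 < \<sigma>" and C1: "0 < C1" and C2: "0 \<le> C2"
    and lower: "\<And>t. C1 * (\<Sum>i<p. (t i)\<^sup>2) \<le> bilin {..<p} (gram_entry n x \<sigma>) t t"
    and upper: "\<And>t. bilin {..<p} (gram_entry n x \<sigma>) t t \<le> C2 * (\<Sum>i<p. (t i)\<^sup>2)"
begin

abbreviation "G \<equiv> gram_entry n x \<sigma>"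

abbreviation "B \<equiv> PiM {..<p} (\<lambda>_. borel :: real measure)"
abbreviation "R \<equiv> gauss_prod n \<sigma>"

definition stat :: "(nat \<Rightarrow> real) \<Rightarrow> nat \<Rightarrow> real" where
  "stat y = (\<lambda>i\<in>{..<p}. (\<Sum>k<n. x k i * y k) / \<sigma>\<^sup>2)"

definition signal :: "(nat \<Rightarrow> real) \<Rightarrow> nat \<Rightarrow> real" where
  "signal \<beta> k = (\<Sum>i<p. x k i * \<beta> i)"

text \<open>Likelihood ratio of the data under the prior \<mu> against pure noise, as a function of
  the statistic. The type \<open>ennreal\<close> lets Tonelli's theorem be applied before
  integrability is known.\<close>

definition L :: "real measure \<Rightarrow> (nat \<Rightarrow> real) \<Rightarrow> ennreal" where
  "L \<mu> w = (\<integral>\<^sup>+\<beta>. ennreal (exp (quad_energy p G w \<beta>)) \<partial>PiM {..<p} (\<lambda>_. \<mu>))"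

lemma G_nonneg: "0 \<le> bilin {..<p} G t t"
  using lower[of t] C1 sum_nonneg[of "{..<p}" "\<lambda>i. (t i)\<^sup>2"] by (smt (verit) mult_nonneg_nonneg zero_le_power2)

lemma G_sym: "G i j = G j i" by (simp add: gram_entry_def mult.commute)

lemma stat_measurable[measurable]: "stat \<in> measurable (PiM {..<n} (\<lambda>_. borel)) B"
  unfolding stat_def[abs_def] by measurable

lemma sets_Q: "unit_distribution \<mu> \<Longrightarrow> sets (PiM {..<p} (\<lambda>_. \<mu>)) = sets B"
  by (intro sets_PiM_cong) (auto simp: unit_distribution.sets_P)

lemma prob_Q: "unit_distribution \<mu> \<Longrightarrow> prob_space (PiM {..<p} (\<lambda>_. \<mu>))"
  by (intro prob_space_PiM) (simp add: unit_distribution_def)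

lemma prob_R: "prob_space R" using \<sigma> by (rule prob_space_gauss_prod)

lemma quad_energy_measurable[measurable]:
  "(\<lambda>z. quad_energy p G (f z) (g z)) \<in> borel_measurable M" if [measurable]: "f \<in> measurable M B" "g \<in> measurable M B"
  unfolding quad_energy_def bilin_def by measurable

lemma AE_Q: "unit_distribution \<mu> \<Longrightarrow> AE \<beta> in PiM {..<p} (\<lambda>_. \<mu>). \<forall>i\<in>{..<p}. \<bar>\<beta> i\<bar> \<le> 1"
  by (intro AE_finite_allI AE_PiM_component) (auto simp: unit_distribution_def unit_distribution_axioms_def)

lemma L_measurable[measurable]: "unit_distribution \<mu> \<Longrightarrow> L \<mu> \<in> borel_measurable B"
proof -
  assume \<mu>: "unit_distribution \<mu>"
  interpret Q: prob_space "PiM {..<p} (\<lambda>_. \<mu>)" using \<mu> by (rule prob_Q)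
  note sets_Q[OF \<mu>, measurable_cong]
  show ?thesis unfolding L_def[abs_def] by measurable
qed

lemma L_le: assumes "unit_distribution \<mu>" shows "L \<mu> w \<le> ennreal (exp (\<Sum>i<p. \<bar>w i\<bar>))"
proof -
  interpret Q: prob_space "PiM {..<p} (\<lambda>_. \<mu>)" using assms by (rule prob_Q)
  have "L \<mu> w \<le> (\<integral>\<^sup>+\<beta>. ennreal (exp (\<Sum>i<p. \<bar>w i\<bar>)) \<partial>PiM {..<p} (\<lambda>_. \<mu>))"
    unfolding L_def
  proof (rule nn_integral_mono_AE)
    show "AE \<beta> in PiM {..<p} (\<lambda>_. \<mu>). ennreal (exp (quad_energy p G w \<beta>)) \<le> ennreal (exp (\<Sum>i<p. \<bar>w i\<bar>))"
      using AE_Q[OF assms]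
    proof eventually_elim
      case (elim \<beta>)
      have "w i * \<beta> i \<le> \<bar>w i\<bar>" if "i < p" for i
      proof -
        have "\<bar>w i\<bar> * \<bar>\<beta> i\<bar> \<le> \<bar>w i\<bar> * 1" using elim that by (intro mult_left_mono) auto
        then show ?thesis using abs_ge_self[of "w i * \<beta> i"] by (simp add: abs_mult)
      qed
      then have "(\<Sum>i<p. w i * \<beta> i) \<le> (\<Sum>i<p. \<bar>w i\<bar>)" by (intro sum_mono) auto
      then show ?case using G_nonneg[of \<beta>] by (intro ennreal_leI) (simp add: quad_energy_def)
    qed
  qed
  then show ?thesis by (simp add: Q.emeasure_space_1)
qed

lemma L_pos: assumes \<mu>: "unit_distribution \<mu>" shows "0 < L \<mu> w"
proof -
  interpret Q: prob_space "PiM {..<p} (\<lambda>_. \<mu>)" using \<mu> by (rule prob_Q)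
  have m: "(\<lambda>\<beta>. quad_energy p G w \<beta>) \<in> borel_measurable B"
    unfolding quad_energy_def bilin_def by measurable
  have "L \<mu> w \<noteq> 0"
  proof
    assume "L \<mu> w = 0"
    then have "AE \<beta> in PiM {..<p} (\<lambda>_. \<mu>). ennreal (exp (quad_energy p G w \<beta>)) = 0"
      unfolding L_def using m sets_Q[OF \<mu>] by (subst (asm) nn_integral_0_iff_AE) (auto cong: measurable_cong_sets)
    then show False by (simp add: Q.AE_False)
  qed
  then show ?thesis by (simp add: zero_less_iff_neq_zero)
qed

definition Lr :: "real measure \<Rightarrow> (nat \<Rightarrow> real) \<Rightarrow> real" where "Lr \<mu> w = enn2real (L \<mu> w)"

lemma L_eq: assumes "unit_distribution \<mu>" shows "L \<mu> w = ennreal (Lr \<mu> w)"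
  unfolding Lr_def using L_le[OF assms, of w] by (intro ennreal_enn2real[symmetric]) (auto simp: top_unique less_top intro: le_less_trans)

lemma Lr_pos: assumes "unit_distribution \<mu>" shows "0 < Lr \<mu> w"
  using L_pos[OF assms, of w] L_eq[OF assms, of w] by simp

lemma Lr_measurable[measurable]: "unit_distribution \<mu> \<Longrightarrow> Lr \<mu> \<in> borel_measurable B"
  unfolding Lr_def[abs_def] using L_measurable by simp

text \<open>Sufficiency: the Cameron-Martin exponent of a signal depends on the noise only through
  \<open>stat\<close>.\<close>

lemma shift_exponent:
  "(\<Sum>k<n. signal \<beta> k * e k) / \<sigma>\<^sup>2 - (\<Sum>k<n. (signal \<beta> k)\<^sup>2) / (2 * \<sigma>\<^sup>2) = quad_energy p G (stat e) \<beta>"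
proof -
  have "(\<Sum>k<n. signal \<beta> k * e k) = (\<Sum>i<p. \<beta> i * (\<Sum>k<n. x k i * e k))"
    unfolding sum_linear_combination signal_def by (simp add: mult.commute)
  also have "\<dots> / \<sigma>\<^sup>2 = (\<Sum>i<p. stat e i * \<beta> i)"
    unfolding sum_divide_distrib[of _ "{..<p}"] by (intro sum.cong) (auto simp: stat_def)
  finally have 1: "(\<Sum>k<n. signal \<beta> k * e k) / \<sigma>\<^sup>2 = (\<Sum>i<p. stat e i * \<beta> i)" .
  have "(\<Sum>k<n. (signal \<beta> k)\<^sup>2) = bilin {..<p} (\<lambda>i j. \<Sum>k<n. x k i * x k j) \<beta> \<beta>"
    unfolding sum_square_linear_combination[symmetric] signal_def by (simp add: mult.commute)
  then have "(\<Sum>k<n. (signal \<beta> k)\<^sup>2) / \<sigma>\<^sup>2 = bilin {..<p} G \<beta> \<beta>"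
    by (simp add: bilin_def gram_entry_def sum_divide_distrib[of _ "{..<p}"])
  then show ?thesis using 1 by (simp add: quad_energy_def)
qed

text \<open>Given \<beta>, the data are translated noise; the Cameron-Martin formula and Tonelli's
  theorem bring the prior integral inside, where it becomes \<open>L\<close>.\<close>

lemma change_of_measure:
  assumes \<mu>: "unit_distribution \<mu>" and f[measurable]: "f \<in> borel_measurable B"
  shows "(\<integral>\<^sup>+\<beta>. \<integral>\<^sup>+e. f (stat (\<lambda>k\<in>{..<n}. signal \<beta> k + e k)) \<partial>R \<partial>PiM {..<p} (\<lambda>_. \<mu>)) = (\<integral>\<^sup>+e. f (stat e) * L \<mu> (stat e) \<partial>R)"
proof -
  let ?Q = "PiM {..<p} (\<lambda>_. \<mu>)"
  interpret Q: prob_space ?Q using \<mu> by (rule prob_Q)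
  interpret R: prob_space R by (rule prob_R)
  interpret pair_sigma_finite ?Q R ..
  note sets_Q[OF \<mu>, measurable_cong] sets_gauss_prod[measurable_cong]
  have "(\<integral>\<^sup>+e. f (stat (\<lambda>k\<in>{..<n}. signal \<beta> k + e k)) \<partial>R) = (\<integral>\<^sup>+e. f (stat e) * ennreal (exp (quad_energy p G (stat e) \<beta>)) \<partial>R)" for \<beta>
    using gauss_prod_shift[OF \<sigma>, of "\<lambda>y. f (stat y)" n "signal \<beta>"] by (simp add: shift_exponent)
  then have "(\<integral>\<^sup>+\<beta>. \<integral>\<^sup>+e. f (stat (\<lambda>k\<in>{..<n}. signal \<beta> k + e k)) \<partial>R \<partial>?Q)
     = (\<integral>\<^sup>+\<beta>. \<integral>\<^sup>+e. f (stat e) * ennreal (exp (quad_energy p G (stat e) \<beta>)) \<partial>R \<partial>?Q)" by simp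
  also have "\<dots> = (\<integral>\<^sup>+e. \<integral>\<^sup>+\<beta>. f (stat e) * ennreal (exp (quad_energy p G (stat e) \<beta>)) \<partial>?Q \<partial>R)"
    by (rule Fubini'[symmetric]) measurable
  also have "\<dots> = (\<integral>\<^sup>+e. f (stat e) * L \<mu> (stat e) \<partial>R)"
    unfolding L_def
  proof (intro nn_integral_cong nn_integral_cmult)
    fix e assume "e \<in> space R"
    then have [measurable]: "stat e \<in> space B" by (auto simp: stat_def space_PiM)
    show "(\<lambda>\<beta>. ennreal (exp (quad_energy p G (stat e) \<beta>))) \<in> borel_measurable ?Q"
      unfolding quad_energy_def bilin_def by measurable
  qed
  finally show ?thesis .
qed

lemma stat_mgf: "(\<integral>\<^sup>+e. ennreal (exp (\<Sum>i<p. stat e i * t i)) \<partial>R) = ennreal (exp (bilin {..<p} G t t / 2))"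
proof -
  have "(\<Sum>i<p. stat e i * t i) = (\<Sum>k<n. (\<Sum>i<p. t i * (x k i / \<sigma>\<^sup>2)) * e k)" for e
    unfolding sum_linear_combination[symmetric] by (simp add: stat_def mult.commute sum_divide_distrib)
  then have "(\<integral>\<^sup>+e. ennreal (exp (\<Sum>i<p. stat e i * t i)) \<partial>R) = ennreal (exp (\<sigma>\<^sup>2 * (\<Sum>k<n. (\<Sum>i<p. t i * (x k i / \<sigma>\<^sup>2))\<^sup>2) / 2))"
    by (simp only: gauss_prod_nn_mgf[OF \<sigma>])
  also have "\<sigma>\<^sup>2 * (\<Sum>k<n. (\<Sum>i<p. t i * (x k i / \<sigma>\<^sup>2))\<^sup>2) = bilin {..<p} G t t"
    unfolding sum_square_linear_combination bilin_def sum_distrib_left gram_entry_def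
    using \<sigma> by (intro sum.cong refl) (simp add: sum_divide_distrib sum_distrib_left sum_distrib_right power2_eq_square mult_ac)
  finally show ?thesis .
qed

text \<open>Signs and coefficients merge into the moment generating function of the statistic at
  \<tau> + \<beta>, whose coordinates are at most 2 in size. G \<le> C2 I gives the exponent 4 C2 p
  / 2, and the term with -G/2 is at most 0.\<close>

lemma signed_moment:
  assumes \<mu>: "unit_distribution \<mu>" and \<tau>: "\<And>i. i < p \<Longrightarrow> \<bar>\<tau> i\<bar> \<le> 1"
  shows "(\<integral>\<^sup>+e. ennreal (exp (\<Sum>i<p. \<tau> i * stat e i)) * L \<mu> (stat e) \<partial>R) \<le> ennreal (exp (2 * C2 * p))"
proof -
  let ?Q = "PiM {..<p} (\<lambda>_. \<mu>)"
  interpret Q: prob_space ?Q using \<mu> by (rule prob_Q)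
  interpret R: prob_space R by (rule prob_R)
  interpret pair_sigma_finite ?Q R ..
  note sets_Q[OF \<mu>, measurable_cong] sets_gauss_prod[measurable_cong]
  have "(\<integral>\<^sup>+e. ennreal (exp (\<Sum>i<p. \<tau> i * stat e i)) * L \<mu> (stat e) \<partial>R)
     = (\<integral>\<^sup>+e. \<integral>\<^sup>+\<beta>. ennreal (exp (\<Sum>i<p. \<tau> i * stat e i)) * ennreal (exp (quad_energy p G (stat e) \<beta>)) \<partial>?Q \<partial>R)"
    unfolding L_def
  proof (intro nn_integral_cong nn_integral_cmult[symmetric])
    fix e assume "e \<in> space R"
    show "(\<lambda>\<beta>. ennreal (exp (quad_energy p G (stat e) \<beta>))) \<in> borel_measurable ?Q"
      unfolding quad_energy_def bilin_def by measurable
  qed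
  also have "\<dots> = (\<integral>\<^sup>+\<beta>. \<integral>\<^sup>+e. ennreal (exp (\<Sum>i<p. \<tau> i * stat e i)) * ennreal (exp (quad_energy p G (stat e) \<beta>)) \<partial>R \<partial>?Q)"
    by (rule Fubini') measurable
  also have "\<dots> = (\<integral>\<^sup>+\<beta>. ennreal (exp (- bilin {..<p} G \<beta> \<beta> / 2)) * (\<integral>\<^sup>+e. ennreal (exp (\<Sum>i<p. stat e i * (\<tau> i + \<beta> i))) \<partial>R) \<partial>?Q)"
  proof (intro nn_integral_cong)
    fix \<beta>
    have "exp (\<Sum>i<p. \<tau> i * stat e i) * exp (quad_energy p G (stat e) \<beta>) = exp (- bilin {..<p} G \<beta> \<beta> / 2) * exp (\<Sum>i<p. stat e i * (\<tau> i + \<beta> i))" for e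
      by (simp add: exp_add[symmetric] quad_energy_def algebra_simps sum.distrib)
    then have "(\<integral>\<^sup>+e. ennreal (exp (\<Sum>i<p. \<tau> i * stat e i)) * ennreal (exp (quad_energy p G (stat e) \<beta>)) \<partial>R)
        = (\<integral>\<^sup>+e. ennreal (exp (- bilin {..<p} G \<beta> \<beta> / 2)) * ennreal (exp (\<Sum>i<p. stat e i * (\<tau> i + \<beta> i))) \<partial>R)"
      by (simp add: ennreal_mult[symmetric])
    also have "\<dots> = ennreal (exp (- bilin {..<p} G \<beta> \<beta> / 2)) * (\<integral>\<^sup>+e. ennreal (exp (\<Sum>i<p. stat e i * (\<tau> i + \<beta> i))) \<partial>R)"
      by (rule nn_integral_cmult) measurable
    finally show "(\<integral>\<^sup>+e. ennreal (exp (\<Sum>i<p. \<tau> i * stat e i)) * ennreal (exp (quad_energy p G (stat e) \<beta>)) \<partial>R)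
        = ennreal (exp (- bilin {..<p} G \<beta> \<beta> / 2)) * (\<integral>\<^sup>+e. ennreal (exp (\<Sum>i<p. stat e i * (\<tau> i + \<beta> i))) \<partial>R)" .
  qed
  also have "\<dots> \<le> (\<integral>\<^sup>+\<beta>. ennreal (exp (2 * C2 * p)) \<partial>?Q)"
  proof (rule nn_integral_mono_AE)
    show "AE \<beta> in ?Q. ennreal (exp (- bilin {..<p} G \<beta> \<beta> / 2)) * (\<integral>\<^sup>+e. ennreal (exp (\<Sum>i<p. stat e i * (\<tau> i + \<beta> i))) \<partial>R) \<le> ennreal (exp (2 * C2 * p))"
      using AE_Q[OF \<mu>]
    proof eventually_elim
      case (elim \<beta>)
      have "(\<tau> i + \<beta> i)\<^sup>2 \<le> 4" if "i < p" for i
      proof -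
        have "\<bar>\<beta> i\<bar> \<le> 1" using elim that by simp
        then have "\<bar>\<tau> i + \<beta> i\<bar> \<le> 2" using \<tau>[OF that] by linarith
        then show ?thesis using abs_le_square_iff[of "\<tau> i + \<beta> i" 2] by simp
      qed
      then have "(\<Sum>i<p. (\<tau> i + \<beta> i)\<^sup>2) \<le> (\<Sum>i<p. 4)" by (intro sum_mono) auto
      then have "C2 * (\<Sum>i<p. (\<tau> i + \<beta> i)\<^sup>2) \<le> C2 * (4 * p)" using C2 by (intro mult_left_mono) auto
      then have "bilin {..<p} G (\<lambda>i. \<tau> i + \<beta> i) (\<lambda>i. \<tau> i + \<beta> i) \<le> 4 * C2 * p"
        using upper[of "\<lambda>i. \<tau> i + \<beta> i"] by simp
      then show ?case using G_nonneg[of \<beta>]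
        by (simp add: stat_mgf ennreal_mult[symmetric] exp_add[symmetric])
    qed
  qed
  also have "\<dots> = ennreal (exp (2 * C2 * p))" by (simp add: Q.emeasure_space_1)
  finally show ?thesis .
qed

text \<open>exp |w| is at most exp w + exp (-w); expanding the product over the coordinates gives
  the 2^p sign vectors of \<open>signed_moment\<close>.\<close>

lemma abs_moment:
  assumes \<mu>: "unit_distribution \<mu>"
  shows "(\<integral>\<^sup>+e. ennreal (exp (\<Sum>i<p. \<bar>stat e i\<bar>)) * L \<mu> (stat e) \<partial>R) \<le> ennreal (2 ^ p * exp (2 * C2 * p))"
proof -
  note sets_gauss_prod[measurable_cong] L_measurable[OF \<mu>, measurable]
  define S where "S = PiE {..<p} (\<lambda>_. {-1, 1 :: real})"
  have S: "finite S" "card S = 2 ^ p" unfolding S_def by (auto intro!: finite_PiE simp: card_PiE numeral_2_eq_2)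
  have "exp (\<Sum>i<p. \<bar>w i\<bar>) \<le> (\<Sum>\<tau>\<in>S. exp (\<Sum>i<p. \<tau> i * w i))" for w :: "nat \<Rightarrow> real"
  proof -
    have "exp (\<Sum>i<p. \<bar>w i\<bar>) = (\<Prod>i<p. exp \<bar>w i\<bar>)" by (simp add: exp_sum)
    also have "\<dots> \<le> (\<Prod>i<p. \<Sum>\<tau>\<in>{-1, 1}. exp (\<tau> * w i))"
      by (intro prod_mono) (auto simp: abs_if)
    also have "\<dots> = (\<Sum>\<tau>\<in>S. \<Prod>i<p. exp (\<tau> i * w i))" unfolding S_def by (rule prod_sum_PiE) auto
    also have "\<dots> = (\<Sum>\<tau>\<in>S. exp (\<Sum>i<p. \<tau> i * w i))" by (simp add: exp_sum)
    finally show ?thesis .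
  qed
  then have "(\<integral>\<^sup>+e. ennreal (exp (\<Sum>i<p. \<bar>stat e i\<bar>)) * L \<mu> (stat e) \<partial>R)
      \<le> (\<integral>\<^sup>+e. ennreal (\<Sum>\<tau>\<in>S. exp (\<Sum>i<p. \<tau> i * stat e i)) * L \<mu> (stat e) \<partial>R)"
    by (intro nn_integral_mono mult_right_mono ennreal_leI) auto
  also have "\<dots> = (\<integral>\<^sup>+e. (\<Sum>\<tau>\<in>S. ennreal (exp (\<Sum>i<p. \<tau> i * stat e i)) * L \<mu> (stat e)) \<partial>R)"
  proof (intro nn_integral_cong)
    fix e
    have "ennreal (\<Sum>\<tau>\<in>S. exp (\<Sum>i<p. \<tau> i * stat e i)) = (\<Sum>\<tau>\<in>S. ennreal (exp (\<Sum>i<p. \<tau> i * stat e i)))"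
      by (rule sum_ennreal[symmetric]) simp
    then show "ennreal (\<Sum>\<tau>\<in>S. exp (\<Sum>i<p. \<tau> i * stat e i)) * L \<mu> (stat e)
        = (\<Sum>\<tau>\<in>S. ennreal (exp (\<Sum>i<p. \<tau> i * stat e i)) * L \<mu> (stat e))"
      by (simp only: sum_distrib_right)
  qed
  also have "\<dots> = (\<Sum>\<tau>\<in>S. \<integral>\<^sup>+e. ennreal (exp (\<Sum>i<p. \<tau> i * stat e i)) * L \<mu> (stat e) \<partial>R)"
    by (rule nn_integral_sum) measurable
  also have "\<dots> \<le> (\<Sum>\<tau>\<in>S. ennreal (exp (2 * C2 * p)))"
  proof (intro sum_mono signed_moment[OF \<mu>])
    fix \<tau> i assume \<tau>: "\<tau> \<in> S" and i: "i < p"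
    have "\<tau> i \<in> {-1, 1}" using PiE_mem[OF \<tau>[unfolded S_def], of i] i by simp
    then show "\<bar>\<tau> i\<bar> \<le> 1" by auto
  qed
  also have "\<dots> = ennreal (\<Sum>\<tau>\<in>S. exp (2 * C2 * p))" by (rule sum_ennreal) simp
  also have "(\<Sum>\<tau>\<in>S. exp (2 * C2 * p)) = 2 ^ p * exp (2 * C2 * p)" by (simp add: S)
  finally show ?thesis .
qed

text \<open>Likelihood ratio of one observation u with noise variance 1/C1, for the prior \<mu>
  against the point mass at 0.\<close>

definition one_dim_lr :: "real measure \<Rightarrow> real \<Rightarrow> real" where
  "one_dim_lr \<mu> u = (\<integral>b. exp (C1 * u * b - C1 * b\<^sup>2 / 2) \<partial>\<mu>)"

lemma one_dim_lr:
  assumes "unit_distribution \<mu>"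
  shows "0 \<le> one_dim_lr \<mu> u" "(\<integral>\<^sup>+b. ennreal (exp (C1 * u * b - C1 * b\<^sup>2 / 2)) \<partial>\<mu>) = ennreal (one_dim_lr \<mu> u)"
proof -
  interpret unit_distribution \<mu> by fact
  show "0 \<le> one_dim_lr \<mu> u" by (simp add: one_dim_lr_def)
  show "(\<integral>\<^sup>+b. ennreal (exp (C1 * u * b - C1 * b\<^sup>2 / 2)) \<partial>\<mu>) = ennreal (one_dim_lr \<mu> u)"
    unfolding one_dim_lr_def using integrable_exp_quadratic[of "C1 * u" C1] by (intro nn_integral_eq_integral) auto
qed

lemma one_dim_lr_measurable: "unit_distribution \<mu> \<Longrightarrow> one_dim_lr \<mu> \<in> borel_measurable borel"
proof -
  assume "unit_distribution \<mu>"
  then interpret unit_distribution \<mu> .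
  show ?thesis unfolding one_dim_lr_def[abs_def] by measurable
qed

lemma one_dim_affinity:
  assumes \<mu>: "unit_distribution \<mu>" and \<nu>: "unit_distribution \<nu>"
  shows "(\<integral>\<^sup>+u. ennreal (sqrt (one_dim_lr \<mu> u * one_dim_lr \<nu> u)) \<partial>gauss (sqrt (1 / C1))) = ennreal (affinity (sqrt (1 / C1)) \<mu> \<nu>)"
proof -
  interpret \<mu>: unit_distribution \<mu> by fact
  interpret \<nu>: unit_distribution \<nu> by fact
  note [measurable] = one_dim_lr_measurable[OF \<mu>] one_dim_lr_measurable[OF \<nu>]
  let ?s = "sqrt (1 / C1)"
  have s: "0 < ?s" using C1 by simp
  have eq: "normal_density 0 ?s u * sqrt (one_dim_lr \<mu> u * one_dim_lr \<nu> u) = sqrt (bayes_density ?s \<mu> u * bayes_density ?s \<nu> u)" for u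
  proof -
    define d where "d = normal_density 0 ?s u"
    have d0: "0 \<le> d" by (simp add: d_def)
    have "bayes_density ?s \<mu> u * bayes_density ?s \<nu> u = (d * d) * (one_dim_lr \<mu> u * one_dim_lr \<nu> u)"
      using \<mu>.bayes_density_lr[OF C1, of u] \<nu>.bayes_density_lr[OF C1, of u]
      by (simp add: one_dim_lr_def d_def flip: \<open>_ = bayes_density _ \<mu> u\<close> \<open>_ = bayes_density _ \<nu> u\<close>)
    then show ?thesis using d0 by (simp add: real_sqrt_mult d_def[symmetric])
  qed
  have "(\<integral>\<^sup>+u. ennreal (sqrt (one_dim_lr \<mu> u * one_dim_lr \<nu> u)) \<partial>gauss ?s)
     = (\<integral>\<^sup>+u. ennreal (normal_density 0 ?s u) * ennreal (sqrt (one_dim_lr \<mu> u * one_dim_lr \<nu> u)) \<partial>lborel)"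
    by (rule nn_integral_density) measurable
  also have "\<dots> = (\<integral>\<^sup>+u. ennreal (sqrt (bayes_density ?s \<mu> u * bayes_density ?s \<nu> u)) \<partial>lborel)"
    using one_dim_lr(1)[OF \<mu>] one_dim_lr(1)[OF \<nu>] by (simp add: ennreal_mult[symmetric] eq)
  also have "\<dots> = ennreal (affinity ?s \<mu> \<nu>)"
    unfolding affinity_def
  proof (rule nn_integral_eq_integral)
    show "integrable lborel (\<lambda>u. sqrt (bayes_density ?s \<mu> u * bayes_density ?s \<nu> u))"
    proof (rule Bochner_Integration.integrable_bound)
      show "integrable lborel (\<lambda>u. (bayes_density ?s \<mu> u + bayes_density ?s \<nu> u) / 2)"
        using \<mu>.integral_bayes_density(1)[OF s] \<nu>.integral_bayes_density(1)[OF s] by simp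
      show "AE u in lborel. norm (sqrt (bayes_density ?s \<mu> u * bayes_density ?s \<nu> u)) \<le> norm ((bayes_density ?s \<mu> u + bayes_density ?s \<nu> u) / 2)"
        using \<mu>.bayes_density_nonneg \<nu>.bayes_density_nonneg arith_geo_mean_sqrt by (intro AE_I2) simp
    qed measurable
  qed (use \<mu>.bayes_density_nonneg \<nu>.bayes_density_nonneg in auto)
  finally show ?thesis .
qed

text \<open>The likelihood ratio depends on \<open>y\<close> only through \<open>stat y\<close>, a Gaussian vector with covariance
  \<open>G = C1 I + (G - C1 I)\<close>. Splitting off the isotropic part and averaging over the remainder with the
  Cauchy-Schwarz inequality leaves a product of one-dimensional affinities.\<close>

theorem affinity_tensorizes:
  assumes \<mu>: "unit_distribution \<mu>" and \<nu>: "unit_distribution \<nu>"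
  shows "(\<integral>\<^sup>+e. ennreal (sqrt (Lr \<mu> (stat e) * Lr \<nu> (stat e))) \<partial>R) \<le> ennreal (affinity (sqrt (1 / C1)) \<mu> \<nu> ^ p)"
proof -
  let ?s = "sqrt (1 / C1)"
  note [measurable] = Lr_measurable[OF \<mu>] Lr_measurable[OF \<nu>] L_measurable[OF \<mu>] L_measurable[OF \<nu>]
    and [measurable_cong] = sets_gauss_prod
  \<comment> \<open>Covariance left after the isotropic part. It is positive semidefinite by
    \<open>lower\<close>, so it is the Gram kernel of some \<open>b\<close>.\<close>
  define K where "K i j = G i j - (if i = j then C1 else 0)" for i j
  have Kq: "bilin {..<p} K t t = bilin {..<p} G t t - C1 * (\<Sum>i<p. (t i)\<^sup>2)" for t
    unfolding K_def by (rule bilin_shift) simp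
  have "\<exists>b. \<forall>i\<in>{..<p}. \<forall>j\<in>{..<p}. K i j = (\<Sum>k\<in>{..<p}. b k i * b k j)"
  proof (rule psd_factorization)
    show "0 \<le> bilin {..<p} K t t" for t using lower[of t] by (simp add: Kq)
    show "K i j = K j i" for i j using G_sym[of i j] by (simp add: K_def)
  qed simp
  then obtain b where b: "\<And>i j. i < p \<Longrightarrow> j < p \<Longrightarrow> K i j = (\<Sum>k<p. b k i * b k j)" by auto
  have bq: "bilin {..<p} (\<lambda>i j. \<Sum>k<p. b k i * b k j) t t = bilin {..<p} G t t - C1 * (\<Sum>i<p. (t i)\<^sup>2)" for t
    unfolding Kq[symmetric] using b by (simp add: bilin_def cong: sum.cong_simp)
  define W where "W u z = (\<lambda>i\<in>{..<p}. C1 * u i + (\<Sum>k<p. b k i * z k))" for u z :: "nat \<Rightarrow> real"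
  have W[measurable]: "W u \<in> measurable (gauss_prod p 1) B" for u unfolding W_def[abs_def] by measurable
  interpret Z: prob_space "gauss_prod p 1" by (rule prob_space_gauss_prod) simp
  \<comment> \<open>Averaging over z adds half of (G - C1 I) at \<beta> to the exponent, which turns
    -G/2 into -C1 |\<beta>|^2 / 2. The coordinates decouple.\<close>
  have remainder: "(\<integral>\<^sup>+z. L \<rho> (W u z) \<partial>gauss_prod p 1) = ennreal (\<Prod>i<p. one_dim_lr \<rho> (u i))"
    if lam: "unit_distribution \<rho>" for u \<rho>
  proof -
    let ?Q = "PiM {..<p} (\<lambda>_. \<rho>)"
    interpret lam: unit_distribution \<rho> by fact
    interpret Q: prob_space ?Q using lam by (rule prob_Q)
    interpret pair_sigma_finite ?Q "gauss_prod p 1" ..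
    interpret PS: product_sigma_finite "\<lambda>_::nat. \<rho>" by (simp add: product_sigma_finite_def lam.sigma_finite_measure_axioms)
    note sets_Q[OF lam, measurable_cong]
    have ex: "quad_energy p G (W u z) \<beta> = (\<Sum>i<p. C1 * u i * \<beta> i) - bilin {..<p} G \<beta> \<beta> / 2 + (\<Sum>k<p. (\<Sum>i<p. \<beta> i * b k i) * z k)" for z \<beta>
    proof -
      have "(\<Sum>i<p. W u z i * \<beta> i) = (\<Sum>i<p. C1 * u i * \<beta> i) + (\<Sum>i<p. \<beta> i * (\<Sum>k<p. b k i * z k))"
        by (simp add: W_def distrib_right sum.distrib mult.commute distrib_left)
      then show ?thesis by (simp add: quad_energy_def sum_linear_combination)
    qed
    have "(\<integral>\<^sup>+z. L \<rho> (W u z) \<partial>gauss_prod p 1) = (\<integral>\<^sup>+\<beta>. \<integral>\<^sup>+z. ennreal (exp (quad_energy p G (W u z) \<beta>)) \<partial>gauss_prod p 1 \<partial>?Q)"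
      unfolding L_def by (rule Fubini') measurable
    also have "\<dots> = (\<integral>\<^sup>+\<beta>. (\<Prod>i<p. ennreal (exp (C1 * u i * \<beta> i - C1 * (\<beta> i)\<^sup>2 / 2))) \<partial>?Q)"
    proof (intro nn_integral_cong)
      fix \<beta>
      define A where "A = (\<Sum>i<p. C1 * u i * \<beta> i) - bilin {..<p} G \<beta> \<beta> / 2"
      have "(\<integral>\<^sup>+z. ennreal (exp (quad_energy p G (W u z) \<beta>)) \<partial>gauss_prod p 1)
          = (\<integral>\<^sup>+z. ennreal (exp A) * ennreal (exp (\<Sum>k<p. (\<Sum>i<p. \<beta> i * b k i) * z k)) \<partial>gauss_prod p 1)"
        by (simp add: ex A_def exp_add ennreal_mult)
      also have "\<dots> = ennreal (exp A) * (\<integral>\<^sup>+z. ennreal (exp (\<Sum>k<p. (\<Sum>i<p. \<beta> i * b k i) * z k)) \<partial>gauss_prod p 1)"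
        by (rule nn_integral_cmult) measurable
      also have "\<dots> = ennreal (exp A) * ennreal (exp ((\<Sum>k<p. (\<Sum>i<p. \<beta> i * b k i)\<^sup>2) / 2))"
        by (subst gauss_prod_nn_mgf) simp_all
      also have "\<dots> = ennreal (exp (A + (bilin {..<p} G \<beta> \<beta> - C1 * (\<Sum>i<p. (\<beta> i)\<^sup>2)) / 2))"
        by (simp only: sum_square_linear_combination bq ennreal_mult[OF exp_ge_zero exp_ge_zero, symmetric] exp_add)
      also have "A + (bilin {..<p} G \<beta> \<beta> - C1 * (\<Sum>i<p. (\<beta> i)\<^sup>2)) / 2 = (\<Sum>i<p. C1 * u i * \<beta> i - C1 * (\<beta> i)\<^sup>2 / 2)"
        by (simp add: A_def sum_subtractf sum_distrib_left sum_divide_distrib diff_divide_distrib)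
      also have "ennreal (exp (\<Sum>i<p. C1 * u i * \<beta> i - C1 * (\<beta> i)\<^sup>2 / 2)) = (\<Prod>i<p. ennreal (exp (C1 * u i * \<beta> i - C1 * (\<beta> i)\<^sup>2 / 2)))"
        by (rule ennreal_exp_sum) simp
      finally show "(\<integral>\<^sup>+z. ennreal (exp (quad_energy p G (W u z) \<beta>)) \<partial>gauss_prod p 1) = (\<Prod>i<p. ennreal (exp (C1 * u i * \<beta> i - C1 * (\<beta> i)\<^sup>2 / 2)))" .
    qed
    also have "\<dots> = (\<Prod>i<p. \<integral>\<^sup>+c. ennreal (exp (C1 * u i * c - C1 * c\<^sup>2 / 2)) \<partial>\<rho>)"
      by (rule PS.product_nn_integral_prod) auto
    also have "\<dots> = ennreal (\<Prod>i<p. one_dim_lr \<rho> (u i))"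
      using one_dim_lr[OF lam] by (simp add: prod_ennreal)
    finally show ?thesis .
  qed
  have inner: "(\<integral>\<^sup>+z. ennreal (sqrt (Lr \<mu> (W u z) * Lr \<nu> (W u z))) \<partial>gauss_prod p 1)
      \<le> (\<Prod>i<p. ennreal (sqrt (one_dim_lr \<mu> (u i) * one_dim_lr \<nu> (u i))))" for u
  proof -
    define r where "r = (\<Prod>i<p. sqrt (one_dim_lr \<mu> (u i) * one_dim_lr \<nu> (u i)))"
    have r0: "0 \<le> r" unfolding r_def by (intro prod_nonneg) (auto simp: one_dim_lr(1) \<mu> \<nu>)
    have r2: "r\<^sup>2 = (\<Prod>i<p. one_dim_lr \<mu> (u i)) * (\<Prod>i<p. one_dim_lr \<nu> (u i))"
      unfolding r_def prod_power_distrib prod.distrib[symmetric]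
      by (intro prod.cong refl) (simp add: one_dim_lr(1) \<mu> \<nu>)
    have sq: "(ennreal (sqrt (Lr \<rho> w)))\<^sup>2 = L \<rho> w" if "unit_distribution \<rho>" for \<rho> w
      using Lr_pos[OF that, of w] by (simp add: L_eq[OF that] ennreal_power)
    define F where "F z = ennreal (sqrt (Lr \<mu> (W u z)))" for z
    define H where "H z = ennreal (sqrt (Lr \<nu> (W u z)))" for z
    have [measurable]: "F \<in> borel_measurable (gauss_prod p 1)" "H \<in> borel_measurable (gauss_prod p 1)"
      unfolding F_def[abs_def] H_def[abs_def] by measurable
    have FH: "ennreal (sqrt (Lr \<mu> (W u z) * Lr \<nu> (W u z))) = F z * H z" for z
      using Lr_pos[OF \<mu>] Lr_pos[OF \<nu>] by (simp add: F_def H_def ennreal_mult[symmetric] real_sqrt_mult less_imp_le)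
    have F2: "(\<integral>\<^sup>+z. (F z)\<^sup>2 \<partial>gauss_prod p 1) = ennreal (\<Prod>i<p. one_dim_lr \<mu> (u i))"
      by (simp only: F_def sq[OF \<mu>] remainder[OF \<mu>])
    have H2: "(\<integral>\<^sup>+z. (H z)\<^sup>2 \<partial>gauss_prod p 1) = ennreal (\<Prod>i<p. one_dim_lr \<nu> (u i))"
      by (simp only: H_def sq[OF \<nu>] remainder[OF \<nu>])
    have r2': "ennreal (\<Prod>i<p. one_dim_lr \<mu> (u i)) * ennreal (\<Prod>i<p. one_dim_lr \<nu> (u i)) = ennreal (r\<^sup>2)"
      by (subst ennreal_mult[symmetric]) (auto simp: r2 one_dim_lr(1) \<mu> \<nu> intro!: prod_nonneg)
    have "(\<integral>\<^sup>+z. F z * H z \<partial>gauss_prod p 1)\<^sup>2 \<le> ennreal (r\<^sup>2)"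
      using Cauchy_Schwarz_nn_integral[of F "gauss_prod p 1" H] by (simp add: F2 H2 r2')
    then have "(\<integral>\<^sup>+z. ennreal (sqrt (Lr \<mu> (W u z) * Lr \<nu> (W u z))) \<partial>gauss_prod p 1) \<le> ennreal r"
      unfolding FH using r0 by (rule ennreal_le_if_square_le)
    also have "ennreal r = (\<Prod>i<p. ennreal (sqrt (one_dim_lr \<mu> (u i) * one_dim_lr \<nu> (u i))))"
      unfolding r_def by (rule prod_ennreal[symmetric]) (auto simp: one_dim_lr(1) \<mu> \<nu>)
    finally show ?thesis .
  qed
  have st: "stat = (\<lambda>e. \<lambda>i\<in>{..<p}. \<Sum>k<n. (x k i / \<sigma>\<^sup>2) * e k)"
    by (auto simp: stat_def fun_eq_iff sum_divide_distrib)
  have "(\<integral>\<^sup>+e. ennreal (sqrt (Lr \<mu> (stat e) * Lr \<nu> (stat e))) \<partial>R)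
     = (\<integral>\<^sup>+u. \<integral>\<^sup>+z. ennreal (sqrt (Lr \<mu> (W u z) * Lr \<nu> (W u z))) \<partial>gauss_prod p 1 \<partial>gauss_prod p ?s)"
    unfolding st W_def
  proof (rule gaussian_split[OF \<sigma> C1])
    fix t :: "nat \<Rightarrow> real"
    have "\<sigma>\<^sup>2 * bilin {..<p} (\<lambda>i j. \<Sum>k<n. x k i / \<sigma>\<^sup>2 * (x k j / \<sigma>\<^sup>2)) t t = bilin {..<p} G t t"
      unfolding bilin_def sum_distrib_left gram_entry_def
      using \<sigma> by (intro sum.cong refl) (simp add: sum_divide_distrib sum_distrib_left sum_distrib_right power2_eq_square mult_ac)
    then show "\<sigma>\<^sup>2 * bilin {..<p} (\<lambda>i j. \<Sum>k<n. x k i / \<sigma>\<^sup>2 * (x k j / \<sigma>\<^sup>2)) t t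
        = C1 * (\<Sum>i<p. (t i)\<^sup>2) + bilin {..<p} (\<lambda>i j. \<Sum>k<p. b k i * b k j) t t"
      by (simp add: bq)
  qed measurable
  also have "\<dots> \<le> (\<integral>\<^sup>+u. (\<Prod>i<p. ennreal (sqrt (one_dim_lr \<mu> (u i) * one_dim_lr \<nu> (u i)))) \<partial>gauss_prod p ?s)"
    by (intro nn_integral_mono inner)
  also have "\<dots> = (\<Prod>i<p. \<integral>\<^sup>+c. ennreal (sqrt (one_dim_lr \<mu> c * one_dim_lr \<nu> c)) \<partial>gauss ?s)"
  proof -
    interpret PS: product_sigma_finite "\<lambda>_::nat. gauss ?s"
      using C1 by (simp add: product_sigma_finite_def prob_space_gauss prob_space_imp_sigma_finite)
    note [measurable] = one_dim_lr_measurable[OF \<mu>] one_dim_lr_measurable[OF \<nu>]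
    show ?thesis by (rule PS.product_nn_integral_prod) auto
  qed
  also have "\<dots> = ennreal (affinity ?s \<mu> \<nu> ^ p)"
  proof -
    have "0 \<le> affinity ?s \<mu> \<nu>" unfolding affinity_def
      using unit_distribution.bayes_density_nonneg[OF \<mu>] unit_distribution.bayes_density_nonneg[OF \<nu>] by (intro integral_nonneg_AE) auto
    then show ?thesis by (simp add: one_dim_affinity[OF \<mu> \<nu>] ennreal_power)
  qed
  finally show ?thesis .
qed

end

section \<open>A finite net of priors\<close>

text \<open>Tonelli's theorem one coordinate at a time, each costing a factor c. Domination, unlike
  closeness of measures, passes to products with an explicit constant.\<close>

lemma PiM_dominated:
  fixes \<alpha> \<nu> :: "real measure" and c :: ennreal
  assumes I: "finite I" and \<alpha>: "prob_space \<alpha>" "sets \<alpha> = sets borel" and \<nu>: "prob_space \<nu>" "sets \<nu> = sets borel"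
    and dom: "\<And>f. f \<in> borel_measurable borel \<Longrightarrow> (\<integral>\<^sup>+x. f x \<partial>\<alpha>) \<le> c * (\<integral>\<^sup>+x. f x \<partial>\<nu>)"
    and F: "F \<in> borel_measurable (PiM I (\<lambda>_. borel))"
  shows "(\<integral>\<^sup>+x. F x \<partial>PiM I (\<lambda>_. \<alpha>)) \<le> c ^ card I * (\<integral>\<^sup>+x. F x \<partial>PiM I (\<lambda>_. \<nu>))"
  using I F
proof (induction arbitrary: F)
  case empty
  then show ?case by (simp add: PiM_empty)
next
  case (insert i I)
  interpret \<alpha>: product_sigma_finite "\<lambda>_. \<alpha>" by (simp add: product_sigma_finite_def \<alpha> prob_space_imp_sigma_finite)
  interpret \<nu>: product_sigma_finite "\<lambda>_. \<nu>" by (simp add: product_sigma_finite_def \<nu> prob_space_imp_sigma_finite)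
  interpret \<nu>': prob_space \<nu> by fact
  have sa: "sets (PiM J (\<lambda>_. \<alpha>)) = sets (PiM J (\<lambda>_. borel))" and sn: "sets (PiM J (\<lambda>_. \<nu>)) = sets (PiM J (\<lambda>_. borel))" for J
    using \<alpha> \<nu> by (auto intro!: sets_PiM_cong)
  have Fa: "F \<in> borel_measurable (PiM (insert i I) (\<lambda>_. \<alpha>))" and Fn: "F \<in> borel_measurable (PiM (insert i I) (\<lambda>_. \<nu>))"
    using insert.prems by (simp_all add: measurable_cong_sets[OF sa refl] measurable_cong_sets[OF sn refl])
  have upd: "(\<lambda>y. x(i := y)) \<in> measurable borel (PiM (insert i I) (\<lambda>_. borel))" if "x \<in> space (PiM I (\<lambda>_. borel :: real measure))" for x
    using that by (intro measurable_fun_upd[where J = I]) auto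
  have upd2: "(\<lambda>z. (fst z)(i := snd z)) \<in> measurable (PiM I (\<lambda>_. borel :: real measure) \<Otimes>\<^sub>M borel) (PiM (insert i I) (\<lambda>_. borel))"
    by (intro measurable_fun_upd[where J = I]) auto
  define H where "H x = (\<integral>\<^sup>+y. F (x(i := y)) \<partial>\<nu>)" for x
  have H: "H \<in> borel_measurable (PiM I (\<lambda>_. borel))"
    unfolding H_def[abs_def]
  proof (rule sigma_finite_measure.borel_measurable_nn_integral[OF prob_space_imp_sigma_finite[OF \<nu>(1)]])
    have "(\<lambda>z. F ((fst z)(i := snd z))) \<in> borel_measurable (PiM I (\<lambda>_. borel :: real measure) \<Otimes>\<^sub>M borel)"
      using measurable_compose[OF upd2 insert.prems] .
    then show "(\<lambda>(x, y). F (x(i := y))) \<in> borel_measurable (PiM I (\<lambda>_. borel) \<Otimes>\<^sub>M \<nu>)"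
      using \<nu>(2) by (simp add: case_prod_unfold cong: measurable_cong_sets sets_pair_measure_cong)
  qed
  have "(\<integral>\<^sup>+x. F x \<partial>PiM (insert i I) (\<lambda>_. \<alpha>)) = (\<integral>\<^sup>+x. (\<integral>\<^sup>+y. F (x(i := y)) \<partial>\<alpha>) \<partial>PiM I (\<lambda>_. \<alpha>))"
    by (rule \<alpha>.product_nn_integral_insert[OF insert.hyps Fa])
  also have "\<dots> \<le> (\<integral>\<^sup>+x. c * H x \<partial>PiM I (\<lambda>_. \<alpha>))"
    unfolding H_def
  proof (intro nn_integral_mono dom)
    fix x assume "x \<in> space (PiM I (\<lambda>_. \<alpha>))"
    then have "x \<in> space (PiM I (\<lambda>_. borel :: real measure))" using sets_eq_imp_space_eq[OF sa[of I]] by simp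
    from measurable_compose[OF upd[OF this] insert.prems] show "(\<lambda>y. F (x(i := y))) \<in> borel_measurable borel" .
  qed
  also have "\<dots> = c * (\<integral>\<^sup>+x. H x \<partial>PiM I (\<lambda>_. \<alpha>))"
    by (rule nn_integral_cmult) (simp add: H measurable_cong_sets[OF sa refl])
  also have "\<dots> \<le> c * (c ^ card I * (\<integral>\<^sup>+x. H x \<partial>PiM I (\<lambda>_. \<nu>)))"
    by (intro mult_left_mono insert.IH H) simp
  also have "(\<integral>\<^sup>+x. H x \<partial>PiM I (\<lambda>_. \<nu>)) = (\<integral>\<^sup>+x. F x \<partial>PiM (insert i I) (\<lambda>_. \<nu>))"
    unfolding H_def by (rule \<nu>.product_nn_integral_insert[OF insert.hyps Fn, symmetric])
  finally show ?case using insert.hyps by (simp add: mult.assoc)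
qed

section \<open>Grid rounding and coded discrete priors\<close>

definition grid_round :: "nat \<Rightarrow> real \<Rightarrow> real" where
  "grid_round N b = of_int \<lfloor>real N * b\<rfloor> / real N"

text \<open>Rounding is downward, so for positive N and b in [-1, 1] the index N is reached only at
  b = 1.\<close>

definition grid_index :: "nat \<Rightarrow> int set" where "grid_index N = {- int N..int N}"

definition cell_mass :: "nat \<Rightarrow> real measure \<Rightarrow> int \<Rightarrow> real" where
  "cell_mass N \<mu> j = measure \<mu> {b. \<lfloor>real N * b\<rfloor> = j}"

text \<open>Cell masses are rounded up to multiples of \<open>1 / net_scale N\<close>. With this scale the rounding adds at most
  a fraction \<open>1 / N\<close> of the total mass, so the normalized net measure dominates the discretized prior up to the
  factor \<open>1 + 1 / N\<close>, uniformly over cells of small mass.\<close>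

definition net_scale :: "nat \<Rightarrow> nat" where "net_scale N = N * (2 * N + 1)"

definition grid_code :: "nat \<Rightarrow> real measure \<Rightarrow> int \<Rightarrow> nat" where
  "grid_code N \<mu> = (\<lambda>j\<in>grid_index N. nat \<lceil>real (net_scale N) * cell_mass N \<mu> j\<rceil>)"

definition net_measure :: "nat \<Rightarrow> (int \<Rightarrow> nat) \<Rightarrow> real measure" where
  "net_measure N k = distr (point_measure (grid_index N) (\<lambda>j. ennreal (real (k j) / real (\<Sum>j\<in>grid_index N. k j)))) borel (\<lambda>j. of_int j / real N)"

definition net_codes :: "nat \<Rightarrow> (int \<Rightarrow> nat) set" where
  "net_codes N = {k \<in> PiE (grid_index N) (\<lambda>_. {0..net_scale N}). 0 < (\<Sum>j\<in>grid_index N. k j)}"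

lemma grid_round_bounds:
  assumes N: "0 < N" shows "\<bar>grid_round N b - b\<bar> \<le> 1 / N" and "\<bar>b\<bar> \<le> 1 \<Longrightarrow> \<lfloor>real N * b\<rfloor> \<in> grid_index N" and "\<bar>b\<bar> \<le> 1 \<Longrightarrow> \<bar>grid_round N b\<bar> \<le> 1"
proof -
  have "\<bar>of_int \<lfloor>real N * b\<rfloor> - real N * b\<bar> \<le> 1" by linarith
  then have "\<bar>(of_int \<lfloor>real N * b\<rfloor> - real N * b) / N\<bar> \<le> 1 / N" using N by (simp add: abs_divide divide_right_mono)
  then show "\<bar>grid_round N b - b\<bar> \<le> 1 / N" using N by (simp add: grid_round_def diff_divide_distrib)
  assume b: "\<bar>b\<bar> \<le> 1"
  have "real N * b \<le> real N * 1" using b by (intro mult_left_mono) auto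
  moreover have "real N * (-1) \<le> real N * b" using b by (intro mult_left_mono) auto
  ultimately show ji: "\<lfloor>real N * b\<rfloor> \<in> grid_index N"
    unfolding grid_index_def by (auto simp: le_floor_iff floor_le_iff)
  then have "\<bar>of_int \<lfloor>real N * b\<rfloor> :: real\<bar> \<le> real N" unfolding grid_index_def by auto
  then show "\<bar>grid_round N b\<bar> \<le> 1" using N by (simp add: grid_round_def abs_divide)
qed

lemma finite_grid_index[simp]: "finite (grid_index N)" by (simp add: grid_index_def)

lemma card_grid_index: "card (grid_index N) = 2 * N + 1" by (simp add: grid_index_def)

lemma net_codes_card: "finite (net_codes N)" "card (net_codes N) \<le> (net_scale N + 1) ^ (2 * N + 1)"
proof -
  have f: "finite (PiE (grid_index N) (\<lambda>_. {0..net_scale N}))" by (intro finite_PiE) auto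
  then show "finite (net_codes N)" by (simp add: net_codes_def)
  have "card (net_codes N) \<le> card (PiE (grid_index N) (\<lambda>_. {0..net_scale N}))"
    unfolding net_codes_def by (intro card_mono f) auto
  then show "card (net_codes N) \<le> (net_scale N + 1) ^ (2 * N + 1)" by (simp add: card_PiE card_grid_index)
qed

lemma nn_integral_net:
  assumes "f \<in> borel_measurable borel"
  shows "(\<integral>\<^sup>+x. f x \<partial>net_measure N k) = (\<Sum>j\<in>grid_index N. ennreal (real (k j) / real (\<Sum>j\<in>grid_index N. k j)) * f (of_int j / real N))"
  unfolding net_measure_def using assms
  by (subst nn_integral_distr) (auto simp: nn_integral_point_measure_finite measurable_point_measure_eq1)

lemma unit_distribution_net:
  assumes N: "0 < N" and k: "k \<in> net_codes N" shows "unit_distribution (net_measure N k)"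
proof -
  let ?K = "real (\<Sum>j\<in>grid_index N. k j)"
  have K: "0 < ?K" using k by (simp add: net_codes_def del: of_nat_sum)
  have tot: "(\<Sum>j\<in>grid_index N. ennreal (real (k j) / ?K)) = 1"
  proof -
    have "(\<Sum>j\<in>grid_index N. ennreal (real (k j) / ?K)) = ennreal (\<Sum>j\<in>grid_index N. real (k j) / ?K)"
      using K by (intro sum_ennreal) auto
    also have "(\<Sum>j\<in>grid_index N. real (k j) / ?K) = 1" using K by (simp add: sum_divide_distrib[symmetric])
    finally show ?thesis by simp
  qed
  have s: "sets (net_measure N k) = sets borel" by (simp add: net_measure_def)
  have sp: "space (net_measure N k) = UNIV" by (simp add: net_measure_def)
  have "emeasure (net_measure N k) (space (net_measure N k)) = (\<integral>\<^sup>+x. 1 \<partial>net_measure N k)" by simp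
  also have "\<dots> = 1" using nn_integral_net[of "\<lambda>_. 1" N k] tot by simp
  finally interpret prob_space "net_measure N k" by (rule prob_spaceI)
  have "emeasure (net_measure N k) {x. \<not> \<bar>x\<bar> \<le> 1} = (\<integral>\<^sup>+x. indicator {x. \<not> \<bar>x\<bar> \<le> 1} x \<partial>net_measure N k)"
    by (rule nn_integral_indicator[symmetric]) (simp add: s)
  also have "\<dots> = 0"
  proof (subst nn_integral_net)
    have "indicator {x :: real. \<not> \<bar>x\<bar> \<le> 1} (of_int j / real N) = (0 :: ennreal)" if "j \<in> grid_index N" for j
    proof -
      have "\<bar>of_int j :: real\<bar> \<le> real N" using that by (auto simp: grid_index_def)
      then show ?thesis using N by (simp add: abs_divide)
    qed
    then show "(\<Sum>j\<in>grid_index N. ennreal (real (k j) / ?K) * indicator {x. \<not> \<bar>x\<bar> \<le> 1} (of_int j / real N)) = 0"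
      by (intro sum.neutral) simp
  qed measurable
  finally have "AE x in net_measure N k. \<bar>x\<bar> \<le> 1"
    by (intro AE_I'[of "{x. \<not> \<bar>x\<bar> \<le> 1}"]) (auto simp: null_sets_def s sp)
  then show ?thesis by unfold_locales (simp_all add: s)
qed

text \<open>Completing the square around the midpoint of the two means; the factor in front is the
  affinity of the two Gaussians.\<close>

lemma sqrt_normal_density_mult:
  assumes s: "0 < s"
  shows "sqrt (normal_density b s z * normal_density c s z) = exp (- (b - c)\<^sup>2 / (8 * s\<^sup>2)) * normal_density ((b + c) / 2) s z"
proof -
  have e: "- (z - b)\<^sup>2 / (2 * s\<^sup>2) + - (z - c)\<^sup>2 / (2 * s\<^sup>2) = 2 * (- (b - c)\<^sup>2 / (8 * s\<^sup>2) + - (z - (b + c) / 2)\<^sup>2 / (2 * s\<^sup>2))"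
    using s by (simp add: field_simps power2_eq_square)
  have "normal_density b s z * normal_density c s z = (exp (- (b - c)\<^sup>2 / (8 * s\<^sup>2)) * normal_density ((b + c) / 2) s z)\<^sup>2"
  proof -
    have "normal_density b s z * normal_density c s z = (1 / sqrt (2 * pi * s\<^sup>2))\<^sup>2 * (exp (- (z - b)\<^sup>2 / (2 * s\<^sup>2)) * exp (- (z - c)\<^sup>2 / (2 * s\<^sup>2)))"
      by (simp add: normal_density_def power2_eq_square)
    also have "\<dots> = (1 / sqrt (2 * pi * s\<^sup>2))\<^sup>2 * exp (- (z - b)\<^sup>2 / (2 * s\<^sup>2) + - (z - c)\<^sup>2 / (2 * s\<^sup>2))"
      by (simp only: exp_add)
    also have "\<dots> = (1 / sqrt (2 * pi * s\<^sup>2))\<^sup>2 * (exp (- (b - c)\<^sup>2 / (8 * s\<^sup>2)) * exp (- (z - (b + c) / 2)\<^sup>2 / (2 * s\<^sup>2)))\<^sup>2"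
      unfolding e exp_double exp_add ..
    finally show ?thesis by (simp add: normal_density_def power_mult_distrib power_divide)
  qed
  then show ?thesis by simp
qed

lemma integral_sqrt_normal_density_mult:
  assumes s: "0 < s"
  shows "(\<integral>\<^sup>+z. ennreal (sqrt (normal_density b s z * normal_density c s z)) \<partial>lborel) = ennreal (exp (- (b - c)\<^sup>2 / (8 * s\<^sup>2)))"
proof -
  have "(\<integral>\<^sup>+z. ennreal (sqrt (normal_density b s z * normal_density c s z)) \<partial>lborel)
      = (\<integral>\<^sup>+z. ennreal (exp (- (b - c)\<^sup>2 / (8 * s\<^sup>2))) * ennreal (normal_density ((b + c) / 2) s z) \<partial>lborel)"
    by (simp add: sqrt_normal_density_mult[OF s] ennreal_mult)
  also have "\<dots> = ennreal (exp (- (b - c)\<^sup>2 / (8 * s\<^sup>2))) * (\<integral>\<^sup>+z. ennreal (normal_density ((b + c) / 2) s z) \<partial>lborel)"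
    by (rule nn_integral_cmult) measurable
  also have "(\<integral>\<^sup>+z. ennreal (normal_density ((b + c) / 2) s z) \<partial>lborel) = 1"
    using s by (subst nn_integral_eq_integral) auto
  finally show ?thesis by simp
qed

section \<open>Domination by the net and affinities of convolved priors\<close>

context unit_distribution
begin

lemma cell_masses: assumes N: "0 < N" shows "(\<Sum>j\<in>grid_index N. cell_mass N P j) = 1"
proof -
  have m: "{b. \<lfloor>real N * b\<rfloor> = j} \<in> sets borel" for j by measurable
  have "(\<Sum>j\<in>grid_index N. cell_mass N P j) = measure P (\<Union>j\<in>grid_index N. {b. \<lfloor>real N * b\<rfloor> = j})"
    unfolding cell_mass_def using m
    by (intro finite_measure_finite_Union[symmetric]) (auto simp: disjoint_family_on_def)
  also have "\<dots> = 1"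
  proof (rule prob_eq_1[THEN iffD2])
    show "(\<Union>j\<in>grid_index N. {b. \<lfloor>real N * b\<rfloor> = j}) \<in> sets P" using m by auto
    show "AE b in P. b \<in> (\<Union>j\<in>grid_index N. {b. \<lfloor>real N * b\<rfloor> = j})"
      using AE_abs_le_1 by eventually_elim (use grid_round_bounds(2)[OF N] in auto)
  qed
  finally show ?thesis .
qed

lemma grid_code_bounds:
  assumes "j \<in> grid_index N"
  shows "real (net_scale N) * cell_mass N P j \<le> real (grid_code N P j)"
    and "real (grid_code N P j) \<le> real (net_scale N) * cell_mass N P j + 1"
    and "grid_code N P j \<le> net_scale N"
proof -
  let ?a = "real (net_scale N) * cell_mass N P j"
  have a: "0 \<le> ?a" by (simp add: cell_mass_def)
  have c: "real (grid_code N P j) = of_int \<lceil>?a\<rceil>" using assms a by (simp add: grid_code_def)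
  show "?a \<le> real (grid_code N P j)" "real (grid_code N P j) \<le> ?a + 1" unfolding c by linarith+
  have "?a \<le> real (net_scale N) * 1" unfolding cell_mass_def by (intro mult_left_mono) auto
  then have "\<lceil>?a\<rceil> \<le> int (net_scale N)" by (simp add: ceiling_le_iff)
  then show "grid_code N P j \<le> net_scale N" using assms by (simp add: grid_code_def nat_le_iff)
qed

lemma grid_code_sum:
  assumes N: "0 < N"
  shows "real (net_scale N) \<le> real (\<Sum>j\<in>grid_index N. grid_code N P j)"
    and "real (\<Sum>j\<in>grid_index N. grid_code N P j) \<le> (1 + 1 / N) * real (net_scale N)"
proof -
  have "(\<Sum>j\<in>grid_index N. real (net_scale N) * cell_mass N P j) = real (net_scale N)"
    using cell_masses[OF N] by (simp add: sum_distrib_left[symmetric])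
  moreover have "(\<Sum>j\<in>grid_index N. real (net_scale N) * cell_mass N P j) \<le> (\<Sum>j\<in>grid_index N. real (grid_code N P j))"
    by (intro sum_mono grid_code_bounds)
  moreover have "(\<Sum>j\<in>grid_index N. real (grid_code N P j)) \<le> (\<Sum>j\<in>grid_index N. real (net_scale N) * cell_mass N P j + 1)"
    by (intro sum_mono grid_code_bounds)
  moreover have "(1 + 1 / N) * real (net_scale N) = real (net_scale N) + real (2 * N + 1)"
    using N by (simp add: net_scale_def field_simps)
  ultimately show "real (net_scale N) \<le> real (\<Sum>j\<in>grid_index N. grid_code N P j)"
    "real (\<Sum>j\<in>grid_index N. grid_code N P j) \<le> (1 + 1 / N) * real (net_scale N)"
    by (simp_all add: sum.distrib card_grid_index)
qed

lemma grid_code_in_net: assumes N: "0 < N" shows "grid_code N P \<in> net_codes N"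
proof -
  have "0 < real (net_scale N)" unfolding of_nat_0_less_iff using N by (simp add: net_scale_def)
  then have "0 < (\<Sum>j\<in>grid_index N. grid_code N P j)" using grid_code_sum(1)[OF N] by linarith
  moreover have "grid_code N P \<in> PiE (grid_index N) (\<lambda>_. {0..net_scale N})"
    using grid_code_bounds(3) by (auto simp: PiE_iff grid_code_def)
  ultimately show ?thesis by (simp add: net_codes_def)
qed

lemma net_dominates:
  assumes N: "0 < N" and f: "f \<in> borel_measurable borel"
  shows "(\<integral>\<^sup>+b. f (grid_round N b) \<partial>P) \<le> ennreal (1 + 1 / N) * (\<integral>\<^sup>+x. f x \<partial>net_measure N (grid_code N P))"
proof -
  let ?k = "grid_code N P" and ?K = "real (\<Sum>j\<in>grid_index N. grid_code N P j)"
  have M: "0 < real (net_scale N)" unfolding of_nat_0_less_iff using N by (simp add: net_scale_def)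
  have K: "0 < ?K" using grid_code_sum(1)[OF N] M by linarith
  have m: "{b. \<lfloor>real N * b\<rfloor> = j} \<in> sets borel" for j by measurable
  have le: "cell_mass N P j \<le> (1 + 1 / N) * (real (?k j) / ?K)" if "j \<in> grid_index N" for j
  proof -
    have "cell_mass N P j * ?K \<le> cell_mass N P j * ((1 + 1 / N) * real (net_scale N))"
      using grid_code_sum(2)[OF N] by (intro mult_left_mono) (auto simp: cell_mass_def)
    also have "\<dots> = (1 + 1 / N) * (real (net_scale N) * cell_mass N P j)" by simp
    also have "\<dots> \<le> (1 + 1 / N) * real (?k j)" using grid_code_bounds(1)[OF that] by (intro mult_left_mono) auto
    finally show ?thesis using K by (simp only: times_divide_eq_right pos_le_divide_eq)
  qed
  have "(\<integral>\<^sup>+b. f (grid_round N b) \<partial>P) = (\<integral>\<^sup>+b. (\<Sum>j\<in>grid_index N. f (of_int j / real N) * indicator {b. \<lfloor>real N * b\<rfloor> = j} b) \<partial>P)"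
  proof (rule nn_integral_cong_AE)
    show "AE b in P. f (grid_round N b) = (\<Sum>j\<in>grid_index N. f (of_int j / real N) * indicator {b. \<lfloor>real N * b\<rfloor> = j} b)"
      using AE_abs_le_1
    proof eventually_elim
      case (elim b)
      have "(\<Sum>j\<in>grid_index N. f (of_int j / real N) * indicator {b. \<lfloor>real N * b\<rfloor> = j} b)
         = (\<Sum>j\<in>grid_index N. if \<lfloor>real N * b\<rfloor> = j then f (of_int j / real N) else 0)"
        by (intro sum.cong) (auto simp: indicator_def)
      also have "\<dots> = f (grid_round N b)"
        using grid_round_bounds(2)[OF N elim] by (simp add: grid_round_def)
      finally show ?case ..
    qed
  qed
  also have "\<dots> = (\<Sum>j\<in>grid_index N. \<integral>\<^sup>+b. f (of_int j / real N) * indicator {b. \<lfloor>real N * b\<rfloor> = j} b \<partial>P)"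
    using m by (intro nn_integral_sum) simp
  also have "\<dots> = (\<Sum>j\<in>grid_index N. f (of_int j / real N) * ennreal (cell_mass N P j))"
    using m by (intro sum.cong refl) (simp add: nn_integral_cmult_indicator cell_mass_def emeasure_eq_measure)
  also have "\<dots> \<le> (\<Sum>j\<in>grid_index N. f (of_int j / real N) * (ennreal (1 + 1 / N) * ennreal (real (?k j) / ?K)))"
  proof (intro sum_mono mult_left_mono)
    fix j assume "j \<in> grid_index N"
    from le[OF this] have "ennreal (cell_mass N P j) \<le> ennreal ((1 + 1 / N) * (real (?k j) / ?K))" by (rule ennreal_leI)
    also have "\<dots> = ennreal (1 + 1 / N) * ennreal (real (?k j) / ?K)" using K by (intro ennreal_mult) auto
    finally show "ennreal (cell_mass N P j) \<le> ennreal (1 + 1 / N) * ennreal (real (?k j) / ?K)" .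
  qed simp
  also have "\<dots> = ennreal (1 + 1 / N) * (\<integral>\<^sup>+x. f x \<partial>net_measure N ?k)"
    unfolding nn_integral_net[OF f] sum_distrib_left by (simp add: mult_ac)
  finally show ?thesis .
qed

lemma sqrt_bayes_density_integrable:
  assumes s: "0 < s" and Q: "unit_distribution Q"
  shows "integrable lborel (\<lambda>z. sqrt (bayes_density s P z * bayes_density s Q z))"
proof (rule Bochner_Integration.integrable_bound)
  interpret Q: unit_distribution Q by fact
  show "integrable lborel (\<lambda>u. (bayes_density s P u + bayes_density s Q u) / 2)"
    using integral_bayes_density(1)[OF s] Q.integral_bayes_density(1)[OF s] by simp
  show "AE u in lborel. norm (sqrt (bayes_density s P u * bayes_density s Q u)) \<le> norm ((bayes_density s P u + bayes_density s Q u) / 2)"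
    using bayes_density_nonneg Q.bayes_density_nonneg arith_geo_mean_sqrt by (intro AE_I2) simp
  show "(\<lambda>z. sqrt (bayes_density s P z * bayes_density s Q z)) \<in> borel_measurable lborel" by measurable
qed

lemma squared_root_difference:
  assumes s: "0 < s" and Q: "unit_distribution Q"
  shows "integrable lborel (\<lambda>z. (sqrt (bayes_density s P z) - sqrt (bayes_density s Q z))\<^sup>2)"
    and "(\<integral>z. (sqrt (bayes_density s P z) - sqrt (bayes_density s Q z))\<^sup>2 \<partial>lborel) = 2 - 2 * affinity s P Q"
proof -
  interpret Q: unit_distribution Q by fact
  have eq: "(sqrt (bayes_density s P z) - sqrt (bayes_density s Q z))\<^sup>2
     = bayes_density s P z + bayes_density s Q z - 2 * sqrt (bayes_density s P z * bayes_density s Q z)" for z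
    using bayes_density_nonneg[of s z] Q.bayes_density_nonneg[of s z]
    by (simp add: power2_diff real_sqrt_mult)
  note i = integral_bayes_density[OF s] Q.integral_bayes_density[OF s] sqrt_bayes_density_integrable[OF s Q]
  show "integrable lborel (\<lambda>z. (sqrt (bayes_density s P z) - sqrt (bayes_density s Q z))\<^sup>2)"
    unfolding eq using i by (intro Bochner_Integration.integrable_diff Bochner_Integration.integrable_add integrable_mult_right)
  show "(\<integral>z. (sqrt (bayes_density s P z) - sqrt (bayes_density s Q z))\<^sup>2 \<partial>lborel) = 2 - 2 * affinity s P Q"
    unfolding eq affinity_def using i by simp
qed

lemma affinity_bounds:
  assumes s: "0 < s" and Q: "unit_distribution Q"
  shows "0 \<le> affinity s P Q" "affinity s P Q \<le> 1"
proof -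
  interpret Q: unit_distribution Q by fact
  show "0 \<le> affinity s P Q" unfolding affinity_def
    using bayes_density_nonneg Q.bayes_density_nonneg by (intro integral_nonneg_AE) auto
  have "0 \<le> (\<integral>z. (sqrt (bayes_density s P z) - sqrt (bayes_density s Q z))\<^sup>2 \<partial>lborel)" by simp
  then show "affinity s P Q \<le> 1" unfolding squared_root_difference(2)[OF s Q] by simp
qed

text \<open>Twice the affinity defect is a squared L2 distance of root densities; the triangle
  inequality for squares costs the factor 2.\<close>

lemma affinity_triangle:
  assumes s: "0 < s" and Q: "unit_distribution Q" and R: "unit_distribution R"
  shows "1 - affinity s P R \<le> 2 * (1 - affinity s P Q) + 2 * (1 - affinity s Q R)"
proof -
  interpret Q: unit_distribution Q by fact
  note i = squared_root_difference[OF s Q] squared_root_difference[OF s R] Q.squared_root_difference[OF s R]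
  have pw: "(a - c)\<^sup>2 \<le> 2 * (a - b)\<^sup>2 + 2 * (b - c)\<^sup>2" for a b c :: real
  proof -
    have "0 \<le> (a - 2 * b + c)\<^sup>2" by simp
    then show ?thesis by (simp add: power2_eq_square algebra_simps)
  qed
  have "(\<integral>z. (sqrt (bayes_density s P z) - sqrt (bayes_density s R z))\<^sup>2 \<partial>lborel)
     \<le> (\<integral>z. 2 * (sqrt (bayes_density s P z) - sqrt (bayes_density s Q z))\<^sup>2 + 2 * (sqrt (bayes_density s Q z) - sqrt (bayes_density s R z))\<^sup>2 \<partial>lborel)"
    using i by (intro integral_mono pw Bochner_Integration.integrable_add integrable_mult_right)
  also have "\<dots> = 2 * (2 - 2 * affinity s P Q) + 2 * (2 - 2 * affinity s Q R)"
    using i by simp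
  finally show ?thesis using i by simp
qed

lemma convolution_gauss:
  assumes s: "0 < s"
  shows "P \<star> gauss s = density lborel (\<lambda>z. ennreal (bayes_density s P z))"
proof (rule measure_eqI)
  fix A assume "A \<in> sets (P \<star> gauss s)"
  then have A[measurable]: "A \<in> sets borel" by simp
  interpret G: prob_space "gauss s" using s by (rule prob_space_gauss)
  interpret pair_sigma_finite P lborel ..
  have "emeasure (P \<star> gauss s) A = (\<integral>\<^sup>+z. indicator A z \<partial>(P \<star> gauss s))"
    by (rule nn_integral_indicator[symmetric]) simp
  also have "\<dots> = (\<integral>\<^sup>+b. \<integral>\<^sup>+y. indicator A (b + y) \<partial>gauss s \<partial>P)"
    by (rule nn_integral_convolution) (auto simp: finite_measure_axioms G.finite_measure_axioms)
  also have "\<dots> = (\<integral>\<^sup>+b. \<integral>\<^sup>+z. ennreal (normal_density b s z) * indicator A z \<partial>lborel \<partial>P)"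
  proof (rule nn_integral_cong)
    fix b
    have "(\<integral>\<^sup>+y. indicator A (b + y) \<partial>gauss s) = (\<integral>\<^sup>+z. indicator A z \<partial>distr (gauss s) borel (\<lambda>y. b + y))"
      by (rule nn_integral_distr[symmetric]) auto
    also have "\<dots> = (\<integral>\<^sup>+z. ennreal (normal_density b s z) * indicator A z \<partial>lborel)"
      unfolding distr_gauss_shift[OF s] by (rule nn_integral_density) auto
    finally show "(\<integral>\<^sup>+y. indicator A (b + y) \<partial>gauss s) = (\<integral>\<^sup>+z. ennreal (normal_density b s z) * indicator A z \<partial>lborel)" .
  qed
  also have "\<dots> = (\<integral>\<^sup>+z. \<integral>\<^sup>+b. ennreal (normal_density b s z) * indicator A z \<partial>P \<partial>lborel)"
    by (rule Fubini'[symmetric]) measurable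
  also have "\<dots> = (\<integral>\<^sup>+z. ennreal (bayes_density s P z) * indicator A z \<partial>lborel)"
    unfolding ennreal_bayes_density by (intro nn_integral_cong nn_integral_multc) measurable
  also have "\<dots> = emeasure (density lborel (\<lambda>z. ennreal (bayes_density s P z))) A"
    by (rule emeasure_density[symmetric]) auto
  finally show "emeasure (P \<star> gauss s) A = emeasure (density lborel (\<lambda>z. ennreal (bayes_density s P z))) A" .
qed simp

text \<open>\<open>RN_deriv\<close> is determined only almost everywhere, and
  \<open>bayes_density\<close> is one version of it.\<close>

lemma hellinger_affinity:
  assumes s: "0 < s" and Q: "unit_distribution Q"
  shows "(hellinger_dist lborel (P \<star> gauss s) (Q \<star> gauss s))\<^sup>2 = 1 - affinity s P Q"
proof -
  interpret Q: unit_distribution Q by fact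
  have rn: "AE z in lborel. ennreal (bayes_density s U z) = RN_deriv lborel (U \<star> gauss s) z" if "unit_distribution U" for U
  proof -
    interpret U: unit_distribution U by fact
    show ?thesis by (rule sigma_finite_measure.RN_deriv_unique[OF sigma_finite_lborel]) (simp_all add: U.convolution_gauss[OF s])
  qed
  have "(\<integral>z. (sqrt (enn2real (RN_deriv lborel (P \<star> gauss s) z)) - sqrt (enn2real (RN_deriv lborel (Q \<star> gauss s) z)))\<^sup>2 \<partial>lborel)
     = (\<integral>z. (sqrt (bayes_density s P z) - sqrt (bayes_density s Q z))\<^sup>2 \<partial>lborel)"
  proof (rule integral_cong_AE)
    show "AE z in lborel. (sqrt (enn2real (RN_deriv lborel (P \<star> gauss s) z)) - sqrt (enn2real (RN_deriv lborel (Q \<star> gauss s) z)))\<^sup>2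
        = (sqrt (bayes_density s P z) - sqrt (bayes_density s Q z))\<^sup>2"
      using rn[OF unit_distribution_axioms] rn[OF Q]
    proof eventually_elim
      case (elim z)
      show ?case unfolding elim(1)[symmetric] elim(2)[symmetric]
        by (simp add: bayes_density_nonneg Q.bayes_density_nonneg)
    qed
  qed measurable
  then show ?thesis
    using squared_root_difference(2)[OF s Q] affinity_bounds[OF s Q] by (simp add: hellinger_dist_def)
qed

text \<open>The coupling of \<open>P\<close> with its rounding bounds the affinity from below by joint concavity
  (Cauchy-Schwarz in \<open>b\<close>); passing to the net measure only costs the factor \<open>1 + 1 / N\<close>.\<close>

lemma affinity_net:
  assumes s: "1 \<le> s" and N: "0 < N"
  shows "1 - 2 / N \<le> affinity s P (net_measure N (grid_code N P))"
proof -
  let ?Q = "net_measure N (grid_code N P)"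
  have s0: "0 < s" using s by simp
  have Q: "unit_distribution ?Q" by (rule unit_distribution_net[OF N grid_code_in_net[OF N]])
  interpret Q: unit_distribution ?Q by (rule Q)
  interpret pair_sigma_finite P lborel ..
  define c where "c = 1 + 1 / real N"
  have c: "1 \<le> c" by (simp add: c_def)
  have [measurable]: "grid_round N \<in> borel_measurable borel" unfolding grid_round_def[abs_def] by measurable
  define F where "F z b = sqrt (normal_density b s z * normal_density (grid_round N b) s z)" for z b
  have Fm[measurable]: "(\<lambda>(b, z). ennreal (F z b)) \<in> borel_measurable (P \<Otimes>\<^sub>M lborel)"
    unfolding F_def by measurable
  have pw: "(\<integral>\<^sup>+b. ennreal (F z b) \<partial>P) \<le> ennreal (sqrt c * sqrt (bayes_density s P z * bayes_density s ?Q z))" for z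
  proof (rule ennreal_le_if_square_le)
    define u where "u b = ennreal (sqrt (normal_density b s z))" for b
    define v where "v b = ennreal (sqrt (normal_density (grid_round N b) s z))" for b
    have [measurable]: "u \<in> borel_measurable P" "v \<in> borel_measurable P" unfolding u_def[abs_def] v_def[abs_def] by measurable
    have uv: "ennreal (F z b) = u b * v b" for b
      by (simp add: F_def u_def v_def real_sqrt_mult ennreal_mult[symmetric])
    have u2: "(u b)\<^sup>2 = ennreal (normal_density b s z)" and v2: "(v b)\<^sup>2 = ennreal (normal_density (grid_round N b) s z)" for b
      by (simp_all add: u_def v_def ennreal_power)
    have "(\<integral>\<^sup>+b. ennreal (F z b) \<partial>P)\<^sup>2 \<le> (\<integral>\<^sup>+b. (u b)\<^sup>2 \<partial>P) * (\<integral>\<^sup>+b. (v b)\<^sup>2 \<partial>P)"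
      unfolding uv by (rule Cauchy_Schwarz_nn_integral) measurable
    also have "\<dots> \<le> ennreal (bayes_density s P z) * (ennreal c * ennreal (bayes_density s ?Q z))"
    proof (rule mult_mono)
      show "(\<integral>\<^sup>+b. (u b)\<^sup>2 \<partial>P) \<le> ennreal (bayes_density s P z)" unfolding u2 ennreal_bayes_density ..
      show "(\<integral>\<^sup>+b. (v b)\<^sup>2 \<partial>P) \<le> ennreal c * ennreal (bayes_density s ?Q z)"
        unfolding v2 Q.ennreal_bayes_density c_def
        by (rule net_dominates[OF N, of "\<lambda>b. ennreal (normal_density b s z)"]) measurable
    qed auto
    also have "\<dots> = ennreal ((sqrt c * sqrt (bayes_density s P z * bayes_density s ?Q z))\<^sup>2)"
      using c bayes_density_nonneg[of s z] Q.bayes_density_nonneg[of s z]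
      by (simp add: power_mult_distrib ennreal_mult[symmetric] mult_ac)
    finally show "(\<integral>\<^sup>+b. ennreal (F z b) \<partial>P)\<^sup>2 \<le> ennreal ((sqrt c * sqrt (bayes_density s P z * bayes_density s ?Q z))\<^sup>2)" .
  qed (use c bayes_density_nonneg Q.bayes_density_nonneg in simp)
  \<comment> \<open>Rounding moves b by at most 1/N, so this bounds from below the affinity of the
    Gaussians centred at b and at its rounding, uniformly in b.\<close>
  have "ennreal (exp (- 1 / (8 * s\<^sup>2 * (real N)\<^sup>2))) = (\<integral>\<^sup>+b. ennreal (exp (- 1 / (8 * s\<^sup>2 * (real N)\<^sup>2))) \<partial>P)"
    by (simp add: emeasure_space_1[simplified])
  also have "\<dots> \<le> (\<integral>\<^sup>+b. \<integral>\<^sup>+z. ennreal (F z b) \<partial>lborel \<partial>P)"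
  proof (rule nn_integral_mono)
    fix b
    have "(b - grid_round N b)\<^sup>2 \<le> (1 / real N)\<^sup>2"
      using grid_round_bounds(1)[OF N, of b] by (simp add: abs_le_square_iff[symmetric] abs_minus_commute)
    then have "(b - grid_round N b)\<^sup>2 / (8 * s\<^sup>2) \<le> (1 / real N)\<^sup>2 / (8 * s\<^sup>2)" by (intro divide_right_mono) auto
    also have "\<dots> = 1 / (8 * s\<^sup>2 * (real N)\<^sup>2)" by (simp add: power_divide)
    finally show "ennreal (exp (- 1 / (8 * s\<^sup>2 * (real N)\<^sup>2))) \<le> (\<integral>\<^sup>+z. ennreal (F z b) \<partial>lborel)"
      unfolding F_def integral_sqrt_normal_density_mult[OF s0] by (intro ennreal_leI) simp
  qed
  also have "\<dots> = (\<integral>\<^sup>+z. \<integral>\<^sup>+b. ennreal (F z b) \<partial>P \<partial>lborel)"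
    by (rule Fubini'[symmetric]) (rule Fm)
  also have "\<dots> \<le> (\<integral>\<^sup>+z. ennreal (sqrt c * sqrt (bayes_density s P z * bayes_density s ?Q z)) \<partial>lborel)"
    by (rule nn_integral_mono) (rule pw)
  also have "\<dots> = ennreal (\<integral>z. sqrt c * sqrt (bayes_density s P z * bayes_density s ?Q z) \<partial>lborel)"
    using sqrt_bayes_density_integrable[OF s0 Q] c bayes_density_nonneg Q.bayes_density_nonneg
    by (intro nn_integral_eq_integral) auto
  also have "(\<integral>z. sqrt c * sqrt (bayes_density s P z * bayes_density s ?Q z) \<partial>lborel) = sqrt c * affinity s P ?Q"
    by (simp add: affinity_def)
  finally have 1: "exp (- 1 / (8 * s\<^sup>2 * (real N)\<^sup>2)) \<le> sqrt c * affinity s P ?Q"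
    using c affinity_bounds(1)[OF s0 Q] by (subst (asm) ennreal_le_iff) auto
  \<comment> \<open>The displacement costs one 1/N here and the factor c = 1 + 1/N costs another
    below; together they make up 2/N.\<close>
  have "1 - 1 / real N \<le> exp (- 1 / (8 * s\<^sup>2 * (real N)\<^sup>2))"
  proof -
    have "real N \<le> (real N)\<^sup>2" using N by (simp add: power2_eq_square)
    also have "1 * (real N)\<^sup>2 \<le> (8 * s\<^sup>2) * (real N)\<^sup>2"
    proof (rule mult_right_mono)
      have "1 \<le> s\<^sup>2" using s by (simp add: one_le_power)
      then show "1 \<le> 8 * s\<^sup>2" by simp
    qed simp
    finally have "1 / (8 * s\<^sup>2 * (real N)\<^sup>2) \<le> 1 / real N" using N by (intro divide_left_mono) auto
    moreover have "1 + (- 1 / (8 * s\<^sup>2 * (real N)\<^sup>2)) \<le> exp (- 1 / (8 * s\<^sup>2 * (real N)\<^sup>2))" by (rule exp_ge_add_one_self)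
    ultimately show ?thesis by simp
  qed
  also note 1
  also have "sqrt c * affinity s P ?Q \<le> c * affinity s P ?Q"
  proof (rule mult_right_mono)
    have "c * 1 \<le> c * c" using c by (intro mult_left_mono) auto
    then have "c \<le> c\<^sup>2" by (simp add: power2_eq_square)
    then show "sqrt c \<le> c" using c by (intro real_le_lsqrt) auto
  qed (rule affinity_bounds[OF s0 Q])
  also have "c * affinity s P ?Q \<le> affinity s P ?Q + 1 / real N"
    using affinity_bounds[OF s0 Q] by (simp add: c_def distrib_right divide_right_mono)
  finally show ?thesis by simp
qed

end

section \<open>Likelihood cost of passing to the net\<close>

context regression
begin

text \<open>Rounding \<beta> changes the energy by a controlled amount; afterwards the rounded prior
  is dominated coordinatewise by the net prior, which costs (1 + 1/N)^p. The dependence on w stays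
  explicit, since w is bounded only with high probability.\<close>

lemma L_le_net:
  assumes \<mu>: "unit_distribution \<mu>" and N: "0 < N"
  shows "L \<mu> w \<le> ennreal (exp ((\<Sum>i<p. \<bar>w i\<bar>) / N + 5 / 4 * C2 * p / N) * (1 + 1 / N) ^ p) * L (net_measure N (grid_code N \<mu>)) w"
proof -
  interpret unit_distribution \<mu> by fact
  let ?\<nu> = "net_measure N (grid_code N \<mu>)" and ?Q = "PiM {..<p} (\<lambda>_. \<mu>)"
  let ?e = "exp ((\<Sum>i<p. \<bar>w i\<bar>) / N + 5 / 4 * C2 * p / N)"
  have \<nu>: "unit_distribution ?\<nu>" by (rule unit_distribution_net[OF N grid_code_in_net[OF N]])
  interpret \<nu>: unit_distribution ?\<nu> by (rule \<nu>)
  define D where "D = distr \<mu> borel (grid_round N)"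
  have gm[measurable]: "grid_round N \<in> borel_measurable borel" unfolding grid_round_def[abs_def] by measurable
  have D: "prob_space D" "sets D = sets borel" unfolding D_def by (auto intro: prob_space_distr)
  have qm: "(\<lambda>\<beta>. ennreal (exp (quad_energy p G w \<beta>))) \<in> borel_measurable B"
    unfolding quad_energy_def bilin_def by measurable
  have rm: "(\<lambda>\<beta>. \<lambda>i\<in>{..<p}. grid_round N (\<beta> i)) \<in> measurable ?Q B" by measurable
  have "L \<mu> w \<le> (\<integral>\<^sup>+\<beta>. ennreal ?e * ennreal (exp (quad_energy p G w (\<lambda>i\<in>{..<p}. grid_round N (\<beta> i)))) \<partial>?Q)"
    unfolding L_def
  proof (rule nn_integral_mono_AE)
    show "AE \<beta> in ?Q. ennreal (exp (quad_energy p G w \<beta>)) \<le> ennreal ?e * ennreal (exp (quad_energy p G w (\<lambda>i\<in>{..<p}. grid_round N (\<beta> i))))"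
      using AE_Q[OF \<mu>]
    proof eventually_elim
      case (elim \<beta>)
      define r where "r i = grid_round N (\<beta> i)" for i
      have r1: "\<bar>r i\<bar> \<le> 1" if "i < p" for i using grid_round_bounds(3)[OF N, of "\<beta> i"] elim that by (simp add: r_def)
      have d: "\<bar>r i - \<beta> i\<bar> \<le> 1 / N" for i unfolding r_def by (rule grid_round_bounds(1)[OF N])
      \<comment> \<open>The difference of the two quadratic forms is the mixed form of a = r -
        \<beta> and b = r + \<beta>. The weight N balances |a| \<le> 1/N against |b| \<le> 2 and
        gives (1 + 4) C2 p / N, halved once by the AM-GM bound and once by the 1/2 in the
        energy.\<close>
      define a where "a i = r i + (-1) * \<beta> i" for i
      define b where "b i = r i + \<beta> i" for i
      have "(\<Sum>i<p. w i * \<beta> i) - (\<Sum>i<p. w i * r i) = (\<Sum>i<p. w i * (\<beta> i - r i))"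
        by (simp add: right_diff_distrib sum_subtractf)
      also have "\<dots> \<le> (\<Sum>i<p. \<bar>w i\<bar> * (1 / N))"
      proof (rule sum_mono)
        fix i
        have "w i * (\<beta> i - r i) \<le> \<bar>w i\<bar> * \<bar>\<beta> i - r i\<bar>" unfolding abs_mult[symmetric] by (rule abs_ge_self)
        also have "\<dots> \<le> \<bar>w i\<bar> * (1 / N)" using d[of i] by (intro mult_left_mono) auto
        finally show "w i * (\<beta> i - r i) \<le> \<bar>w i\<bar> * (1 / N)" .
      qed
      also have "\<dots> = (\<Sum>i<p. \<bar>w i\<bar>) / N" by (simp add: sum_divide_distrib)
      finally have lin: "(\<Sum>i<p. w i * \<beta> i) - (\<Sum>i<p. w i * r i) \<le> (\<Sum>i<p. \<bar>w i\<bar>) / N" .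
      have "bilin {..<p} G a b = bilin {..<p} G r r - bilin {..<p} G \<beta> \<beta>"
        unfolding a_def[abs_def] b_def[abs_def] bilin_add_left bilin_add_right bilin_scale_left
        using bilin_commute[of "{..<p}" G \<beta> r] G_sym by simp
      moreover have "2 * \<bar>bilin {..<p} G a b\<bar> \<le> real N * bilin {..<p} G a a + bilin {..<p} G b b / real N"
        by (rule bilin_AM_GM) (use G_nonneg G_sym N in auto)
      moreover have "real N * bilin {..<p} G a a \<le> C2 * p / N"
      proof -
        have "(\<Sum>i<p. (a i)\<^sup>2) \<le> (\<Sum>i<p. (1 / real N)\<^sup>2)"
          using d by (intro sum_mono) (simp add: a_def abs_le_square_iff[symmetric])
        then have "C2 * (\<Sum>i<p. (a i)\<^sup>2) \<le> C2 * (p * (1 / real N)\<^sup>2)" using C2 by (intro mult_left_mono) auto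
        then have "real N * bilin {..<p} G a a \<le> real N * (C2 * (p * (1 / real N)\<^sup>2))"
          using upper[of a] by (intro mult_left_mono) auto
        also have "\<dots> = C2 * p / N" using N by (simp add: power2_eq_square)
        finally show ?thesis .
      qed
      moreover have "bilin {..<p} G b b / real N \<le> 4 * C2 * p / N"
      proof -
        have "(b i)\<^sup>2 \<le> 4" if "i < p" for i
        proof -
          have "\<bar>\<beta> i\<bar> \<le> 1" using elim that by simp
          then have "\<bar>b i\<bar> \<le> 2" using r1[OF that] unfolding b_def by linarith
          then show ?thesis using abs_le_square_iff[of "b i" 2] by simp
        qed
        then have "(\<Sum>i<p. (b i)\<^sup>2) \<le> (\<Sum>i<p. 4)" by (intro sum_mono) auto
        then have "C2 * (\<Sum>i<p. (b i)\<^sup>2) \<le> C2 * (4 * p)" using C2 by (intro mult_left_mono) auto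
        then have "bilin {..<p} G b b \<le> 4 * C2 * p" using upper[of b] by simp
        then show ?thesis by (rule divide_right_mono) simp
      qed
      moreover have "4 * C2 * p / N = 4 * (C2 * p / N)" "5 / 4 * C2 * p / N = 5 / 4 * (C2 * p / N)" by simp_all
      moreover have "(r' - q) / 2 \<le> 5 / 4 * t" if "y = r' - q" "2 * \<bar>y\<bar> \<le> u + v" "u \<le> t" "v \<le> 4 * t" for y r' q u v t :: real
      proof -
        have "y \<le> \<bar>y\<bar>" by simp
        then have "2 * (r' - q) \<le> t + 4 * t" using that by simp
        then show ?thesis by (simp add: field_simps)
      qed
      ultimately have quad: "(bilin {..<p} G r r - bilin {..<p} G \<beta> \<beta>) / 2 \<le> 5 / 4 * C2 * p / N"
        by metis
      have "quad_energy p G w (\<lambda>i\<in>{..<p}. grid_round N (\<beta> i)) = quad_energy p G w r"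
        by (simp add: quad_energy_def bilin_def r_def cong: sum.cong_simp)
      moreover have "quad_energy p G w \<beta> \<le> (\<Sum>i<p. \<bar>w i\<bar>) / N + 5 / 4 * C2 * p / N + quad_energy p G w r"
        using lin quad by (simp add: quad_energy_def diff_divide_distrib)
      ultimately show ?case by (simp add: ennreal_mult[symmetric] exp_add[symmetric])
    qed
  qed
  also have "\<dots> = ennreal ?e * (\<integral>\<^sup>+\<beta>. ennreal (exp (quad_energy p G w (\<lambda>i\<in>{..<p}. grid_round N (\<beta> i)))) \<partial>?Q)"
    by (rule nn_integral_cmult) (rule measurable_compose[OF rm qm])
  also have "(\<integral>\<^sup>+\<beta>. ennreal (exp (quad_energy p G w (\<lambda>i\<in>{..<p}. grid_round N (\<beta> i)))) \<partial>?Q)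
      = (\<integral>\<^sup>+\<beta>. ennreal (exp (quad_energy p G w \<beta>)) \<partial>distr ?Q B (\<lambda>\<beta>. \<lambda>i\<in>{..<p}. grid_round N (\<beta> i)))"
    using qm by (subst nn_integral_distr[OF rm]) simp_all
  also have "distr ?Q B (\<lambda>\<beta>. \<lambda>i\<in>{..<p}. grid_round N (\<beta> i)) = PiM {..<p} (\<lambda>_. D)"
    unfolding D_def by (rule distr_PiM_components) (auto simp: prob_space_axioms)
  also have "ennreal ?e * (\<integral>\<^sup>+\<beta>. ennreal (exp (quad_energy p G w \<beta>)) \<partial>PiM {..<p} (\<lambda>_. D))
      \<le> ennreal ?e * (ennreal (1 + 1 / N) ^ card {..<p} * L ?\<nu> w)"
    unfolding L_def
  proof (intro mult_left_mono PiM_dominated D)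
    show "prob_space ?\<nu>" "sets ?\<nu> = sets borel" by (simp_all add: \<nu>.prob_space_axioms)
    fix f :: "real \<Rightarrow> ennreal" assume f: "f \<in> borel_measurable borel"
    have "(\<integral>\<^sup>+x. f x \<partial>D) = (\<integral>\<^sup>+b. f (grid_round N b) \<partial>\<mu>)"
      unfolding D_def using f by (intro nn_integral_distr) auto
    then show "(\<integral>\<^sup>+x. f x \<partial>D) \<le> ennreal (1 + 1 / N) * (\<integral>\<^sup>+x. f x \<partial>?\<nu>)"
      using net_dominates[OF N f] by simp
  qed (use qm in auto)
  also have "\<dots> = ennreal (?e * (1 + 1 / N) ^ p) * L ?\<nu> w"
    by (simp add: ennreal_mult ennreal_power[symmetric] mult.assoc del: ennreal_plus)
  finally show ?thesis .
qed

end

section \<open>Concentration of the likelihood ratio\<close>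

text \<open>The minimal Rayleigh value is an eigenvalue and so at least the minimum of the spectrum;
  the upper bound is the same statement for -S.\<close>

lemma rayleigh_bounds:
  assumes S: "S \<in> carrier_mat p p" and p: "0 < p" and sym: "\<And>i j. i < p \<Longrightarrow> j < p \<Longrightarrow> S $$ (i, j) = S $$ (j, i)"
  shows "lambda_min S * (\<Sum>i<p. (t i)\<^sup>2) \<le> bilin {..<p} (\<lambda>i j. S $$ (i, j)) t t"
    and "bilin {..<p} (\<lambda>i j. S $$ (i, j)) t t \<le> lambda_max S * (\<Sum>i<p. (t i)\<^sup>2)"
proof -
  have fin: "finite (spectrum S)" by (rule card_finite_spectrum[OF S])
  have ev: "l \<in> spectrum S" if "\<exists>i<p. x i \<noteq> 0" and "\<And>i. i < p \<Longrightarrow> (\<Sum>j<p. S $$ (i, j) * x j) = l * x i" for l x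
  proof -
    have "eigenvector S (vec p x) l"
      unfolding eigenvector_def
    proof (intro conjI)
      show "vec p x \<in> carrier_vec (dim_row S)" using S by simp
      show "vec p x \<noteq> 0\<^sub>v (dim_row S)" using S that(1) by (auto simp: vec_eq_iff)
      show "S *\<^sub>v vec p x = l \<cdot>\<^sub>v vec p x"
        using S that(2) by (intro eq_vecI) (auto simp: scalar_prod_def lessThan_atLeast0)
    qed
    then show ?thesis by (auto simp: spectrum_def eigenvalue_def)
  qed
  have t0: "0 \<le> (\<Sum>i<p. (t i)\<^sup>2)" by (intro sum_nonneg) auto
  obtain x l where xl: "\<exists>i<p. x i \<noteq> 0" "\<And>i. i < p \<Longrightarrow> (\<Sum>j<p. S $$ (i, j) * x j) = l * x i"
    and ray: "\<And>y. l * (\<Sum>i<p. (y i)\<^sup>2) \<le> bilin {..<p} (\<lambda>i j. S $$ (i, j)) y y"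
  proof (rule symmetric_min_eigenvector[of p "\<lambda>i j. S $$ (i, j)", OF p sym])
    fix x l assume "\<exists>i<p. x i \<noteq> 0" "\<And>i. i < p \<Longrightarrow> (\<Sum>j<p. S $$ (i, j) * x j) = l * x i"
      "\<And>y. l * (\<Sum>i<p. (y i)\<^sup>2) \<le> bilin {..<p} (\<lambda>i j. S $$ (i, j)) y y"
    then show thesis by (rule that)
  qed
  have "lambda_min S \<le> l" unfolding lambda_min_def using fin ev[OF xl] by (rule Min_le)
  then have "lambda_min S * (\<Sum>i<p. (t i)\<^sup>2) \<le> l * (\<Sum>i<p. (t i)\<^sup>2)" using t0 by (rule mult_right_mono)
  then show "lambda_min S * (\<Sum>i<p. (t i)\<^sup>2) \<le> bilin {..<p} (\<lambda>i j. S $$ (i, j)) t t" using ray[of t] by simp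
  have sym': "- S $$ (i, j) = - S $$ (j, i)" if "i < p" "j < p" for i j using sym[OF that] by simp
  obtain x' l' where xl': "\<exists>i<p. x' i \<noteq> 0" "\<And>i. i < p \<Longrightarrow> (\<Sum>j<p. - S $$ (i, j) * x' j) = l' * x' i"
    and ray': "\<And>y. l' * (\<Sum>i<p. (y i)\<^sup>2) \<le> bilin {..<p} (\<lambda>i j. - S $$ (i, j)) y y"
  proof (rule symmetric_min_eigenvector[of p "\<lambda>i j. - S $$ (i, j)", OF p sym'])
    fix x l assume "\<exists>i<p. x i \<noteq> 0" "\<And>i. i < p \<Longrightarrow> (\<Sum>j<p. - S $$ (i, j) * x j) = l * x i"
      "\<And>y. l * (\<Sum>i<p. (y i)\<^sup>2) \<le> bilin {..<p} (\<lambda>i j. - S $$ (i, j)) y y"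
    then show thesis by (rule that)
  qed
  have "(\<Sum>j<p. S $$ (i, j) * x' j) = (- l') * x' i" if "i < p" for i
    using xl'(2)[OF that] by (simp add: sum_negf)
  then have "- l' \<le> lambda_max S" unfolding lambda_max_def using fin ev[OF xl'(1)] by (intro Max_ge) auto
  then have "(- l') * (\<Sum>i<p. (t i)\<^sup>2) \<le> lambda_max S * (\<Sum>i<p. (t i)\<^sup>2)" using t0 by (rule mult_right_mono)
  moreover have "bilin {..<p} (\<lambda>i j. - S $$ (i, j)) t t = - bilin {..<p} (\<lambda>i j. S $$ (i, j)) t t"
    by (simp add: bilin_def sum_negf)
  ultimately show "bilin {..<p} (\<lambda>i j. S $$ (i, j)) t t \<le> lambda_max S * (\<Sum>i<p. (t i)\<^sup>2)" using ray'[of t] by simp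
qed

lemma regression_of_design:
  assumes X: "X \<in> carrier_mat n p" and p: "0 < p" and \<sigma>: "0 < \<sigma>" and C1: "0 < C1" and C2: "1 \<le> C2"
    and lo: "C1 \<le> lambda_min (X\<^sup>T * X) / \<sigma>\<^sup>2" and up: "lambda_max (X\<^sup>T * X) / \<sigma>\<^sup>2 \<le> C2"
  shows "regression n p (\<lambda>k i. X $$ (k, i)) \<sigma> C1 C2"
proof -
  let ?S = "X\<^sup>T * X"
  have S: "?S \<in> carrier_mat p p" using X by simp
  have Sij: "?S $$ (i, j) = (\<Sum>k<n. X $$ (k, i) * X $$ (k, j))" if "i < p" "j < p" for i j
    using X that by (simp add: scalar_prod_def lessThan_atLeast0)
  have sym: "?S $$ (i, j) = ?S $$ (j, i)" if "i < p" "j < p" for i j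
    using that by (simp only: Sij mult.commute)
  have G: "bilin {..<p} (gram_entry n (\<lambda>k i. X $$ (k, i)) \<sigma>) t t = bilin {..<p} (\<lambda>i j. ?S $$ (i, j)) t t / \<sigma>\<^sup>2" for t
  proof -
    have "bilin {..<p} (\<lambda>i j. ?S $$ (i, j)) t t / \<sigma>\<^sup>2 = (\<Sum>i<p. \<Sum>j<p. ?S $$ (i, j) * t i * t j / \<sigma>\<^sup>2)"
      by (simp only: bilin_def sum_divide_distrib)
    also have "\<dots> = (\<Sum>i<p. \<Sum>j<p. (\<Sum>k<n. X $$ (k, i) * X $$ (k, j)) / \<sigma>\<^sup>2 * t i * t j)"
      by (intro sum.cong refl) (simp only: Sij lessThan_iff times_divide_eq_left)
    finally show ?thesis by (simp only: bilin_def gram_entry_def)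
  qed
  have t0: "0 \<le> (\<Sum>i<p. (t i)\<^sup>2)" for t :: "nat \<Rightarrow> real" by (intro sum_nonneg) auto
  show ?thesis
  proof
    fix t :: "nat \<Rightarrow> real"
    have "C1 * (\<Sum>i<p. (t i)\<^sup>2) \<le> lambda_min ?S / \<sigma>\<^sup>2 * (\<Sum>i<p. (t i)\<^sup>2)" using lo t0 by (rule mult_right_mono)
    also have "\<dots> \<le> bilin {..<p} (\<lambda>i j. ?S $$ (i, j)) t t / \<sigma>\<^sup>2"
      using divide_right_mono[OF rayleigh_bounds(1)[OF S p sym, of t], of "\<sigma>\<^sup>2"] by simp
    finally show "C1 * (\<Sum>i<p. (t i)\<^sup>2) \<le> bilin {..<p} (gram_entry n (\<lambda>k i. X $$ (k, i)) \<sigma>) t t" by (simp only: G)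
    have "bilin {..<p} (\<lambda>i j. ?S $$ (i, j)) t t / \<sigma>\<^sup>2 \<le> lambda_max ?S / \<sigma>\<^sup>2 * (\<Sum>i<p. (t i)\<^sup>2)"
      using divide_right_mono[OF rayleigh_bounds(2)[OF S p sym, of t], of "\<sigma>\<^sup>2"] by simp
    also have "\<dots> \<le> C2 * (\<Sum>i<p. (t i)\<^sup>2)" using up t0 by (rule mult_right_mono)
    finally show "bilin {..<p} (gram_entry n (\<lambda>k i. X $$ (k, i)) \<sigma>) t t \<le> C2 * (\<Sum>i<p. (t i)\<^sup>2)" by (simp only: G)
  qed (use \<sigma> C1 C2 in auto)
qed

text \<open>The crude bound 1 + M \<le> exp M yields log-cardinality of order N^3 instead of N log
  N. With N of order p^(1/6) this is p^(1/2), still negligible.\<close>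

lemma card_net_codes_le:
  assumes N: "0 < N" shows "real (card (net_codes N)) \<le> exp (9 * real N ^ 3)"
proof -
  have "real (card (net_codes N)) \<le> real ((net_scale N + 1) ^ (2 * N + 1))"
    using net_codes_card(2)[of N] by (simp only: of_nat_le_iff)
  also have "\<dots> = (1 + real (net_scale N)) ^ (2 * N + 1)" by (simp only: of_nat_power of_nat_add of_nat_1 add.commute[of "real (net_scale N)"])
  also have "\<dots> \<le> exp (real (net_scale N)) ^ (2 * N + 1)" by (intro power_mono exp_ge_add_one_self) simp
  also have "\<dots> = exp (real ((2 * N + 1) * net_scale N))" by (simp only: exp_of_nat_mult of_nat_mult)
  also have "\<dots> \<le> exp (9 * real N ^ 3)"
  proof -
    have "(2 * N + 1) * net_scale N \<le> (3 * N) * (N * (3 * N))"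
      unfolding net_scale_def using N by (intro mult_mono) auto
    also have "\<dots> = 9 * N ^ 3" by (simp add: power3_eq_cube)
    finally have "real ((2 * N + 1) * net_scale N) \<le> real (9 * N ^ 3)" by (simp only: of_nat_le_iff)
    then show ?thesis by simp
  qed
  finally show ?thesis .
qed

section \<open>Exceptional events and their probabilities\<close>

context regression
begin

text \<open>Probability under the prior \<mu> that the statistic lies in E, written in
  change-of-measure form; \<open>joint_law_stat\<close> identifies the two.\<close>

definition pr :: "real measure \<Rightarrow> (nat \<Rightarrow> real) set \<Rightarrow> ennreal" where
  "pr \<mu> E = (\<integral>\<^sup>+e. indicator E (stat e) * L \<mu> (stat e) \<partial>R)"

text \<open>Exponential Markov inequality. Of the constant 2 C2 + 2, the part 2 C2 pays for the
  moment, 1 for 2^p \<le> exp p, and 1 is left as decay.\<close>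

lemma pr_large_stat:
  assumes \<mu>: "unit_distribution \<mu>" and E: "\<And>w. w \<in> E \<Longrightarrow> (2 * C2 + 2) * p \<le> (\<Sum>i<p. \<bar>w i\<bar>)"
  shows "pr \<mu> E \<le> ennreal (exp (- real p))"
proof -
  note [measurable] = L_measurable[OF \<mu>] and [measurable_cong] = sets_gauss_prod
  let ?k = "(2 * C2 + 2) * p"
  have "pr \<mu> E \<le> (\<integral>\<^sup>+e. ennreal (exp (- ?k)) * (ennreal (exp (\<Sum>i<p. \<bar>stat e i\<bar>)) * L \<mu> (stat e)) \<partial>R)"
    unfolding pr_def
  proof (rule nn_integral_mono)
    fix e
    have "indicator E (stat e) \<le> ennreal (exp (- ?k)) * ennreal (exp (\<Sum>i<p. \<bar>stat e i\<bar>))"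
    proof (cases "stat e \<in> E")
      case True
      then have "1 \<le> exp (- ?k + (\<Sum>i<p. \<bar>stat e i\<bar>))" using E[OF True] by simp
      then show ?thesis using True by (simp add: ennreal_mult[symmetric] exp_add[symmetric])
    qed simp
    then show "indicator E (stat e) * L \<mu> (stat e) \<le> ennreal (exp (- ?k)) * (ennreal (exp (\<Sum>i<p. \<bar>stat e i\<bar>)) * L \<mu> (stat e))"
      unfolding mult.assoc[symmetric] by (rule mult_right_mono) simp
  qed
  also have "\<dots> = ennreal (exp (- ?k)) * (\<integral>\<^sup>+e. ennreal (exp (\<Sum>i<p. \<bar>stat e i\<bar>)) * L \<mu> (stat e) \<partial>R)"
    by (rule nn_integral_cmult) measurable
  also have "\<dots> \<le> ennreal (exp (- ?k)) * ennreal (2 ^ p * exp (2 * C2 * p))"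
    by (intro mult_left_mono abs_moment[OF \<mu>]) simp
  also have "\<dots> = ennreal (exp (- ?k) * (2 ^ p * exp (2 * C2 * p)))" by (rule ennreal_mult[symmetric]) simp_all
  also have "\<dots> \<le> ennreal (exp (- real p))"
  proof (rule ennreal_leI)
    have "(2 :: real) \<le> exp 1" using exp_ge_add_one_self[of "1 :: real"] by simp
    then have "(2 :: real) ^ p \<le> exp 1 ^ p" by (intro power_mono) auto
    also have "exp 1 ^ p = exp (real p)" using exp_of_nat_mult[of p "1 :: real"] by simp
    finally have "exp (- ?k) * (2 ^ p * exp (2 * C2 * p)) \<le> exp (- ?k) * (exp (real p) * exp (2 * C2 * p))"
      by (intro mult_left_mono mult_right_mono) auto
    also have "\<dots> = exp (- real p)" by (simp add: exp_add[symmetric] algebra_simps)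
    finally show "exp (- ?k) * (2 ^ p * exp (2 * C2 * p)) \<le> exp (- real p)" .
  qed
  finally show ?thesis .
qed

text \<open>On E the likelihood under \<mu> is at most exp(t/2) times the geometric mean of the two
  likelihoods. The latter integrates to at most the p-th power of the affinity, and 1 - q \<le>
  exp(-q).\<close>

lemma pr_likelihood_ratio:
  assumes \<mu>: "unit_distribution \<mu>" and \<nu>: "unit_distribution \<nu>"
    and E: "\<And>w. w \<in> E \<Longrightarrow> Lr \<mu> w \<le> exp t * Lr \<nu> w"
    and q: "q \<le> 1 - affinity (sqrt (1 / C1)) \<nu> \<mu>"
  shows "pr \<mu> E \<le> ennreal (exp (t / 2 - q * p))"
proof -
  note [measurable] = Lr_measurable[OF \<mu>] Lr_measurable[OF \<nu>] and [measurable_cong] = sets_gauss_prod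
  have s: "0 < sqrt (1 / C1)" using C1 by simp
  define a where "a = affinity (sqrt (1 / C1)) \<nu> \<mu>"
  have a0: "0 \<le> a" unfolding a_def by (rule unit_distribution.affinity_bounds[OF \<nu> s \<mu>])
  have "pr \<mu> E \<le> (\<integral>\<^sup>+e. ennreal (exp (t / 2)) * ennreal (sqrt (Lr \<nu> (stat e) * Lr \<mu> (stat e))) \<partial>R)"
    unfolding pr_def
  proof (rule nn_integral_mono)
    fix e
    let ?w = "stat e"
    show "indicator E ?w * L \<mu> ?w \<le> ennreal (exp (t / 2)) * ennreal (sqrt (Lr \<nu> ?w * Lr \<mu> ?w))"
    proof (cases "?w \<in> E")
      case True
      have m0: "0 < Lr \<mu> ?w" by (rule Lr_pos[OF \<mu>])
      have "Lr \<mu> ?w = sqrt (Lr \<mu> ?w) * sqrt (Lr \<mu> ?w)" using m0 by simp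
      also have "\<dots> \<le> sqrt (exp t * Lr \<nu> ?w) * sqrt (Lr \<mu> ?w)"
        using E[OF True] m0 by (intro mult_right_mono) auto
      also have "\<dots> = exp (t / 2) * sqrt (Lr \<nu> ?w * Lr \<mu> ?w)"
      proof -
        have "sqrt (exp t) = exp (t / 2)" by (rule real_sqrt_unique) (simp_all add: power2_eq_square flip: exp_add)
        then show ?thesis by (simp add: real_sqrt_mult)
      qed
      finally have "L \<mu> ?w \<le> ennreal (exp (t / 2) * sqrt (Lr \<nu> ?w * Lr \<mu> ?w))"
        unfolding L_eq[OF \<mu>] by (rule ennreal_leI)
      also have "\<dots> = ennreal (exp (t / 2)) * ennreal (sqrt (Lr \<nu> ?w * Lr \<mu> ?w))"
        using Lr_pos[OF \<nu>, of ?w] m0 by (intro ennreal_mult) auto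
      finally show ?thesis using True by simp
    qed simp
  qed
  also have "\<dots> = ennreal (exp (t / 2)) * (\<integral>\<^sup>+e. ennreal (sqrt (Lr \<nu> (stat e) * Lr \<mu> (stat e))) \<partial>R)"
    by (rule nn_integral_cmult) measurable
  also have "\<dots> \<le> ennreal (exp (t / 2)) * ennreal (a ^ p)"
    unfolding a_def by (intro mult_left_mono affinity_tensorizes[OF \<nu> \<mu>]) simp
  also have "\<dots> = ennreal (exp (t / 2) * a ^ p)" using a0 by (intro ennreal_mult[symmetric]) auto
  also have "\<dots> \<le> ennreal (exp (t / 2 - q * p))"
  proof (rule ennreal_leI)
    have "1 + (- q) \<le> exp (- q)" by (rule exp_ge_add_one_self)
    then have "a ^ p \<le> exp (- q) ^ p" using q a0 by (intro power_mono) (auto simp: a_def)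
    also have "\<dots> = exp (- q * p)" by (simp add: exp_of_nat_mult[symmetric] mult.commute)
    finally have "exp (t / 2) * a ^ p \<le> exp (t / 2) * exp (- q * p)" by (intro mult_left_mono) auto
    then show "exp (t / 2) * a ^ p \<le> exp (t / 2 - q * p)" by (simp add: exp_add[symmetric])
  qed
  finally show ?thesis .
qed

definition bad_large :: "(nat \<Rightarrow> real) set" where
  "bad_large = {w \<in> space B. (2 * C2 + 2) * p \<le> (\<Sum>i<p. \<bar>w i\<bar>)}"

text \<open>A finite union over net priors that are far from the truth yet nearly as likely:
  measurable, and independent of the estimator.\<close>

definition bad_net :: "real measure \<Rightarrow> nat \<Rightarrow> real \<Rightarrow> real \<Rightarrow> (nat \<Rightarrow> real) set" where
  "bad_net \<mu> N t q = (\<Union>k\<in>{k \<in> net_codes N. q \<le> 1 - affinity (sqrt (1 / C1)) (net_measure N k) \<mu>}.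
     {w \<in> space B. Lr \<mu> w \<le> exp t * Lr (net_measure N k) w})"

lemma bad_sets:
  assumes \<mu>: "unit_distribution \<mu>" and N: "0 < N"
  shows "bad_large \<in> sets B" "bad_net \<mu> N t q \<in> sets B"
proof -
  show "bad_large \<in> sets B" unfolding bad_large_def by measurable
  show "bad_net \<mu> N t q \<in> sets B"
    unfolding bad_net_def
  proof (intro sets.finite_UN)
    show "finite {k \<in> net_codes N. q \<le> 1 - affinity (sqrt (1 / C1)) (net_measure N k) \<mu>}"
      using net_codes_card(1)[of N] by simp
    fix k assume "k \<in> {k \<in> net_codes N. q \<le> 1 - affinity (sqrt (1 / C1)) (net_measure N k) \<mu>}"
    then have k: "unit_distribution (net_measure N k)" using N by (intro unit_distribution_net) auto
    note [measurable] = Lr_measurable[OF \<mu>] Lr_measurable[OF k]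
    show "{w \<in> space B. Lr \<mu> w \<le> exp t * Lr (net_measure N k) w} \<in> sets B" by measurable
  qed
qed

lemma pr_bad_net:
  assumes \<mu>: "unit_distribution \<mu>" and N: "0 < N"
  shows "pr \<mu> (bad_net \<mu> N t q) \<le> ennreal (exp (9 * real N ^ 3 + t / 2 - q * p))"
proof -
  let ?K = "{k \<in> net_codes N. q \<le> 1 - affinity (sqrt (1 / C1)) (net_measure N k) \<mu>}"
  let ?E = "\<lambda>k. {w \<in> space B. Lr \<mu> w \<le> exp t * Lr (net_measure N k) w}"
  note [measurable] = L_measurable[OF \<mu>] Lr_measurable[OF \<mu>] and [measurable_cong] = sets_gauss_prod
  have fin: "finite ?K" using net_codes_card(1)[of N] by simp
  have unit: "unit_distribution (net_measure N k)" if "k \<in> ?K" for k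
    using that N by (intro unit_distribution_net) auto
  have "pr \<mu> (bad_net \<mu> N t q) \<le> (\<integral>\<^sup>+e. (\<Sum>k\<in>?K. indicator (?E k) (stat e) * L \<mu> (stat e)) \<partial>R)"
    unfolding pr_def
  proof (rule nn_integral_mono)
    fix e
    have "indicator (bad_net \<mu> N t q) (stat e) \<le> (\<Sum>k\<in>?K. indicator (?E k) (stat e) :: ennreal)"
    proof (cases "stat e \<in> bad_net \<mu> N t q")
      case True
      then obtain k where k: "k \<in> ?K" "stat e \<in> ?E k" by (auto simp: bad_net_def)
      have "(1 :: ennreal) = indicator (?E k) (stat e)" using k(2) by simp
      also have "\<dots> \<le> (\<Sum>k\<in>?K. indicator (?E k) (stat e))" using k(1) fin by (intro member_le_sum) auto
      finally show ?thesis using True by simp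
    qed simp
    then show "indicator (bad_net \<mu> N t q) (stat e) * L \<mu> (stat e) \<le> (\<Sum>k\<in>?K. indicator (?E k) (stat e) * L \<mu> (stat e))"
      unfolding sum_distrib_right[symmetric] by (rule mult_right_mono) simp
  qed
  also have "\<dots> = (\<Sum>k\<in>?K. pr \<mu> (?E k))"
    unfolding pr_def
  proof (rule nn_integral_sum)
    fix k assume "k \<in> ?K"
    note [measurable] = Lr_measurable[OF unit[OF this]]
    have [measurable]: "?E k \<in> sets B" by measurable
    show "(\<lambda>e. indicator (?E k) (stat e) * L \<mu> (stat e)) \<in> borel_measurable R" by measurable
  qed
  also have "\<dots> \<le> (\<Sum>k\<in>?K. ennreal (exp (t / 2 - q * p)))"
    by (intro sum_mono pr_likelihood_ratio[OF \<mu> unit]) auto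
  also have "\<dots> = ennreal (\<Sum>k\<in>?K. exp (t / 2 - q * p))" by (rule sum_ennreal) simp
  also have "\<dots> \<le> ennreal (exp (9 * real N ^ 3 + t / 2 - q * p))"
  proof (rule ennreal_leI)
    have "real (card ?K) \<le> real (card (net_codes N))" using net_codes_card(1)[of N] by (simp add: card_mono)
    also have "\<dots> \<le> exp (9 * real N ^ 3)" by (rule card_net_codes_le[OF N])
    finally have "real (card ?K) * exp (t / 2 - q * p) \<le> exp (9 * real N ^ 3) * exp (t / 2 - q * p)"
      by (intro mult_right_mono) auto
    then show "(\<Sum>k\<in>?K. exp (t / 2 - q * p)) \<le> exp (9 * real N ^ 3 + t / 2 - q * p)"
      by (simp add: exp_add[symmetric] algebra_simps)
  qed
  finally show ?thesis .
qed

text \<open>The deterministic core: a far near-maximizer hands both its likelihood and its distance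
  to its net code. The threshold q = h/2 - 2/N solves h = 2 (2/N) + 2 q, the two terms of the
  triangle inequality.\<close>

lemma maximizer_in_bad:
  assumes \<mu>s: "unit_distribution \<mu>s" and \<mu>: "unit_distribution \<mu>" and N: "0 < N" and C1': "C1 \<le> 1"
    and w: "w \<in> space B" "w \<notin> bad_large"
    and near_max: "Lr \<mu>s w \<le> exp t0 * Lr \<mu> w"
    and far: "h < 1 - affinity (sqrt (1 / C1)) \<mu> \<mu>s"
  shows "w \<in> bad_net \<mu>s N (t0 + (13 / 4 * C2 + 3) * p / N) (h / 2 - 2 / N)"
proof -
  let ?k = "grid_code N \<mu>" and ?s = "sqrt (1 / C1)"
  let ?\<nu> = "net_measure N ?k"
  have s: "1 \<le> ?s" using C1 C1' by simp
  have s0: "0 < ?s" using s by linarith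
  have k: "?k \<in> net_codes N" by (rule unit_distribution.grid_code_in_net[OF \<mu> N])
  have \<nu>: "unit_distribution ?\<nu>" by (rule unit_distribution_net[OF N k])
  have "1 - affinity ?s \<mu> \<mu>s \<le> 2 * (1 - affinity ?s \<mu> ?\<nu>) + 2 * (1 - affinity ?s ?\<nu> \<mu>s)"
    by (rule unit_distribution.affinity_triangle[OF \<mu> s0 \<nu> \<mu>s])
  moreover have "1 - 2 / N \<le> affinity ?s \<mu> ?\<nu>" by (rule unit_distribution.affinity_net[OF \<mu> s N])
  ultimately have q: "h / 2 - 2 / N \<le> 1 - affinity ?s ?\<nu> \<mu>s" using far by (simp add: field_simps)
  have w1: "(\<Sum>i<p. \<bar>w i\<bar>) \<le> (2 * C2 + 2) * p" using w by (auto simp: bad_large_def)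
  let ?x = "(\<Sum>i<p. \<bar>w i\<bar>) / N + 5 / 4 * C2 * p / N"
  have "ennreal (Lr \<mu> w) \<le> ennreal (exp ?x * (1 + 1 / N) ^ p) * ennreal (Lr ?\<nu> w)"
    using L_le_net[OF \<mu> N, of w] by (simp only: L_eq[OF \<mu>] L_eq[OF \<nu>])
  also have "\<dots> = ennreal (exp ?x * (1 + 1 / N) ^ p * Lr ?\<nu> w)"
    using Lr_pos[OF \<nu>, of w] by (intro ennreal_mult[symmetric]) auto
  finally have "Lr \<mu> w \<le> exp ?x * (1 + 1 / N) ^ p * Lr ?\<nu> w"
    using Lr_pos[OF \<nu>, of w] by (subst (asm) ennreal_le_iff) auto
  also have "\<dots> \<le> exp ((13 / 4 * C2 + 3) * p / N) * Lr ?\<nu> w"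
  proof (rule mult_right_mono)
    have "(1 + 1 / N) ^ p \<le> exp (1 / N) ^ p" by (intro power_mono exp_ge_add_one_self) simp
    also have "\<dots> = exp (p / N)" by (simp add: exp_of_nat_mult[symmetric])
    finally have "exp ?x * (1 + 1 / N) ^ p \<le> exp ?x * exp (p / N)" by (intro mult_left_mono) auto
    also have "\<dots> = exp (?x + p / N)" by (simp only: exp_add)
    \<comment> \<open>13/4 C2 + 3 collects 2 C2 + 2 from the bound on the statistic, 5/4 C2 from
      rounding the quadratic form and 1 from the domination factor.\<close>
    also have "\<dots> \<le> exp ((13 / 4 * C2 + 3) * p / N)"
    proof -
      have "(\<Sum>i<p. \<bar>w i\<bar>) / N \<le> (2 * C2 + 2) * p / N" using w1 by (rule divide_right_mono) simp
      then have "?x + p / N \<le> (2 * C2 + 2) * p / N + 5 / 4 * C2 * p / N + p / N" by simp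
      also have "\<dots> = (13 / 4 * C2 + 3) * p / N" using N by (simp add: field_simps)
      finally show ?thesis by simp
    qed
    finally show "exp ?x * (1 + 1 / N) ^ p \<le> exp ((13 / 4 * C2 + 3) * p / N)" .
  qed (use Lr_pos[OF \<nu>, of w] in simp)
  finally have "exp t0 * Lr \<mu> w \<le> exp t0 * (exp ((13 / 4 * C2 + 3) * p / N) * Lr ?\<nu> w)" by (rule mult_left_mono) simp
  with near_max have "Lr \<mu>s w \<le> exp t0 * (exp ((13 / 4 * C2 + 3) * p / N) * Lr ?\<nu> w)" by (rule order_trans)
  then have "Lr \<mu>s w \<le> exp (t0 + (13 / 4 * C2 + 3) * p / N) * Lr ?\<nu> w" by (simp only: exp_add mult.assoc)
  then show ?thesis using k q w by (auto simp: bad_net_def)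
qed

end

section \<open>Rate of convergence\<close>

locale regression_design = regression n p "\<lambda>k i. X $$ (k, i)" \<sigma> C1 C2
  for n p and X :: "real mat" and \<sigma> C1 C2 +
  assumes X: "X \<in> carrier_mat n p"
begin

text \<open>The diagonal of the Gram matrix becomes the quadratic part of the prior tilts, which
  leaves the zero-diagonal coupling.\<close>

lemma energy_split:
  "quad_energy p G w \<beta> = quad_energy p (offdiag_coeff \<sigma> X) w \<beta> - (\<Sum>i<p. diag_coeff \<sigma> X i / 2 * (\<beta> i)\<^sup>2)"
proof -
  have "(\<Sum>j<p. G i j * \<beta> i * \<beta> j) = (\<Sum>j<p. offdiag_coeff \<sigma> X i j * \<beta> i * \<beta> j) + diag_coeff \<sigma> X i * (\<beta> i)\<^sup>2" if i: "i < p" for i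
  proof -
    have "(\<Sum>j<p. G i j * \<beta> i * \<beta> j) = (\<Sum>j<p. offdiag_coeff \<sigma> X i j * \<beta> i * \<beta> j + (if i = j then diag_coeff \<sigma> X i * (\<beta> i)\<^sup>2 else 0))"
    proof (intro sum.cong refl)
      fix j assume "j \<in> {..<p}"
      then have "G i j = gram_coeff \<sigma> X i j" using i by (simp add: gram_entry_def gram_coeff_eq[OF X])
      moreover have "diag_coeff \<sigma> X i = gram_coeff \<sigma> X i i" by (simp only: diag_coeff_def gram_coeff_def)
      ultimately show "G i j * \<beta> i * \<beta> j = offdiag_coeff \<sigma> X i j * \<beta> i * \<beta> j + (if i = j then diag_coeff \<sigma> X i * (\<beta> i)\<^sup>2 else 0)"
        by (cases "i = j") (simp_all add: offdiag_coeff_def power2_eq_square)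
    qed
    then show ?thesis using i by (simp add: sum.distrib)
  qed
  then have "bilin {..<p} G \<beta> \<beta> = bilin {..<p} (offdiag_coeff \<sigma> X) \<beta> \<beta> + (\<Sum>i<p. diag_coeff \<sigma> X i * (\<beta> i)\<^sup>2)"
    by (simp add: bilin_def sum.distrib)
  then show ?thesis by (simp add: quad_energy_def add_divide_distrib sum_divide_distrib)
qed

lemma suff_stat_eq:
  assumes "i < p" shows "suff_stat \<sigma> X (vec n y) $ i = stat y i"
  using assms X by (simp add: suff_stat_def stat_def scalar_prod_def lessThan_atLeast0)

lemma suff_stat_carrier: "suff_stat \<sigma> X (vec n y) \<in> carrier_vec p"
  by (rule carrier_vecI) (use X in \<open>simp add: suff_stat_def\<close>)

text \<open>Adding the cumulants undoes the normalization of the tilted priors. This is the reason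
  for the shifted objective: it approximates the log-likelihood itself, which is comparable across
  priors.\<close>

lemma partition_fun_likelihood:
  assumes \<mu>: "\<mu> \<in> unit_priors"
  shows "ln (partition_fun \<sigma> X (suff_stat \<sigma> X (vec n y)) \<mu>) + (\<Sum>i<p. cumulant \<mu> 0 (diag_coeff \<sigma> X i)) = ln (Lr \<mu> (stat y))"
proof -
  interpret unit_distribution \<mu> by (rule unit_distribution_prior[OF \<mu>])
  let ?d = "diag_coeff \<sigma> X" and ?Q = "PiM {..<p} (\<lambda>_. \<mu>)" and ?w = "suff_stat \<sigma> X (vec n y)"
  define h where "h i b = exp (0 * b - ?d i / 2 * b\<^sup>2 - cumulant \<mu> 0 (?d i))" for i b
  have hm[measurable]: "h i \<in> borel_measurable borel" for i unfolding h_def[abs_def] by measurable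
  note sets_Q[OF unit_distribution_axioms, measurable_cong]
  have qm[measurable]: "(\<lambda>\<beta>. quad_energy p A v \<beta>) \<in> borel_measurable ?Q" for A v
    unfolding quad_energy_def bilin_def by measurable
  have t: "tilted \<mu> 0 (?d i) = density \<mu> (\<lambda>b. ennreal (h i b))" for i by (simp add: tilted_def h_def)
  have "PiM {..<p} (\<lambda>i. tilted \<mu> 0 (?d i)) = density ?Q (\<lambda>\<beta>. \<Prod>i<p. ennreal (h i (\<beta> i)))"
    unfolding t
  proof (rule PiM_density)
    show "sigma_finite_measure (density \<mu> (\<lambda>b. ennreal (h i b)))" for i
      unfolding t[symmetric] using unit_distribution_tilted[of 0 "?d i"]
      by (simp add: unit_distribution_def prob_space_imp_sigma_finite)
  qed (auto simp: sigma_finite_measure_axioms)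
  also have "(\<lambda>\<beta>. \<Prod>i<p. ennreal (h i (\<beta> i))) = (\<lambda>\<beta>. ennreal (\<Prod>i<p. h i (\<beta> i)))"
    by (simp add: prod_ennreal h_def)
  finally have PiM: "PiM {..<p} (\<lambda>i. tilted \<mu> 0 (?d i)) = density ?Q (\<lambda>\<beta>. ennreal (\<Prod>i<p. h i (\<beta> i)))" .
  have hp: "(\<Prod>i<p. h i (\<beta> i)) * exp (quad_energy p (offdiag_coeff \<sigma> X) (($) ?w) \<beta>)
      = exp (- (\<Sum>i<p. cumulant \<mu> 0 (?d i))) * exp (quad_energy p G (stat y) \<beta>)" for \<beta>
  proof -
    have "(\<Prod>i<p. h i (\<beta> i)) = exp (- (\<Sum>i<p. ?d i / 2 * (\<beta> i)\<^sup>2) - (\<Sum>i<p. cumulant \<mu> 0 (?d i)))"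
      by (simp add: h_def exp_sum[symmetric] sum_subtractf sum_negf)
    moreover have "quad_energy p (offdiag_coeff \<sigma> X) (($) ?w) \<beta> = quad_energy p (offdiag_coeff \<sigma> X) (stat y) \<beta>"
      by (simp add: quad_energy_def suff_stat_eq cong: sum.cong_simp)
    ultimately show ?thesis unfolding energy_split by (simp add: exp_add[symmetric])
  qed
  have "partition_fun \<sigma> X ?w \<mu> = (\<integral>\<beta>. (\<Prod>i<p. h i (\<beta> i)) * exp (quad_energy p (offdiag_coeff \<sigma> X) (($) ?w) \<beta>) \<partial>?Q)"
    unfolding partition_fun_eq[OF X suff_stat_carrier] PiM
  proof (subst integral_density)
    show "AE \<beta> in ?Q. 0 \<le> (\<Prod>i<p. h i (\<beta> i))" by (auto simp: h_def intro!: prod_nonneg)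
    show "(\<lambda>\<beta>. exp (quad_energy p (offdiag_coeff \<sigma> X) (($) ?w) \<beta>)) \<in> borel_measurable ?Q" by measurable
    show "(\<lambda>\<beta>. \<Prod>i<p. h i (\<beta> i)) \<in> borel_measurable ?Q" by measurable
  qed simp
  also have "\<dots> = exp (- (\<Sum>i<p. cumulant \<mu> 0 (?d i))) * (\<integral>\<beta>. exp (quad_energy p G (stat y) \<beta>) \<partial>?Q)"
    unfolding hp by simp
  also have "(\<integral>\<beta>. exp (quad_energy p G (stat y) \<beta>) \<partial>?Q) = Lr \<mu> (stat y)"
    unfolding Lr_def L_def
    by (rule integral_eq_nn_integral[OF measurable_compose[OF qm borel_measurable_exp]]) simp
  finally show ?thesis using Lr_pos[OF unit_distribution_axioms, of "stat y"] by (simp add: ln_mult)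
qed

lemma mf_shifted_approximation:
  assumes \<mu>: "\<mu> \<in> unit_priors"
  obtains S where "(SUP \<gamma>\<in>carrier_vec p. ereal (mf_objective_shifted \<sigma> X \<gamma> (suff_stat \<sigma> X (vec n y)) \<mu>)) = ereal S"
    and "S \<le> ln (Lr \<mu> (stat y))"
    and "ln (Lr \<mu> (stat y)) \<le> S + 7 * real p powr (2/3) * mat_trace (coupling \<sigma> X * coupling \<sigma> X) powr (1/3)"
proof -
  let ?w = "suff_stat \<sigma> X (vec n y)" and ?c = "\<Sum>i<p. cumulant \<mu> 0 (diag_coeff \<sigma> X i)"
  obtain S where S: "(SUP \<gamma>\<in>carrier_vec p. ereal (mf_objective \<sigma> X \<gamma> ?w \<mu>)) = ereal S"
    "S \<le> ln (partition_fun \<sigma> X ?w \<mu>)"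
    "ln (partition_fun \<sigma> X ?w \<mu>) \<le> S + 7 * real p powr (2/3) * mat_trace (coupling \<sigma> X * coupling \<sigma> X) powr (1/3)"
    using mf_approximation[OF X suff_stat_carrier \<mu>] by metis
  have "carrier_vec p \<noteq> ({} :: real vec set)" using zero_carrier_vec[of p] by blast
  then have "(SUP \<gamma>\<in>carrier_vec p. ereal (mf_objective \<sigma> X \<gamma> ?w \<mu>) + ereal ?c) = ereal S + ereal ?c"
    unfolding S(1)[symmetric] by (rule SUP_ereal_add_left) simp
  then have "(SUP \<gamma>\<in>carrier_vec p. ereal (mf_objective_shifted \<sigma> X \<gamma> ?w \<mu>)) = ereal (S + ?c)"
    using X by (simp add: mf_objective_shifted_def)
  then show thesis
    using S(2,3) partition_fun_likelihood[OF \<mu>, of y] by (intro that[of "S + ?c"]) simp_all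
qed

text \<open>Integrating over the noise first, with \<beta> fixed, puts the event in the form of
  \<open>change_of_measure\<close>.\<close>

lemma joint_law_stat:
  assumes \<mu>: "\<mu> \<in> unit_priors" and E[measurable]: "E \<in> sets B"
  shows "{\<omega> \<in> space (joint_law \<sigma> X \<mu>). stat (fst \<omega>) \<in> E} \<in> sets (joint_law \<sigma> X \<mu>)"
    and "emeasure (joint_law \<sigma> X \<mu>) {\<omega> \<in> space (joint_law \<sigma> X \<mu>). stat (fst \<omega>) \<in> E} = pr \<mu> E"
proof -
  interpret unit_distribution \<mu> by (rule unit_distribution_prior[OF \<mu>])
  let ?Q = "PiM {..<p} (\<lambda>_. \<mu>)"
  interpret Q: prob_space ?Q using unit_distribution_axioms by (rule prob_Q)
  interpret R: prob_space R by (rule prob_R)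
  interpret pair_sigma_finite R ?Q ..
  note sets_Q[OF unit_distribution_axioms, measurable_cong] sets_gauss_prod[measurable_cong]
  let ?T = "PiM {..<n} (\<lambda>_. borel :: real measure) \<Otimes>\<^sub>M B"
  define \<phi> where "\<phi> z = (\<lambda>k\<in>{..<n}. signal (snd z) k + fst z k, snd z)" for z :: "(nat \<Rightarrow> real) \<times> (nat \<Rightarrow> real)"
  have J: "joint_law \<sigma> X \<mu> = distr (R \<Otimes>\<^sub>M ?Q) ?T \<phi>"
  proof -
    have "(\<lambda>(e, \<beta>). (\<lambda>k\<in>{..<n}. (X *\<^sub>v vec p \<beta>) $ k + e k, \<beta>)) = \<phi>"
      using X by (auto simp: \<phi>_def fun_eq_iff signal_def scalar_prod_def lessThan_atLeast0)
    then show ?thesis using X by (simp add: joint_law_def)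
  qed
  have \<phi>[measurable]: "\<phi> \<in> measurable (R \<Otimes>\<^sub>M ?Q) ?T"
    unfolding \<phi>_def[abs_def] signal_def by measurable
  define A where "A = {\<omega> \<in> space (joint_law \<sigma> X \<mu>). stat (fst \<omega>) \<in> E}"
  have sp: "space (joint_law \<sigma> X \<mu>) = space ?T" by (simp add: J)
  have A[measurable]: "A \<in> sets ?T" unfolding A_def sp by measurable
  then show "{\<omega> \<in> space (joint_law \<sigma> X \<mu>). stat (fst \<omega>) \<in> E} \<in> sets (joint_law \<sigma> X \<mu>)"
    by (simp add: A_def[symmetric] J)
  have "emeasure (joint_law \<sigma> X \<mu>) A = (\<integral>\<^sup>+\<omega>. indicator A \<omega> \<partial>joint_law \<sigma> X \<mu>)"
    using A by (intro nn_integral_indicator[symmetric]) (simp add: J)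
  also have "\<dots> = (\<integral>\<^sup>+z. indicator A (\<phi> z) \<partial>(R \<Otimes>\<^sub>M ?Q))"
    unfolding J by (rule nn_integral_distr) measurable
  also have "\<dots> = (\<integral>\<^sup>+\<beta>. \<integral>\<^sup>+e. indicator A (\<phi> (e, \<beta>)) \<partial>R \<partial>?Q)"
    by (rule nn_integral_snd[symmetric]) measurable
  also have "\<dots> = (\<integral>\<^sup>+\<beta>. \<integral>\<^sup>+e. indicator E (stat (\<lambda>k\<in>{..<n}. signal \<beta> k + e k)) \<partial>R \<partial>?Q)"
  proof (intro nn_integral_cong)
    fix \<beta> e assume "\<beta> \<in> space ?Q" "e \<in> space R"
    then have "(e, \<beta>) \<in> space (R \<Otimes>\<^sub>M ?Q)" by (simp add: space_pair_measure)
    then have "\<phi> (e, \<beta>) \<in> space ?T" by (rule measurable_space[OF \<phi>])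
    then show "indicator A (\<phi> (e, \<beta>)) = (indicator E (stat (\<lambda>k\<in>{..<n}. signal \<beta> k + e k)) :: ennreal)"
      by (simp add: A_def sp indicator_def) (simp add: \<phi>_def)
  qed
  also have "\<dots> = pr \<mu> E"
    unfolding pr_def by (rule change_of_measure[OF unit_distribution_axioms]) measurable
  finally show "emeasure (joint_law \<sigma> X \<mu>) {\<omega> \<in> space (joint_law \<sigma> X \<mu>). stat (fst \<omega>) \<in> E} = pr \<mu> E"
    by (simp add: A_def)
qed

text \<open>In terms of \<open>a = p powr (1/6)\<close> all terms of the exponent are multiples of \<open>a^5\<close> and \<open>a^4 y\<close>.\<close>

lemma exponent_bound:
  fixes a y N :: real
  assumes a: "1 \<le> a" and y: "0 \<le> y" and N: "a \<le> N" "N \<le> 2 * a" and C2: "0 \<le> C2"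
  shows "9 * N ^ 3 + (a ^ 5 + 7 * (a ^ 4 * y) + (13 / 4 * C2 + 3) * a ^ 6 / N) / 2
       - ((167 + 4 * C2) * (1 / a + y / a\<^sup>2) / 2 - 2 / N) * a ^ 6 \<le> - (a ^ 4)"
proof -
  have a0: "0 < a" and N0: "0 < N" using a N by auto
  have "N ^ 3 \<le> (2 * a) ^ 3" using N N0 by (intro power_mono) auto
  also have "\<dots> = 8 * (a ^ 3 * 1)" by (simp add: power_mult_distrib)
  also have "\<dots> \<le> 8 * (a ^ 3 * a\<^sup>2)" using a by (intro mult_left_mono) (auto simp: one_le_power)
  also have "\<dots> = 8 * a ^ 5" by (simp add: power_add[symmetric])
  finally have 1: "9 * N ^ 3 \<le> 72 * a ^ 5" by simp
  define z where "z = a ^ 6 / N"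
  have "a ^ 6 / N \<le> a ^ 6 / a" using N a0 N0 by (intro divide_left_mono) auto
  also have "\<dots> = a ^ 5" using a0 by (simp add: power_eq_if field_simps)
  finally have 2: "z \<le> a ^ 5" by (simp only: z_def)
  then have 3: "C2 * z \<le> C2 * a ^ 5" using C2 by (rule mult_left_mono)
  have e1: "(13 / 4 * C2 + 3) * a ^ 6 / N = 13 / 4 * (C2 * z) + 3 * z"
    by (simp add: z_def add_divide_distrib distrib_right)
  have e2: "((167 + 4 * C2) * (1 / a + y / a\<^sup>2) / 2 - 2 / N) * a ^ 6
      = 167 / 2 * a ^ 5 + 2 * (C2 * a ^ 5) + 167 / 2 * (a ^ 4 * y) + 2 * (C2 * (a ^ 4 * y)) - 2 * z"
  proof -
    have i: "a ^ 6 * (1 / a) = a ^ 5" "a ^ 6 * (y / a\<^sup>2) = a ^ 4 * y" using a0 by (simp_all add: power_eq_if field_simps)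
    have "((167 + 4 * C2) * (1 / a + y / a\<^sup>2) / 2 - 2 / N) * a ^ 6
       = (167 + 4 * C2) / 2 * (a ^ 6 * (1 / a) + a ^ 6 * (y / a\<^sup>2)) - 2 * z"
      unfolding z_def by (simp add: algebra_simps add_divide_distrib)
    then show ?thesis unfolding i by (simp add: algebra_simps add_divide_distrib)
  qed
  have 4: "0 \<le> a ^ 4 * y" "0 \<le> C2 * (a ^ 4 * y)" "0 \<le> C2 * a ^ 5" using a0 y C2 by auto
  have 5: "a ^ 4 \<le> a ^ 5" using a by (intro power_increasing) auto
  have 6: "0 \<le> a ^ 5" using a0 by simp
  \<comment> \<open>Origin of 167 + 4 C2, with room to spare: the a^5 terms need 72 + 1/2 + 3/2 + 2
    + 1 = 77 out of 167/2, the C2 terms 13/8 out of 2, and the a^4 y terms 7/2 out of 167/2.\<close>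
  have lin: "9 * n3 + (a5 + 7 * b + (13 / 4 * c + 3 * z')) / 2 - (167 / 2 * a5 + 2 * d + 167 / 2 * b + 2 * e - 2 * z') \<le> - a4"
    if "9 * n3 \<le> 72 * a5" "z' \<le> a5" "c \<le> d" "0 \<le> b" "0 \<le> e" "0 \<le> d" "a4 \<le> a5" "0 \<le> a5"
    for n3 a5 b c z' d e a4 :: real using that by argo
  show ?thesis unfolding e1 e2 by (rule lin) (use 1 2 3 4 5 6 in auto)
qed

text \<open>The estimator is an arbitrary function of the sample point, so its event need not be
  measurable. It is enclosed in the union of a null set and two measurable events for the statistic,
  and outer measure is monotone.\<close>

lemma hellinger_rate:
  assumes p: "0 < p" and C1': "C1 \<le> 1"
    and P: "P \<subseteq> unit_priors" and \<mu>s: "\<mu>s \<in> P"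
    and hat: "\<And>\<omega>. \<omega> \<in> space (joint_law \<sigma> X \<mu>s) \<Longrightarrow> \<mu>hat \<omega> \<in> P"
    and max: "\<And>\<omega>. \<omega> \<in> space (joint_law \<sigma> X \<mu>s) \<Longrightarrow>
      (SUP \<mu>\<in>P. SUP \<gamma>\<in>carrier_vec p. ereal (mf_objective_shifted \<sigma> X \<gamma> (suff_stat \<sigma> X (vec n (fst \<omega>))) \<mu>))
       \<le> (SUP \<gamma>\<in>carrier_vec p. ereal (mf_objective_shifted \<sigma> X \<gamma> (suff_stat \<sigma> X (vec n (fst \<omega>))) (\<mu>hat \<omega>))) + ereal (\<epsilon> \<omega>)"
    and eps: "AE \<omega> in joint_law \<sigma> X \<mu>s. \<epsilon> \<omega> \<le> real p powr (5/6)"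
  shows "outer_measure_of (joint_law \<sigma> X \<mu>s)
     {\<omega> \<in> space (joint_law \<sigma> X \<mu>s).
        (hellinger_dist lborel (\<mu>hat \<omega> \<star> gauss (sqrt (1 / C1))) (\<mu>s \<star> gauss (sqrt (1 / C1))))\<^sup>2
        > (167 + 4 * C2) * (1 / real p powr (1/6) + mat_trace (coupling \<sigma> X * coupling \<sigma> X) powr (1/3) / real p powr (1/3))}
     \<le> ennreal (2 * exp (- (real p powr (2/3)) / 2))"
proof -
  let ?J = "joint_law \<sigma> X \<mu>s" and ?s = "sqrt (1 / C1)"
  define a where "a = real p powr (1/6)"
  define y where "y = mat_trace (coupling \<sigma> X * coupling \<sigma> X) powr (1/3)"
  \<comment> \<open>Rounding up at most doubles \<open>a\<close>, because a \<ge> 1.\<close>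
  define N where "N = nat \<lceil>a\<rceil>"
  have a: "1 \<le> a" using p by (simp add: a_def ge_one_powr_ge_zero)
  have y: "0 \<le> y" by (simp add: y_def)
  have pw: "real p powr (real k / 6) = a ^ k" for k
    using p by (simp add: a_def powr_realpow[symmetric] powr_powr)
  have pows: "real p powr (5/6) = a ^ 5" "real p powr (2/3) = a ^ 4" "real p powr (1/3) = a\<^sup>2" "real p = a ^ 6"
    using pw[of 5] pw[of 4] pw[of 2] pw[of 6] p by simp_all
  have N: "a \<le> real N" "real N \<le> 2 * a" using a unfolding N_def by (simp_all, linarith)
  have N0: "0 < N" using N a by (cases N) auto
  define h where "h = (167 + 4 * C2) * (1 / a + y / a\<^sup>2)"
  \<comment> \<open>Likelihood slack: a^5 = p^(5/6) for the optimization error and 7 a^4 y for the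
    mean-field gap.\<close>
  define t0 where "t0 = a ^ 5 + 7 * (a ^ 4 * y)"
  define t where "t = t0 + (13 / 4 * C2 + 3) * p / N"
  define q where "q = h / 2 - 2 / N"
  have us: "unit_distribution \<mu>s" using \<mu>s P by (auto intro: unit_distribution_prior)
  have s0: "0 < ?s" using C1 by simp
  have E: "bad_large \<in> sets B" "bad_net \<mu>s N t q \<in> sets B" using bad_sets[OF us N0] by auto
  obtain Z where Z: "{\<omega> \<in> space ?J. \<not> \<epsilon> \<omega> \<le> real p powr (5/6)} \<subseteq> Z" "emeasure ?J Z = 0" "Z \<in> sets ?J"
    using eps by (rule AE_E)
  let ?E1 = "{\<omega> \<in> space ?J. stat (fst \<omega>) \<in> bad_large}" and ?E2 = "{\<omega> \<in> space ?J. stat (fst \<omega>) \<in> bad_net \<mu>s N t q}"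
  have m\<mu>s: "\<mu>s \<in> unit_priors" using \<mu>s P by auto
  note J1 = joint_law_stat[OF m\<mu>s E(1)] and J2 = joint_law_stat[OF m\<mu>s E(2)]
  have sub: "{\<omega> \<in> space ?J. (hellinger_dist lborel (\<mu>hat \<omega> \<star> gauss ?s) (\<mu>s \<star> gauss ?s))\<^sup>2 > h} \<subseteq> Z \<union> (?E1 \<union> ?E2)"
  proof
    fix \<omega> assume "\<omega> \<in> {\<omega> \<in> space ?J. (hellinger_dist lborel (\<mu>hat \<omega> \<star> gauss ?s) (\<mu>s \<star> gauss ?s))\<^sup>2 > h}"
    then have \<omega>: "\<omega> \<in> space ?J" and far: "h < (hellinger_dist lborel (\<mu>hat \<omega> \<star> gauss ?s) (\<mu>s \<star> gauss ?s))\<^sup>2" by auto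
    show "\<omega> \<in> Z \<union> (?E1 \<union> ?E2)"
    proof (rule ccontr)
      assume n: "\<omega> \<notin> Z \<union> (?E1 \<union> ?E2)"
      define w where "w = stat (fst \<omega>)"
      have w: "w \<in> space B" unfolding w_def stat_def by (simp add: space_PiM)
      have "\<epsilon> \<omega> \<le> real p powr (5/6)" using n Z(1) \<omega> by blast
      then have \<epsilon>: "\<epsilon> \<omega> \<le> a ^ 5" by (simp only: pows(1))
      have mh: "\<mu>hat \<omega> \<in> unit_priors" using hat[OF \<omega>] P by auto
      have uh: "unit_distribution (\<mu>hat \<omega>)" by (rule unit_distribution_prior[OF mh])
      \<comment> \<open>The truth uses the upper side of the approximation and the estimator the
        lower side, so the mean-field gap enters only once.\<close>
      obtain Ss where Ss: "(SUP \<gamma>\<in>carrier_vec p. ereal (mf_objective_shifted \<sigma> X \<gamma> (suff_stat \<sigma> X (vec n (fst \<omega>))) \<mu>s)) = ereal Ss"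
        "ln (Lr \<mu>s w) \<le> Ss + 7 * real p powr (2/3) * y"
        using mf_shifted_approximation[OF m\<mu>s, of "fst \<omega>"] unfolding w_def y_def by metis
      obtain Sh where Sh: "(SUP \<gamma>\<in>carrier_vec p. ereal (mf_objective_shifted \<sigma> X \<gamma> (suff_stat \<sigma> X (vec n (fst \<omega>))) (\<mu>hat \<omega>))) = ereal Sh"
        "Sh \<le> ln (Lr (\<mu>hat \<omega>) w)"
        using mf_shifted_approximation[OF mh, of "fst \<omega>"] unfolding w_def by metis
      have "ereal Ss \<le> ereal Sh + ereal (\<epsilon> \<omega>)"
        unfolding Ss(1)[symmetric] Sh(1)[symmetric] by (rule order_trans[OF SUP_upper[OF \<mu>s] max[OF \<omega>]])
      then have "Ss \<le> Sh + \<epsilon> \<omega>" by simp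
      then have "ln (Lr \<mu>s w) \<le> t0 + ln (Lr (\<mu>hat \<omega>) w)" using Ss(2)[unfolded pows(2)] Sh(2) \<epsilon> unfolding t0_def by simp
      then have "exp (ln (Lr \<mu>s w)) \<le> exp (t0 + ln (Lr (\<mu>hat \<omega>) w))" by simp
      then have near: "Lr \<mu>s w \<le> exp t0 * Lr (\<mu>hat \<omega>) w"
        using Lr_pos[OF us, of w] Lr_pos[OF uh, of w] by (simp add: exp_add)
      have "h < 1 - affinity ?s (\<mu>hat \<omega>) \<mu>s"
        using far unfolding unit_distribution.hellinger_affinity[OF uh s0 us] .
      moreover have "w \<notin> bad_large" using n \<omega> by (auto simp: w_def)
      ultimately have "w \<in> bad_net \<mu>s N t q"
        unfolding t_def q_def by (intro maximizer_in_bad[OF us uh N0 C1' w _ near])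
      then show False using n \<omega> by (auto simp: w_def)
    qed
  qed
  have "outer_measure_of ?J {\<omega> \<in> space ?J. (hellinger_dist lborel (\<mu>hat \<omega> \<star> gauss ?s) (\<mu>s \<star> gauss ?s))\<^sup>2 > h}
      \<le> outer_measure_of ?J (Z \<union> (?E1 \<union> ?E2))"
    using sub by (rule outer_measure_of_mono)
  also have "\<dots> = emeasure ?J (Z \<union> (?E1 \<union> ?E2))" using Z(3) J1(1) J2(1) by (intro outer_measure_of_eq) auto
  also have "\<dots> \<le> emeasure ?J Z + (emeasure ?J ?E1 + emeasure ?J ?E2)"
    using Z(3) J1(1) J2(1) by (intro order_trans[OF emeasure_subadditive] add_left_mono emeasure_subadditive) auto
  also have "\<dots> = pr \<mu>s bad_large + pr \<mu>s (bad_net \<mu>s N t q)"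
    unfolding J1(2) J2(2) Z(2) by simp
  also have "\<dots> \<le> ennreal (exp (- real p)) + ennreal (exp (9 * real N ^ 3 + t / 2 - q * p))"
    by (intro add_mono pr_bad_net[OF us N0] pr_large_stat[OF us]) (simp add: bad_large_def)
  also have "\<dots> = ennreal (exp (- real p) + exp (9 * real N ^ 3 + t / 2 - q * p))" by simp
  also have "\<dots> \<le> ennreal (2 * exp (- (real p powr (2/3)) / 2))"
  proof (rule ennreal_leI)
    have e1: "9 * real N ^ 3 + t / 2 - q * p \<le> - (a ^ 4)"
      using exponent_bound[OF a y N C2] unfolding t_def q_def h_def t0_def pows(4) .
    have e2: "a ^ 4 \<le> real p" unfolding pows(4) using a by (intro power_increasing) auto
    have e3: "0 \<le> a ^ 4" using a by simp
    \<comment> \<open>Halving the exponent lets the constant 2 serve both as prefactor and as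
      divisor in the final bound.\<close>
    have "exp (9 * real N ^ 3 + t / 2 - q * p) \<le> exp (- (a ^ 4) / 2)"
      unfolding exp_le_cancel_iff using e1 e3 by linarith
    moreover have "exp (- real p) \<le> exp (- (a ^ 4) / 2)"
      unfolding exp_le_cancel_iff using e2 e3 by linarith
    ultimately show "exp (- real p) + exp (9 * real N ^ 3 + t / 2 - q * p) \<le> 2 * exp (- (real p powr (2/3)) / 2)"
      unfolding pows(2) by linarith
  qed
  finally show ?thesis by (simp only: h_def pows(3) y_def a_def)
qed

end

theorem theorem2:
  shows
  "(\<exists>\<kappa>>0. \<forall>(C\<^sub>1 :: real) (C\<^sub>2 :: real) (\<sigma> :: real) (n :: nat) (p :: nat) (X :: real mat) (P :: real measure set).
      0 < C\<^sub>1 \<and> C\<^sub>1 \<le> 1 \<and> 1 \<le> C\<^sub>2 \<and> 0 < \<sigma> \<and> 0 < p \<and> X \<in> carrier_mat n p \<and>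
      C\<^sub>1 \<le> lambda_min (X\<^sup>T * X) / \<sigma>\<^sup>2 \<and> lambda_max (X\<^sup>T * X) / \<sigma>\<^sup>2 \<le> C\<^sub>2 \<and>
      closedin (subtopology weak_topology unit_priors) P \<longrightarrow>
      (SUP v\<in>carrier_vec p. SUP \<mu>\<in>P.
         \<bar>ereal (ln (partition_fun \<sigma> X v \<mu>))
            - (SUP \<gamma>\<in>carrier_vec p. ereal (mf_objective \<sigma> X \<gamma> v \<mu>))\<bar>)
      \<le> ereal (\<kappa> * real p powr (2/3)
                 * mat_trace (coupling \<sigma> X * coupling \<sigma> X) powr (1/3)))
   \<and>
   (\<forall>(C\<^sub>1 :: real) (C\<^sub>2 :: real). 0 < C\<^sub>1 \<and> C\<^sub>1 \<le> 1 \<and> 1 \<le> C\<^sub>2 \<longrightarrow>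
     (\<exists>c>0. \<exists>C>0. \<forall>(\<sigma> :: real) (n :: nat) (p :: nat) (X :: real mat) (P :: real measure set)
         (\<mu>s :: real measure)
         (\<mu>hat :: (nat \<Rightarrow> real) \<times> (nat \<Rightarrow> real) \<Rightarrow> real measure)
         (\<epsilon> :: (nat \<Rightarrow> real) \<times> (nat \<Rightarrow> real) \<Rightarrow> real).
        0 < \<sigma> \<and> 0 < p \<and> X \<in> carrier_mat n p \<and>
        C\<^sub>1 \<le> lambda_min (X\<^sup>T * X) / \<sigma>\<^sup>2 \<and> lambda_max (X\<^sup>T * X) / \<sigma>\<^sup>2 \<le> C\<^sub>2 \<and>
        closedin (subtopology weak_topology unit_priors) P \<and> \<mu>s \<in> P \<and>
        (\<forall>\<omega>\<in>space (joint_law \<sigma> X \<mu>s).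
           \<mu>hat \<omega> \<in> P \<and>
           (SUP \<mu>\<in>P. SUP \<gamma>\<in>carrier_vec p.
              ereal (mf_objective_shifted \<sigma> X \<gamma> (suff_stat \<sigma> X (vec n (fst \<omega>))) \<mu>))
           \<le> (SUP \<gamma>\<in>carrier_vec p.
                ereal (mf_objective_shifted \<sigma> X \<gamma> (suff_stat \<sigma> X (vec n (fst \<omega>))) (\<mu>hat \<omega>)))
             + ereal (\<epsilon> \<omega>)) \<and>
        (AE \<omega> in joint_law \<sigma> X \<mu>s. \<epsilon> \<omega> \<le> real p powr (5/6)) \<longrightarrow>
        outer_measure_of (joint_law \<sigma> X \<mu>s)
          {\<omega> \<in> space (joint_law \<sigma> X \<mu>s).
             (hellinger_dist lborel
                (\<mu>hat \<omega> \<star> density lborel (normal_density 0 (sqrt (1 / C\<^sub>1))))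
                (\<mu>s \<star> density lborel (normal_density 0 (sqrt (1 / C\<^sub>1)))))\<^sup>2
             > c * (1 / real p powr (1/6)
                    + mat_trace (coupling \<sigma> X * coupling \<sigma> X) powr (1/3) / real p powr (1/3))}
        \<le> ennreal (C * exp (- (real p powr (2/3)) / C))))"
proof (rule conjI, goal_cases)
  case 1
  show ?case
    by (intro exI[of _ 7] conjI allI impI mf_approximation_uniform) (auto dest: closedin_unit_priors)
next
  case 2
  show ?case
  proof (intro allI impI, goal_cases)
    case C: (1 C\<^sub>1 C\<^sub>2)
    show ?case
    proof (rule exI[of _ "167 + 4 * C\<^sub>2"], rule conjI, goal_cases)
      case 1
      show ?case using C by simp
    next
      case 2
      show ?case
      proof (rule exI[of _ 2], rule conjI, simp, intro allI impI, goal_cases)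
        case H: (1 \<sigma> n p X P \<mu>s \<mu>hat \<epsilon>)
        interpret regression_design n p X \<sigma> C\<^sub>1 C\<^sub>2
          using C H by (intro regression_design.intro regression_of_design regression_design_axioms.intro) auto
        show ?case
          by (rule hellinger_rate[where P = P and \<epsilon> = \<epsilon>]) (use C H closedin_unit_priors in auto)
      qed
    qed
  qed
qed

end
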